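(* Let $(M,g,\tau)$ be a fibered SKR $4$-manifold. On the regular set $M'$ of $\tau$, choose an orthonormal frame $\{e_i\}$ so that $e_1=w/|w|$ is the normalization of a horizontal lift $w$, $e_2=Je_1$, $e_3=u/\sqrt Q$ and $e_4=-v/\sqrt Q$. Writing $e^{ij}=e^i\wedge e^j$ for the dual coframe, the curvature matrix in this frame has the form $$[R_{ij}]=\begin{bmatrix}0&be^{12}+ce^{34}&r(e^{13}+e^{24})&r(e^{14}-e^{23})\\-(be^{12}+ce^{34})&0&-r(e^{14}-e^{23})&r(e^{13}+e^{24})\\-r(e^{13}+e^{24})&r(e^{14}-e^{23})&0&ce^{12}+de^{34}\\-r(e^{14}-e^{23})&-r(e^{13}+e^{24})&-(ce^{12}+de^{34})&0\end{bmatrix}$$ for certain functions $b,c,d,r$.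
   Context: **SKR structures.** Let $(M,J,g)$ be Kähler. A Killing potential is a smooth function $\tau$ such that $J\nabla\tau$ is a Killing field; $M'$ is the set of regular points of $\tau$. Put $v=\nabla\tau$, $u=Jv$, $Q=g(v,v)$, and on $M'$ let $\mathcal V=\operatorname{span}\{v,u\}$, $\mathcal H=\mathcal V^\perp$. $(g,\tau)$ is an SKR structure if $\tau$ is a nonconstant Killing potential and at each regular point all nonzero vectors of $\mathcal H$ are eigenvectors of both the Ricci endomorphism and the Hessian of $\tau$. Then on $M'$, $\nabla d\tau=\phi g$ on $\mathcal H$ and $\nabla d\tau=\psi g$ on $\mathcal V$ for functions $\phi,\psi$; $\phi,\psi,Q$ are locally functions of $\tau$; $\phi$ is either nowhere zero on $M'$ (irreducible case) or identically zero (reducible case), and in the irreducible case $Q=2(\tau-\bar c)\phi$ for a constant $\bar c$. **Fibered SKR manifolds.** A compact SKR manifold with boundary is $(M,g,\tau)$ with $M$ compact with boundary, $(g,\tau)$ an SKR structure on the interior extending smoothly to $\partial M=\tau^{-1}(0)$, $0$ being a regular value. It is fibered if: on $M'$ there is a fibration $\pi:M'\to N$ over a Kähler manifold $(N,h)$, locally that of a holomorphic line bundle with vertical distribution $\mathcal V$ and horizontal distribution $\mathcal H$ of a Chern connection, such that $g(\mathcal H,\mathcal V)=0$, $g=2|\tau-\bar c|\,\pi^*h$ on $\mathcal H$ in the irreducible case (respectively $g=\pi^*h$ on $\mathcal H$ in the reducible case), and $g=Q\theta^2/a^2+Q^{-1}d\tau^2$ on $\mathcal V$, where $a\ne0$ is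 a constant and $\theta$ is the $1$-form vanishing on $v$ and $\mathcal H$ with $\theta(u)=a$; horizontal lifts $w$ (sections of $\mathcal H$ projecting to vector fields on $N$, commuting with $u,v$) are defined on $M'$; and $u$ generates a circle action by isometries on $M$. **Curvature.** $R_{ij}=\sum_{k<l}R_{ijkl}e^k\wedge e^l$, $R_{ijkl}=\langle R(e_i,e_j)e_k,e_l\rangle$, with $R(a,b)c=\nabla_b\nabla_ac-\nabla_a\nabla_bc+\nabla_{[a,b]}c$. *)

theory Defs
  imports "HOL-Analysis.Analysis"
begin

section \<open>Smooth manifolds with boundary\<close>

text \<open>C-infinity on an open set: all iterated directional derivatives exist and are
  continuous; the arguments are finite-dimensional throughout.\<close>

primrec Ck_on :: "nat \<Rightarrow> ('a::real_normed_vector \<Rightarrow> 'b::real_normed_vector) \<Rightarrow> 'a set \<Rightarrow> bool" where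
  "Ck_on 0 f W \<longleftrightarrow> continuous_on W f"
| "Ck_on (Suc k) f W \<longleftrightarrow> f differentiable_on W \<and>
     (\<forall>v. Ck_on k (\<lambda>x. frechet_derivative f (at x) v) W)"

text \<open>Smoothness on a set that need not be open (here: relatively open in a half-space) means
  having local smooth extensions.\<close>

definition smooth_on :: "'a::euclidean_space set \<Rightarrow> ('a \<Rightarrow> 'b::real_normed_vector) \<Rightarrow> bool" where
  "smooth_on S f \<longleftrightarrow> (\<forall>x\<in>S. \<exists>W F. open W \<and> x \<in> W \<and> (\<forall>k. Ck_on k F W) \<and> (\<forall>y\<in>S \<inter> W. F y = f y))"

text \<open>A chart is a domain together with a coordinate map, only meaningful on the domain.\<close>

type_synonym ('m, 'e) chart = "'m set \<times> ('m \<Rightarrow> 'e)"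

abbreviation cdom :: "('m, 'e) chart \<Rightarrow> 'm set" where "cdom c \<equiv> fst c"
abbreviation cmap :: "('m, 'e) chart \<Rightarrow> 'm \<Rightarrow> 'e" where "cmap c \<equiv> snd c"
abbreviation cimg :: "('m, 'e) chart \<Rightarrow> 'e set" where "cimg c \<equiv> cmap c ` cdom c"
abbreviation cinv :: "('m, 'e) chart \<Rightarrow> 'e \<Rightarrow> 'm" where "cinv c \<equiv> inv_into (cdom c) (cmap c)"

definition pts :: "('m, 'e) chart set \<Rightarrow> 'm set" where
  "pts A = (\<Union>c\<in>A. cdom c)"

definition open_in :: "('m::topological_space, 'e) chart set \<Rightarrow> 'm set \<Rightarrow> bool" where
  "open_in A U \<longleftrightarrow> openin (top_of_set (pts A)) U"

text \<open>The chart images are relatively open in \<^term>\<open>{x. 0 \<le> x \<bullet> n}\<close>, which is a closed half-space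
  if \<open>n \<noteq> 0\<close> and the whole space if \<open>n = 0\<close>. The Hausdorff and second countability axioms are
  taken care of by the sorts of the point types.\<close>

definition smooth_manifold :: "('m::{t2_space,second_countable_topology}, 'e::euclidean_space) chart set \<Rightarrow> bool" where
  "smooth_manifold A \<longleftrightarrow>
     (\<forall>c\<in>A. open_in A (cdom c) \<and>
        (\<exists>n. openin (top_of_set {x. 0 \<le> x \<bullet> n}) (cimg c)) \<and>
        homeomorphism (cdom c) (cimg c) (cmap c) (cinv c)) \<and>
     (\<forall>c\<in>A. \<forall>d\<in>A. smooth_on (cmap c ` (cdom c \<inter> cdom d)) (cmap d \<circ> cinv c))"

definition minterior :: "('m, 'e::topological_space) chart set \<Rightarrow> 'm set" where
  "minterior A = {p. \<exists>c\<in>A. p \<in> cdom c \<and> cmap c p \<in> interior (cimg c)}"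

definition mboundary :: "('m, 'e::topological_space) chart set \<Rightarrow> 'm set" where
  "mboundary A = pts A - minterior A"

definition smooth_fun :: "('m, 'e::euclidean_space) chart set \<Rightarrow> 'm set \<Rightarrow> ('m \<Rightarrow> 'b::real_normed_vector) \<Rightarrow> bool" where
  "smooth_fun A U f \<longleftrightarrow> (\<forall>c\<in>A. smooth_on (cmap c ` (cdom c \<inter> U)) (f \<circ> cinv c))"

definition smooth_map :: "('m::topological_space, 'e::euclidean_space) chart set \<Rightarrow>
    ('n::topological_space, 'f::euclidean_space) chart set \<Rightarrow> 'm set \<Rightarrow> ('m \<Rightarrow> 'n) \<Rightarrow> bool" where
  "smooth_map A B U f \<longleftrightarrow> continuous_on U f \<and> f ` U \<subseteq> pts B \<and>
     (\<forall>c\<in>A. \<forall>d\<in>B. smooth_on (cmap c ` {p \<in> cdom c \<inter> U. f p \<in> cdom d}) (cmap d \<circ> f \<circ> cinv c))"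

definition diffeomorphism_on :: "('m::topological_space, 'e::euclidean_space) chart set \<Rightarrow>
    ('n::topological_space, 'f::euclidean_space) chart set \<Rightarrow> 'm set \<Rightarrow> 'n set \<Rightarrow> ('m \<Rightarrow> 'n) \<Rightarrow> bool" where
  "diffeomorphism_on A B S T f \<longleftrightarrow>
     (\<exists>k. homeomorphism S T f k \<and> smooth_map A B S f \<and> smooth_map B A T k)"

definition prod_atlas :: "('m, 'e) chart set \<Rightarrow> ('n, 'f) chart set \<Rightarrow> ('m \<times> 'n, 'e \<times> 'f) chart set" where
  "prod_atlas A B = {(cdom c \<times> cdom d, map_prod (cmap c) (cmap d)) | c d. c \<in> A \<and> d \<in> B}"

text \<open>The derivative at \<open>p\<close> of a function, read in the chart \<open>c\<close> and applied to the coordinate vector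
  \<open>x\<close>. Taking the derivative within the chart image gives it its meaning at boundary points,
  where it is still unique. The function need only be meaningful near \<open>p\<close>.\<close>

definition dd :: "('m, 'e::euclidean_space) chart \<Rightarrow> ('m \<Rightarrow> 'b::real_normed_vector) \<Rightarrow> 'm \<Rightarrow> 'e \<Rightarrow> 'b" where
  "dd c f p x = frechet_derivative (f \<circ> cinv c) (at (cmap c p) within cimg c) x"

definition dmap :: "('m, 'e::euclidean_space) chart \<Rightarrow> ('n, 'f::real_normed_vector) chart \<Rightarrow> ('m \<Rightarrow> 'n) \<Rightarrow> 'm \<Rightarrow> 'e \<Rightarrow> 'f" where
  "dmap c d f p x = dd c (\<lambda>q. cmap d (f q)) p x"

abbreviation trans_d :: "('m, 'e::euclidean_space) chart \<Rightarrow> ('m, 'e) chart \<Rightarrow> 'm \<Rightarrow> 'e \<Rightarrow> 'e" where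
  "trans_d c d p \<equiv> dmap c d id p"

section \<open>Tensor fields\<close>

text \<open>Tensor fields are families of coordinate expressions, one for each chart, related by the
  tensor transformation law. A tangent vector at \<open>p\<close>, read in a chart around \<open>p\<close>, is an arbitrary
  element of the model space.\<close>

type_synonym ('m, 'e) vfield = "('m, 'e) chart \<Rightarrow> 'm \<Rightarrow> 'e"
type_synonym ('m, 'e) oneform = "('m, 'e) chart \<Rightarrow> 'm \<Rightarrow> 'e \<Rightarrow> real"
type_synonym ('m, 'e) endofield = "('m, 'e) chart \<Rightarrow> 'm \<Rightarrow> 'e \<Rightarrow> 'e"
type_synonym ('m, 'e) bilfield = "('m, 'e) chart \<Rightarrow> 'm \<Rightarrow> 'e \<Rightarrow> 'e \<Rightarrow> real"

definition vector_field :: "('m::topological_space, 'e::euclidean_space) chart set \<Rightarrow> 'm set \<Rightarrow> ('m, 'e) vfield \<Rightarrow> bool" where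
  "vector_field A U X \<longleftrightarrow>
     (\<forall>c\<in>A. smooth_on (cmap c ` (cdom c \<inter> U)) (\<lambda>z. X c (cinv c z))) \<and>
     (\<forall>c\<in>A. \<forall>d\<in>A. \<forall>p\<in>cdom c \<inter> cdom d \<inter> U. X d p = trans_d c d p (X c p))"

definition one_form :: "('m::topological_space, 'e::euclidean_space) chart set \<Rightarrow> 'm set \<Rightarrow> ('m, 'e) oneform \<Rightarrow> bool" where
  "one_form A U \<alpha> \<longleftrightarrow>
     (\<forall>c\<in>A. (\<forall>p\<in>cdom c \<inter> U. linear (\<alpha> c p)) \<and>
        (\<forall>x. smooth_on (cmap c ` (cdom c \<inter> U)) (\<lambda>z. \<alpha> c (cinv c z) x))) \<and>
     (\<forall>c\<in>A. \<forall>d\<in>A. \<forall>p\<in>cdom c \<inter> cdom d \<inter> U. \<forall>x. \<alpha> d p (trans_d c d p x) = \<alpha> c p x)"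

definition endo_field :: "('m::topological_space, 'e::euclidean_space) chart set \<Rightarrow> 'm set \<Rightarrow> ('m, 'e) endofield \<Rightarrow> bool" where
  "endo_field A U J \<longleftrightarrow>
     (\<forall>c\<in>A. (\<forall>p\<in>cdom c \<inter> U. linear (J c p)) \<and>
        (\<forall>x. smooth_on (cmap c ` (cdom c \<inter> U)) (\<lambda>z. J c (cinv c z) x))) \<and>
     (\<forall>c\<in>A. \<forall>d\<in>A. \<forall>p\<in>cdom c \<inter> cdom d \<inter> U. \<forall>x.
        J d p (trans_d c d p x) = trans_d c d p (J c p x))"

definition riemannian_metric :: "('m::topological_space, 'e::euclidean_space) chart set \<Rightarrow> 'm set \<Rightarrow> ('m, 'e) bilfield \<Rightarrow> bool" where
  "riemannian_metric A U g \<longleftrightarrow>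
     (\<forall>c\<in>A. (\<forall>p\<in>cdom c \<inter> U. bilinear (g c p) \<and> (\<forall>x y. g c p x y = g c p y x) \<and>
                  (\<forall>x. x \<noteq> 0 \<longrightarrow> 0 < g c p x x)) \<and>
        (\<forall>x y. smooth_on (cmap c ` (cdom c \<inter> U)) (\<lambda>z. g c (cinv c z) x y))) \<and>
     (\<forall>c\<in>A. \<forall>d\<in>A. \<forall>p\<in>cdom c \<inter> cdom d \<inter> U. \<forall>x y.
        g d p (trans_d c d p x) (trans_d c d p y) = g c p x y)"

section \<open>Riemannian and Kaehler geometry\<close>

text \<open>The vector dual to a covector with respect to the metric.\<close>

definition sharp :: "('m, 'e) bilfield \<Rightarrow> ('m, 'e) chart \<Rightarrow> 'm \<Rightarrow> ('e \<Rightarrow> real) \<Rightarrow> 'e" where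
  "sharp g c p \<alpha> = (THE x. \<forall>y. g c p x y = \<alpha> y)"

definition grad :: "('m, 'e::euclidean_space) bilfield \<Rightarrow> ('m \<Rightarrow> real) \<Rightarrow> ('m, 'e) vfield" where
  "grad g f c p = sharp g c p (dd c f p)"

definition christoffel :: "('m, 'e::euclidean_space) bilfield \<Rightarrow> ('m, 'e) chart \<Rightarrow> 'm \<Rightarrow> 'e \<Rightarrow> 'e \<Rightarrow> 'e" where
  "christoffel g c p x y = sharp g c p (\<lambda>z.
     (dd c (\<lambda>q. g c q y z) p x + dd c (\<lambda>q. g c q x z) p y - dd c (\<lambda>q. g c q x y) p z) / 2)"

text \<open>Levi-Civita connection: \<^term>\<open>nabla g X Y\<close> is the covariant derivative of \<open>Y\<close> along \<open>X\<close>.\<close>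

definition nabla :: "('m, 'e::euclidean_space) bilfield \<Rightarrow> ('m, 'e) vfield \<Rightarrow> ('m, 'e) vfield \<Rightarrow> ('m, 'e) vfield" where
  "nabla g X Y c p = dd c (Y c) p (X c p) + christoffel g c p (X c p) (Y c p)"

definition lie_bracket :: "('m, 'e::euclidean_space) vfield \<Rightarrow> ('m, 'e) vfield \<Rightarrow> ('m, 'e) vfield" where
  "lie_bracket X Y c p = dd c (Y c) p (X c p) - dd c (X c) p (Y c p)"

text \<open>Note the sign convention, opposite to the more common one.\<close>

definition curv :: "('m, 'e::euclidean_space) bilfield \<Rightarrow> ('m, 'e) vfield \<Rightarrow> ('m, 'e) vfield \<Rightarrow> ('m, 'e) vfield \<Rightarrow> ('m, 'e) vfield" where
  "curv g X Y Z c p = nabla g Y (nabla g X Z) c p - nabla g X (nabla g Y Z) c p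
     + nabla g (lie_bracket X Y) Z c p"

text \<open>Extension of a coordinate vector to a field that is constant in the chart under consideration.
  It is used to evaluate tensorial expressions in a fixed chart; it does not obey the
  transformation law.\<close>

definition cfield :: "'e \<Rightarrow> ('m, 'e) vfield" where
  "cfield x = (\<lambda>c p. x)"

text \<open>With the above sign convention, the Ricci tensor (positive on spheres) is the trace of
  \<open>b \<mapsto> R(x,b)y\<close>.\<close>

definition ricci :: "('m, 'e::euclidean_space) bilfield \<Rightarrow> ('m, 'e) bilfield" where
  "ricci g c p x y = (\<Sum>b\<in>Basis. curv g (cfield x) (cfield b) (cfield y) c p \<bullet> b)"

definition ricci_endo :: "('m, 'e::euclidean_space) bilfield \<Rightarrow> ('m, 'e) endofield" where
  "ricci_endo g c p x = sharp g c p (ricci g c p x)"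

definition hess_endo :: "('m, 'e::euclidean_space) bilfield \<Rightarrow> ('m \<Rightarrow> real) \<Rightarrow> ('m, 'e) endofield" where
  "hess_endo g f c p x = nabla g (cfield x) (grad g f) c p"

definition hess :: "('m, 'e::euclidean_space) bilfield \<Rightarrow> ('m \<Rightarrow> real) \<Rightarrow> ('m, 'e) bilfield" where
  "hess g f c p x y = g c p (hess_endo g f c p x) y"

definition lie_metric :: "('m, 'e::euclidean_space) bilfield \<Rightarrow> ('m, 'e) vfield \<Rightarrow> ('m, 'e) bilfield" where
  "lie_metric g X c p x y = dd c (\<lambda>q. g c q x y) p (X c p)
     - g c p (lie_bracket X (cfield x) c p) y - g c p x (lie_bracket X (cfield y) c p)"

definition killing_field :: "('m::topological_space, 'e::euclidean_space) chart set \<Rightarrow> 'm set \<Rightarrow> ('m, 'e) bilfield \<Rightarrow> ('m, 'e) vfield \<Rightarrow> bool" where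
  "killing_field A U g X \<longleftrightarrow> vector_field A U X \<and>
     (\<forall>p\<in>U. \<forall>c\<in>A. p \<in> cdom c \<longrightarrow> (\<forall>x y. lie_metric g X c p x y = 0))"

text \<open>A Kaehler structure on the open set \<open>U\<close>: \<open>J\<close> is an almost complex structure, \<open>g\<close> is Hermitian,
  and \<open>J\<close> is parallel (which comprises integrability).\<close>

definition kaehler :: "('m::topological_space, 'e::euclidean_space) chart set \<Rightarrow> 'm set \<Rightarrow> ('m, 'e) bilfield \<Rightarrow> ('m, 'e) endofield \<Rightarrow> bool" where
  "kaehler A U g J \<longleftrightarrow> riemannian_metric A U g \<and> endo_field A U J \<and>
     (\<forall>p\<in>U. \<forall>c\<in>A. p \<in> cdom c \<longrightarrow>
        (\<forall>x. J c p (J c p x) = - x) \<and>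
        (\<forall>x y. g c p (J c p x) (J c p y) = g c p x y) \<and>
        (\<forall>x y. nabla g (cfield x) (\<lambda>c q. J c q y) c p = J c p (nabla g (cfield x) (cfield y) c p)))"

section \<open>SKR structures\<close>

definition regular_set :: "('m, 'e::euclidean_space) chart set \<Rightarrow> ('m \<Rightarrow> real) \<Rightarrow> 'm set" where
  "regular_set A \<tau> = {p. \<exists>c\<in>A. p \<in> cdom c \<and> (\<exists>x. dd c \<tau> p x \<noteq> 0)}"

definition Jgrad :: "('m, 'e::euclidean_space) bilfield \<Rightarrow> ('m, 'e) endofield \<Rightarrow> ('m \<Rightarrow> real) \<Rightarrow> ('m, 'e) vfield" where
  "Jgrad g J \<tau> c p = J c p (grad g \<tau> c p)"

definition Qfun :: "('m, 'e::euclidean_space) bilfield \<Rightarrow> ('m \<Rightarrow> real) \<Rightarrow> ('m, 'e) chart \<Rightarrow> 'm \<Rightarrow> real" where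
  "Qfun g \<tau> c p = g c p (grad g \<tau> c p) (grad g \<tau> c p)"

definition vert :: "('m, 'e::euclidean_space) bilfield \<Rightarrow> ('m, 'e) endofield \<Rightarrow> ('m \<Rightarrow> real) \<Rightarrow> ('m, 'e) chart \<Rightarrow> 'm \<Rightarrow> 'e set" where
  "vert g J \<tau> c p = span {grad g \<tau> c p, Jgrad g J \<tau> c p}"

definition horiz :: "('m, 'e::euclidean_space) bilfield \<Rightarrow> ('m, 'e) endofield \<Rightarrow> ('m \<Rightarrow> real) \<Rightarrow> ('m, 'e) chart \<Rightarrow> 'm \<Rightarrow> 'e set" where
  "horiz g J \<tau> c p = {x. \<forall>y\<in>vert g J \<tau> c p. g c p x y = 0}"

definition killing_potential :: "('m::topological_space, 'e::euclidean_space) chart set \<Rightarrow> 'm set \<Rightarrow> ('m, 'e) bilfield \<Rightarrow> ('m, 'e) endofield \<Rightarrow> ('m \<Rightarrow> real) \<Rightarrow> bool" where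
  "killing_potential A U g J \<tau> \<longleftrightarrow> smooth_fun A U \<tau> \<and> killing_field A U g (Jgrad g J \<tau>)"

definition skr_structure :: "('m::topological_space, 'e::euclidean_space) chart set \<Rightarrow> 'm set \<Rightarrow> ('m, 'e) bilfield \<Rightarrow> ('m, 'e) endofield \<Rightarrow> ('m \<Rightarrow> real) \<Rightarrow> bool" where
  "skr_structure A U g J \<tau> \<longleftrightarrow> kaehler A U g J \<and> killing_potential A U g J \<tau> \<and>
     (\<exists>p\<in>U. \<exists>q\<in>U. \<tau> p \<noteq> \<tau> q) \<and>
     (\<forall>p \<in> U \<inter> regular_set A \<tau>. \<forall>c\<in>A. p \<in> cdom c \<longrightarrow>
        (\<forall>x \<in> horiz g J \<tau> c p. x \<noteq> 0 \<longrightarrow>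
           (\<exists>\<nu>. ricci_endo g c p x = \<nu> *\<^sub>R x) \<and> (\<exists>\<mu>. hess_endo g \<tau> c p x = \<mu> *\<^sub>R x)))"

definition compact_skr_with_boundary :: "('m::{t2_space,second_countable_topology}, 'e::euclidean_space) chart set \<Rightarrow> ('m, 'e) bilfield \<Rightarrow> ('m, 'e) endofield \<Rightarrow> ('m \<Rightarrow> real) \<Rightarrow> bool" where
  "compact_skr_with_boundary A g J \<tau> \<longleftrightarrow> smooth_manifold A \<and> compact (pts A) \<and>
     riemannian_metric A (pts A) g \<and> endo_field A (pts A) J \<and> smooth_fun A (pts A) \<tau> \<and>
     skr_structure A (minterior A) g J \<tau> \<and>
     mboundary A = {p \<in> pts A. \<tau> p = 0} \<and>
     {p \<in> pts A. \<tau> p = 0} \<subseteq> regular_set A \<tau>"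

section \<open>Fibered SKR 4-manifolds\<close>

text \<open>Smooth locally trivial fibration of the open subset \<open>E\<close> over the whole base, with
  two-dimensional fibres, possibly with boundary. Up to diffeomorphism the typical fibre is one of
  the fibres, so there is no loss of generality in taking its points from the type of the total
  space.\<close>

definition fibration :: "('m::{t2_space,second_countable_topology}, real^4) chart set \<Rightarrow>
    ('n::{t2_space,second_countable_topology}, real^2) chart set \<Rightarrow> 'm set \<Rightarrow> ('m \<Rightarrow> 'n) \<Rightarrow> bool" where
  "fibration A B E \<pi> \<longleftrightarrow> smooth_map A B E \<pi> \<and> \<pi> ` E = pts B \<and>
     (\<forall>y\<in>pts B. \<exists>V. open_in B V \<and> y \<in> V \<and>
        (\<exists>(F :: ('m, real^2) chart set) t. smooth_manifold F \<and>
           diffeomorphism_on A (prod_atlas B F) {p\<in>E. \<pi> p \<in> V} (V \<times> pts F) t \<and>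
           (\<forall>p\<in>E. \<pi> p \<in> V \<longrightarrow> fst (t p) = \<pi> p)))"

text \<open>The Chern connection form of a Hermitian metric in a holomorphic frame of squared norm \<open>\<kappa>\<close>,
  that is, the (1,0)-part of \<open>d (ln \<kappa>)\<close>.\<close>

definition chern_form :: "('n, 'f::euclidean_space) endofield \<Rightarrow> ('n \<Rightarrow> real) \<Rightarrow> ('n, 'f) chart \<Rightarrow> 'n \<Rightarrow> 'f \<Rightarrow> complex" where
  "chern_form J \<kappa> d y Y =
     (of_real (dd d (\<lambda>z. ln (\<kappa> z)) y Y) - \<i> * of_real (dd d (\<lambda>z. ln (\<kappa> z)) y (J d y Y))) / 2"

text \<open>Near each point, \<open>\<pi>\<close> is the projection of a holomorphic line bundle over an open set \<open>V\<close>, which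
  may be assumed trivialised by a holomorphic frame of squared norm \<open>\<kappa>\<close>: with the holomorphic fibre
  coordinate \<open>\<zeta>\<close>, the pair \<open>(\<pi>, \<zeta>)\<close> is a holomorphic injective immersion into the total space
  \<open>V \<times> \<complex>\<close>. The vertical distribution, the kernel of \<open>d\<pi>\<close>, is the span of the gradient of \<open>\<tau>\<close> and
  its \<open>J\<close>-image; the horizontal distribution of the Chern connection is its orthogonal complement.\<close>

definition locally_line_bundle :: "('m::topological_space, 'e::euclidean_space) chart set \<Rightarrow>
    ('m, 'e) bilfield \<Rightarrow> ('m, 'e) endofield \<Rightarrow> ('m \<Rightarrow> real) \<Rightarrow>
    ('n::topological_space, 'f::euclidean_space) chart set \<Rightarrow> ('n, 'f) endofield \<Rightarrow>
    'm set \<Rightarrow> ('m \<Rightarrow> 'n) \<Rightarrow> bool" where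
  "locally_line_bundle A g J \<tau> B J' E \<pi> \<longleftrightarrow>
     (\<forall>p\<in>E. \<exists>U V (\<zeta> :: 'm \<Rightarrow> complex) (\<kappa> :: 'n \<Rightarrow> real).
        open_in A U \<and> p \<in> U \<and> U \<subseteq> E \<and> open_in B V \<and> \<pi> ` U \<subseteq> V \<and>
        smooth_fun A U \<zeta> \<and> smooth_fun B V \<kappa> \<and> (\<forall>y\<in>V. 0 < \<kappa> y) \<and>
        inj_on (\<lambda>q. (\<pi> q, \<zeta> q)) U \<and>
        (\<forall>q\<in>U. \<forall>c\<in>A. \<forall>d\<in>B. q \<in> cdom c \<longrightarrow> \<pi> q \<in> cdom d \<longrightarrow>
           (\<forall>x. dmap c d \<pi> q (J c q x) = J' d (\<pi> q) (dmap c d \<pi> q x)) \<and>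
           (\<forall>x. dd c \<zeta> q (J c q x) = \<i> * dd c \<zeta> q x) \<and>
           (\<forall>x. dmap c d \<pi> q x = 0 \<longrightarrow> dd c \<zeta> q x = 0 \<longrightarrow> x = 0) \<and>
           {x. dmap c d \<pi> q x = 0} = vert g J \<tau> c q \<and>
           {x. dd c \<zeta> q x + \<zeta> q * chern_form J' \<kappa> d (\<pi> q) (dmap c d \<pi> q x) = 0} = horiz g J \<tau> c q))"

text \<open>A horizontal lift, defined on the open set \<open>U\<close>, of the vector field \<open>X\<close> on the open set \<open>V\<close>.\<close>

definition horizontal_lift :: "('m::topological_space, 'e::euclidean_space) chart set \<Rightarrow>
    ('m, 'e) bilfield \<Rightarrow> ('m, 'e) endofield \<Rightarrow> ('m \<Rightarrow> real) \<Rightarrow>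
    ('n::topological_space, 'f::euclidean_space) chart set \<Rightarrow> ('m \<Rightarrow> 'n) \<Rightarrow>
    'm set \<Rightarrow> 'n set \<Rightarrow> ('n, 'f) vfield \<Rightarrow> ('m, 'e) vfield \<Rightarrow> bool" where
  "horizontal_lift A g J \<tau> B \<pi> U V X w \<longleftrightarrow>
     open_in A U \<and> U \<subseteq> regular_set A \<tau> \<and> open_in B V \<and> \<pi> ` U \<subseteq> V \<and>
     vector_field B V X \<and> vector_field A U w \<and>
     (\<forall>p\<in>U. \<forall>c\<in>A. p \<in> cdom c \<longrightarrow>
        w c p \<in> horiz g J \<tau> c p \<and>
        (\<forall>d\<in>B. \<pi> p \<in> cdom d \<longrightarrow> dmap c d \<pi> p (w c p) = X d (\<pi> p)) \<and>
        lie_bracket w (Jgrad g J \<tau>) c p = 0 \<and> lie_bracket w (grad g \<tau>) c p = 0)"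

text \<open>The metric condition on horizontal vectors, for a conformal factor \<open>f\<close>.\<close>

definition horizontal_metric :: "('m::topological_space, 'e::euclidean_space) chart set \<Rightarrow>
    ('m, 'e) bilfield \<Rightarrow> ('m, 'e) endofield \<Rightarrow> ('m \<Rightarrow> real) \<Rightarrow>
    ('n::topological_space, 'f::euclidean_space) chart set \<Rightarrow> ('n, 'f) bilfield \<Rightarrow>
    ('m \<Rightarrow> 'n) \<Rightarrow> ('m \<Rightarrow> real) \<Rightarrow> bool" where
  "horizontal_metric A g J \<tau> B h \<pi> f \<longleftrightarrow>
     (\<forall>p\<in>regular_set A \<tau>. \<forall>c\<in>A. \<forall>d\<in>B. p \<in> cdom c \<longrightarrow> \<pi> p \<in> cdom d \<longrightarrow>
        (\<forall>x\<in>horiz g J \<tau> c p. \<forall>y\<in>horiz g J \<tau> c p.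
           g c p x y = f p * h d (\<pi> p) (dmap c d \<pi> p x) (dmap c d \<pi> p y)))"

definition vertical_metric :: "('m::topological_space, 'e::euclidean_space) chart set \<Rightarrow>
    ('m, 'e) bilfield \<Rightarrow> ('m, 'e) endofield \<Rightarrow> ('m \<Rightarrow> real) \<Rightarrow> bool" where
  "vertical_metric A g J \<tau> \<longleftrightarrow>
     (\<exists>a \<theta>. a \<noteq> 0 \<and> one_form A (regular_set A \<tau>) \<theta> \<and>
        (\<forall>p\<in>regular_set A \<tau>. \<forall>c\<in>A. p \<in> cdom c \<longrightarrow>
           \<theta> c p (grad g \<tau> c p) = 0 \<and> (\<forall>x\<in>horiz g J \<tau> c p. \<theta> c p x = 0) \<and>
           \<theta> c p (Jgrad g J \<tau> c p) = a \<and>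
           (\<forall>x\<in>vert g J \<tau> c p. \<forall>y\<in>vert g J \<tau> c p.
              g c p x y = Qfun g \<tau> c p * (\<theta> c p x * \<theta> c p y) / a\<^sup>2
                + dd c \<tau> p x * dd c \<tau> p y / Qfun g \<tau> c p)))"

text \<open>The circle is \<open>\<real> / T\<int>\<close>.\<close>

definition generates_isometric_circle_action :: "('m::topological_space, 'e::euclidean_space) chart set \<Rightarrow>
    ('m, 'e) bilfield \<Rightarrow> ('m, 'e) vfield \<Rightarrow> bool" where
  "generates_isometric_circle_action A g X \<longleftrightarrow>
     (\<exists>(\<Phi> :: real \<Rightarrow> 'm \<Rightarrow> 'm) T. 0 < T \<and>
        smooth_map (prod_atlas {(UNIV, id)} A) A (UNIV \<times> pts A) (\<lambda>(t, p). \<Phi> t p) \<and>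
        (\<forall>p\<in>pts A. \<Phi> 0 p = p \<and> \<Phi> T p = p \<and> (\<forall>s t. \<Phi> (s + t) p = \<Phi> s (\<Phi> t p))) \<and>
        (\<forall>t. \<forall>p\<in>pts A. \<forall>d\<in>A. \<Phi> t p \<in> cdom d \<longrightarrow>
           ((\<lambda>s. cmap d (\<Phi> s p)) has_vector_derivative X d (\<Phi> t p)) (at t) \<and>
           (\<forall>c\<in>A. p \<in> cdom c \<longrightarrow> (\<forall>x y.
              g d (\<Phi> t p) (dmap c d (\<Phi> t) p x) (dmap c d (\<Phi> t) p y) = g c p x y))))"

text \<open>Here \<open>\<phi>\<close> is the eigenvalue function of the Hessian on the horizontal
  distribution. Orthogonality of the two distributions needs no mention since the horizontal
  distribution of the Chern connection equals the orthogonal complement of the vertical one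
  in \<^const>\<open>locally_line_bundle\<close>.\<close>

definition fibered_skr_4manifold :: "('m::{t2_space,second_countable_topology}, real^4) chart set \<Rightarrow>
    ('m, real^4) bilfield \<Rightarrow> ('m, real^4) endofield \<Rightarrow> ('m \<Rightarrow> real) \<Rightarrow>
    ('n::{t2_space,second_countable_topology}, real^2) chart set \<Rightarrow>
    ('n, real^2) bilfield \<Rightarrow> ('n, real^2) endofield \<Rightarrow> ('m \<Rightarrow> 'n) \<Rightarrow> bool" where
  "fibered_skr_4manifold A g J \<tau> B h J' \<pi> \<longleftrightarrow>
     compact_skr_with_boundary A g J \<tau> \<and>
     smooth_manifold B \<and> mboundary B = {} \<and> kaehler B (pts B) h J' \<and>
     fibration A B (regular_set A \<tau>) \<pi> \<and>
     locally_line_bundle A g J \<tau> B J' (regular_set A \<tau>) \<pi> \<and>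
     (\<exists>\<phi>. (\<forall>p\<in>regular_set A \<tau>. \<forall>c\<in>A. p \<in> cdom c \<longrightarrow>
              (\<forall>x\<in>horiz g J \<tau> c p. \<forall>y\<in>horiz g J \<tau> c p. hess g \<tau> c p x y = \<phi> p * g c p x y)) \<and>
          ((\<exists>cbar. (\<forall>p\<in>regular_set A \<tau>. \<phi> p \<noteq> 0 \<and>
                      (\<forall>c\<in>A. p \<in> cdom c \<longrightarrow> Qfun g \<tau> c p = 2 * (\<tau> p - cbar) * \<phi> p)) \<and>
                   horizontal_metric A g J \<tau> B h \<pi> (\<lambda>p. 2 * \<bar>\<tau> p - cbar\<bar>)) \<or>
           ((\<forall>p\<in>regular_set A \<tau>. \<phi> p = 0) \<and> horizontal_metric A g J \<tau> B h \<pi> (\<lambda>p. 1)))) \<and>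
     vertical_metric A g J \<tau> \<and>
     (\<forall>X. vector_field B (pts B) X \<longrightarrow>
        (\<exists>w. horizontal_lift A g J \<tau> B \<pi> (regular_set A \<tau>) (pts B) X w)) \<and>
     generates_isometric_circle_action A g (Jgrad g J \<tau>)"

section \<open>Frames and the curvature matrix\<close>

text \<open>Frames, coframes and matrices are indexed by 1, ..., 4.\<close>

definition skr_frame :: "('m, 'e::euclidean_space) bilfield \<Rightarrow> ('m, 'e) endofield \<Rightarrow> ('m \<Rightarrow> real) \<Rightarrow>
    ('m, 'e) vfield \<Rightarrow> nat \<Rightarrow> ('m, 'e) vfield" where
  "skr_frame g J \<tau> w i c p =
     (if i = 1 then (1 / sqrt (g c p (w c p) (w c p))) *\<^sub>R w c p
      else if i = 2 then J c p ((1 / sqrt (g c p (w c p) (w c p))) *\<^sub>R w c p)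
      else if i = 3 then (1 / sqrt (Qfun g \<tau> c p)) *\<^sub>R Jgrad g J \<tau> c p
      else - ((1 / sqrt (Qfun g \<tau> c p)) *\<^sub>R grad g \<tau> c p))"

definition dual_coframe :: "(nat \<Rightarrow> ('m, 'e::euclidean_space) vfield) \<Rightarrow> nat \<Rightarrow> ('m, 'e) oneform" where
  "dual_coframe e k c p =
     (THE \<alpha>. linear \<alpha> \<and> (\<forall>l\<in>{1..4}. \<alpha> (e l c p) = (if k = l then 1 else 0)))"

definition coframe_wedge :: "(nat \<Rightarrow> ('m, 'e::euclidean_space) vfield) \<Rightarrow> nat \<Rightarrow> nat \<Rightarrow> ('m, 'e) bilfield" where
  "coframe_wedge e k l c p x y =
     dual_coframe e k c p x * dual_coframe e l c p y - dual_coframe e k c p y * dual_coframe e l c p x"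

definition curv_comp :: "('m, 'e::euclidean_space) bilfield \<Rightarrow> (nat \<Rightarrow> ('m, 'e) vfield) \<Rightarrow>
    nat \<Rightarrow> nat \<Rightarrow> nat \<Rightarrow> nat \<Rightarrow> ('m, 'e) chart \<Rightarrow> 'm \<Rightarrow> real" where
  "curv_comp g e i j k l c p = g c p (curv g (e i) (e j) (e k) c p) (e l c p)"

definition curv_form :: "('m, 'e::euclidean_space) bilfield \<Rightarrow> (nat \<Rightarrow> ('m, 'e) vfield) \<Rightarrow>
    nat \<Rightarrow> nat \<Rightarrow> ('m, 'e) bilfield" where
  "curv_form g e i j c p x y =
     (\<Sum>k\<in>{1..4}. \<Sum>l\<in>{k<..4}. curv_comp g e i j k l c p * coframe_wedge e k l c p x y)"

end

theory Submission
  imports Defs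
begin

text \<open>
  Write \<open>v = \<nabla>\<tau>\<close>, \<open>u = Jv\<close>, let \<open>H\<close> be the Hessian endomorphism \<open>x \<mapsto> \<nabla>\<^sub>x v\<close> and let \<open>\<phi>\<close> be its
  eigenvalue on the horizontal distribution. \<open>H\<close> is symmetric, and it commutes with \<open>J\<close> because
  \<open>u\<close> is a Killing field and \<open>J\<close> is parallel; hence the vertical plane is an eigenspace as well,
  with eigenvalue \<open>\<psi>\<close>, and every member of the adapted frame satisfies \<open>H e\<^sub>i = \<lambda>\<^sub>i e\<^sub>i\<close> with
  \<open>\<lambda>\<^sub>1 = \<lambda>\<^sub>2 = \<phi>\<close> and \<open>\<lambda>\<^sub>3 = \<lambda>\<^sub>4 = \<psi>\<close>.

  The Ricci identity \<open>R(x,y)v = (\<nabla>\<^sub>y H)x - (\<nabla>\<^sub>x H)y\<close> therefore expresses all components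
  \<open>R\<^sub>i\<^sub>j\<^sub>4\<^sub>k\<close> through derivatives of the two eigenvalues and through the connection coefficients of
  the frame multiplied by differences of eigenvalues (\<open>Rm_grad\<close>). Only coefficients involving
  \<open>e\<^sub>3\<close> or \<open>e\<^sub>4\<close> survive in the components at issue, and these are given by \<open>H\<close> again (\<open>\<omega>_4\<close>,
  \<open>\<omega>_3\<close>). One further fact enters: \<open>\<phi>\<close> is constant in horizontal directions
  (\<open>dd_\<phi>_horizontal\<close>), because \<open>Q = 2(\<tau> - \<kappa>)\<phi>\<close> unless \<open>\<phi>\<close> vanishes identically, and both
  \<open>\<tau>\<close> and \<open>Q\<close> are constant in these directions. The outcome is that \<open>R\<^sub>1\<^sub>2\<^sub>4\<^sub>k\<close> and \<open>R\<^sub>3\<^sub>4\<^sub>4\<^sub>k\<close>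
  vanish for \<open>k = 1, 2\<close> and that \<open>R\<^sub>i\<^sub>4\<^sub>4\<^sub>k\<close> is a multiple of the identity for \<open>i, k = 1, 2\<close>. The
  symmetries of a Kaehler curvature tensor, invariance under \<open>J\<close> in each pair of slots and
  symmetry under exchange of the pairs, turn this into the asserted matrix
  (\<open>skr_curvature_patternI\<close>); the entry \<open>c\<close> occurs twice by pair symmetry.

  Two matters remain. The Kaehler and Killing equations are available in the interior
  of the manifold only, whereas the frame is defined up to the boundary. All quantities are smooth
  up to the boundary in coordinates, and interior points are dense, so the resulting equations
  extend by continuity (\<open>curvature_pattern_closed\<close>). Moreover \<open>b\<close>, \<open>c\<close>, \<open>d\<close>, \<open>r\<close> have to be
  functions of the point alone, which amounts to the compatibility of covariant derivatives
  and Lie brackets with coordinate changes (\<open>curv_comp_chart_independent\<close>).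
\<close>

section \<open>Smooth functions on open sets\<close>

lemma Ck_on_cong:
  assumes "open W" "\<And>x. x \<in> W \<Longrightarrow> f x = g x"
  shows "Ck_on k f W \<longleftrightarrow> Ck_on k g W"
proof -
  have imp: "Ck_on k f W \<Longrightarrow> Ck_on k g W" if "\<And>x. x \<in> W \<Longrightarrow> f x = g x" for f g :: "'a \<Rightarrow> 'b"
    using that
  proof (induction k arbitrary: f g)
    case 0
    then show ?case by (auto cong: continuous_on_cong)
  next
    case (Suc k)
    have df: "f differentiable at x" if "x \<in> W" for x
      using Suc.prems(1) that \<open>open W\<close> by (auto simp: differentiable_on_eq_differentiable_at)
    have eq: "frechet_derivative f (at x) = frechet_derivative g (at x)" if "x \<in> W" for x
      using frechet_derivative_transform_within_open[OF df[OF that] \<open>open W\<close> that] Suc.prems(2) by auto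
    have "g differentiable at x" if "x \<in> W" for x
      using df[OF that] has_derivative_transform_within_open[OF _ \<open>open W\<close> that, of f _ UNIV g] Suc.prems(2)
      unfolding differentiable_def by blast
    then have "g differentiable_on W"
      using \<open>open W\<close> by (auto simp: differentiable_on_eq_differentiable_at)
    moreover have "Ck_on k (\<lambda>x. frechet_derivative g (at x) v) W" for v
      using Suc.IH[of "\<lambda>x. frechet_derivative f (at x) v" "\<lambda>x. frechet_derivative g (at x) v"] Suc.prems(1) eq
      by auto
    ultimately show ?case by simp
  qed
  show ?thesis using imp[of f g] imp[of g f] assms(2) by auto
qed

lemma Ck_on_subset: "Ck_on k f W \<Longrightarrow> V \<subseteq> W \<Longrightarrow> Ck_on k f V"
  by (induction k arbitrary: f) (auto intro: continuous_on_subset differentiable_on_subset)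

lemma Ck_on_SucD: "Ck_on (Suc k) f W \<Longrightarrow> Ck_on k f W"
proof (induction k arbitrary: f)
  case 0
  then show ?case by (simp add: differentiable_imp_continuous_on)
next
  case (Suc k)
  then have "f differentiable_on W" and d: "\<And>v. Ck_on (Suc k) (\<lambda>x. frechet_derivative f (at x) v) W"
    by (auto simp del: Ck_on.simps(2) simp: Ck_on.simps(2)[of "Suc k"])
  with Suc.IH[OF d] show ?case by simp
qed

text \<open>The derivative may be supplied as any explicit formula \<open>f'\<close>; inductions
  over the order of differentiability use the closure lemmas for order \<open>k\<close> on that
  formula.\<close>

lemma Ck_on_SucI:
  assumes "open W" "\<And>x. x \<in> W \<Longrightarrow> (f has_derivative f' x) (at x)"
    and "\<And>v. Ck_on k (\<lambda>x. f' x v) W"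
  shows "Ck_on (Suc k) f W"
proof -
  have "f differentiable_on W"
    using assms(1,2) by (auto simp: differentiable_on_eq_differentiable_at differentiable_def)
  moreover have "Ck_on k (\<lambda>x. frechet_derivative f (at x) v) W" for v
    by (rule iffD1[OF Ck_on_cong[OF assms(1)] assms(3)])
       (use frechet_derivative_at[OF assms(2)] in simp)
  ultimately show ?thesis by simp
qed

lemma Ck_on_Suc_has_derivative:
  assumes "open W" "Ck_on (Suc k) f W" "x \<in> W"
  shows "(f has_derivative frechet_derivative f (at x)) (at x)"
  using assms by (auto simp: differentiable_on_eq_differentiable_at frechet_derivative_works)

lemma Ck_on_const: "Ck_on k (\<lambda>x. a) W"
  by (induction k arbitrary: a) simp_all

lemma Ck_on_bounded_linear:
  assumes "open W" "bounded_linear L" "Ck_on k f W"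
  shows "Ck_on k (\<lambda>x. L (f x)) W"
  using assms(3)
proof (induction k arbitrary: f)
  case 0
  then show ?case using bounded_linear.continuous_on[OF assms(2)] by auto
next
  case (Suc k)
  show ?case
  proof (rule Ck_on_SucI[OF assms(1)])
    show "((\<lambda>x. L (f x)) has_derivative (\<lambda>v. L (frechet_derivative f (at x) v))) (at x)" if "x \<in> W" for x
      using bounded_linear.has_derivative[OF assms(2) Ck_on_Suc_has_derivative[OF assms(1) Suc.prems that]] .
    show "Ck_on k (\<lambda>x. L (frechet_derivative f (at x) v)) W" for v
      using Suc by auto
  qed
qed

lemma Ck_on_add:
  assumes "open W" "Ck_on k f W" "Ck_on k g W"
  shows "Ck_on k (\<lambda>x. f x + g x) W"
  using assms(2,3)
proof (induction k arbitrary: f g)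
  case 0
  then show ?case by (auto intro: continuous_intros)
next
  case (Suc k)
  show ?case
  proof (rule Ck_on_SucI[OF assms(1)])
    show "((\<lambda>x. f x + g x) has_derivative (\<lambda>v. frechet_derivative f (at x) v + frechet_derivative g (at x) v)) (at x)"
      if "x \<in> W" for x
      using has_derivative_add Ck_on_Suc_has_derivative[OF assms(1) _ that] Suc.prems by blast
    show "Ck_on k (\<lambda>x. frechet_derivative f (at x) v + frechet_derivative g (at x) v) W" for v
      using Suc by auto
  qed
qed

lemma Ck_on_bilinear:
  assumes "open W" "bounded_bilinear B" "Ck_on k f W" "Ck_on k g W"
  shows "Ck_on k (\<lambda>x. B (f x) (g x)) W"
  using assms(3,4)
proof (induction k arbitrary: f g)
  case 0
  then show ?case using bounded_bilinear.continuous_on[OF assms(2)] by auto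
next
  case (Suc k)
  show ?case
  proof (rule Ck_on_SucI[OF assms(1)])
    show "((\<lambda>x. B (f x) (g x)) has_derivative
        (\<lambda>v. B (f x) (frechet_derivative g (at x) v) + B (frechet_derivative f (at x) v) (g x))) (at x)"
      if "x \<in> W" for x
      by (rule bounded_bilinear.FDERIV[OF assms(2)]; rule Ck_on_Suc_has_derivative[OF assms(1) _ that]; rule Suc.prems)
    show "Ck_on k (\<lambda>x. B (f x) (frechet_derivative g (at x) v) + B (frechet_derivative f (at x) v) (g x)) W" for v
      using Suc.IH Suc.prems(1,2) Ck_on_SucD[OF Suc.prems(1)] Ck_on_SucD[OF Suc.prems(2)]
      by (intro Ck_on_add[OF assms(1)]) simp_all
  qed
qed

lemmas Ck_on_mult = Ck_on_bilinear[OF _ bounded_bilinear_mult]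

lemma Ck_on_inverse:
  fixes f :: "'a::real_normed_vector \<Rightarrow> real"
  assumes "open W" "Ck_on k f W" "\<And>x. x \<in> W \<Longrightarrow> f x \<noteq> 0"
  shows "Ck_on k (\<lambda>x. inverse (f x)) W"
  using assms(2)
proof (induction k)
  case 0
  then show ?case using assms(3) by (auto intro: continuous_intros)
next
  case (Suc k)
  note IH = Suc.IH[OF Ck_on_SucD[OF Suc.prems]]
  show ?case
  proof (rule Ck_on_SucI[OF assms(1)])
    show "((\<lambda>x. inverse (f x)) has_derivative
        (\<lambda>v. (-1) * (inverse (f x) * frechet_derivative f (at x) v * inverse (f x)))) (at x)"
      if "x \<in> W" for x
      using Deriv.has_derivative_inverse[OF assms(3)[OF that] Ck_on_Suc_has_derivative[OF assms(1) Suc.prems that]]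
      by simp
    show "Ck_on k (\<lambda>x. (-1) * (inverse (f x) * frechet_derivative f (at x) v * inverse (f x))) W" for v
      using Suc.prems by (intro Ck_on_mult assms(1) IH Ck_on_const) simp
  qed
qed

text \<open>With \<open>s = f\<^sup>-\<^sup>1\<^sup>/\<^sup>2\<close> the derivative is
  \<open>-1/2 f' s\<^sup>3\<close>, a product of functions that are already known to be
  differentiable \<open>k\<close> times, so the induction closes without any reference to
  \<open>sqrt\<close> itself.\<close>

lemma Ck_on_inverse_sqrt:
  fixes f :: "'a::real_normed_vector \<Rightarrow> real"
  assumes "open W" "Ck_on k f W" "\<And>x. x \<in> W \<Longrightarrow> 0 < f x"
  shows "Ck_on k (\<lambda>x. inverse (sqrt (f x))) W"
  using assms(2)
proof (induction k)
  case 0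
  then show ?case using assms(3) by (fastforce intro: continuous_intros)
next
  case (Suc k)
  note IH = Suc.IH[OF Ck_on_SucD[OF Suc.prems]]
  let ?s = "\<lambda>x. inverse (sqrt (f x))"
  show ?case
  proof (rule Ck_on_SucI[OF assms(1)])
    show "(?s has_derivative (\<lambda>v. (-1/2) * (frechet_derivative f (at x) v * (?s x * (?s x * ?s x))))) (at x)"
      if "x \<in> W" for x
    proof -
      note pos = assms(3)[OF that]
      have "((\<lambda>y. inverse (sqrt y)) has_real_derivative (- 1/2 * (?s x * (?s x * ?s x)))) (at (f x))"
        using pos by (auto intro!: derivative_eq_intros simp: field_simps power2_eq_square)
      from DERIV_compose_FDERIV[OF this Ck_on_Suc_has_derivative[OF assms(1) Suc.prems that]]
      show ?thesis by (simp add: mult_ac)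
    qed
    show "Ck_on k (\<lambda>x. (-1/2) * (frechet_derivative f (at x) v * (?s x * (?s x * ?s x)))) W" for v
      using Suc.prems by (intro Ck_on_mult assms(1) IH Ck_on_const) simp
  qed
qed

text \<open>The mean value theorem in the \<open>x\<close> direction, applied to the difference of
  \<open>f\<close> in the \<open>y\<close> direction, and then a second time in the
  \<open>y\<close> direction.\<close>

lemma second_difference_mean_value:
  fixes f :: "'a::real_normed_vector \<Rightarrow> real"
  assumes W: "open W" and f: "Ck_on 2 f W" and s: "0 < s"
    and sub: "\<And>\<xi> \<eta>. \<xi> \<in> {0..s} \<Longrightarrow> \<eta> \<in> {0..s} \<Longrightarrow> z + \<xi> *\<^sub>R x + \<eta> *\<^sub>R y \<in> W"
  shows "\<exists>\<xi>\<in>{0..s}. \<exists>\<eta>\<in>{0..s}. f (z + s *\<^sub>R x + s *\<^sub>R y) - f (z + s *\<^sub>R x) - f (z + s *\<^sub>R y) + f z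
     = s\<^sup>2 * frechet_derivative (\<lambda>q. frechet_derivative f (at q) x) (at (z + \<xi> *\<^sub>R x + \<eta> *\<^sub>R y)) y"
proof -
  let ?D = "\<lambda>q. frechet_derivative f (at q) x"
  have f1: "Ck_on (Suc 1) f W" using f by (simp add: numeral_2_eq_2)
  have f2: "Ck_on (Suc 0) ?D W" using f1 by simp
  note d1 = Ck_on_Suc_has_derivative[OF W f1]
  note d2 = Ck_on_Suc_has_derivative[OF W f2]
  have lin: "frechet_derivative f (at q) (h *\<^sub>R x) = h * ?D q" if "q \<in> W" for q h
    using linear_cmul[OF has_derivative_linear[OF d1[OF that]]] by simp
  have lin2: "frechet_derivative ?D (at q) (h *\<^sub>R y) = h * frechet_derivative ?D (at q) y" if "q \<in> W" for q h
    using linear_cmul[OF has_derivative_linear[OF d2[OF that]]] by simp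
  define \<phi> where "\<phi> t = f (z + t *\<^sub>R x + s *\<^sub>R y) - f (z + t *\<^sub>R x)" for t
  have dphi: "(\<phi> has_derivative (\<lambda>h. h * (?D (z + t *\<^sub>R x + s *\<^sub>R y) - ?D (z + t *\<^sub>R x)))) (at t within {0..s})"
    if "0 \<le> t" "t \<le> s" for t
  proof -
    have m: "z + t *\<^sub>R x + s *\<^sub>R y \<in> W" "z + t *\<^sub>R x \<in> W"
      using sub[of t s] sub[of t 0] that s by auto
    have "((\<lambda>t. f (z + t *\<^sub>R x + s *\<^sub>R y)) has_derivative
        (\<lambda>h. frechet_derivative f (at (z + t *\<^sub>R x + s *\<^sub>R y)) (h *\<^sub>R x))) (at t within {0..s})"
      by (rule has_derivative_compose[where f = "\<lambda>t. z + t *\<^sub>R x + s *\<^sub>R y", OF _ d1[OF m(1)]]) (auto intro!: derivative_eq_intros)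
    moreover have "((\<lambda>t. f (z + t *\<^sub>R x)) has_derivative
        (\<lambda>h. frechet_derivative f (at (z + t *\<^sub>R x)) (h *\<^sub>R x))) (at t within {0..s})"
      by (rule has_derivative_compose[where f = "\<lambda>t. z + t *\<^sub>R x", OF _ d1[OF m(2)]]) (auto intro!: derivative_eq_intros)
    ultimately show ?thesis
      unfolding \<phi>_def using has_derivative_diff
      by (fastforce simp: lin m right_diff_distrib)
  qed
  from mvt_very_simple[OF less_imp_le[OF s] dphi] obtain \<xi> where xi: "\<xi> \<in> {0..s}"
    and 1: "\<phi> s - \<phi> 0 = s * (?D (z + \<xi> *\<^sub>R x + s *\<^sub>R y) - ?D (z + \<xi> *\<^sub>R x))"
    by auto
  have "((\<lambda>t. ?D (z + \<xi> *\<^sub>R x + t *\<^sub>R y)) has_derivative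
      (\<lambda>h. h * frechet_derivative ?D (at (z + \<xi> *\<^sub>R x + t *\<^sub>R y)) y)) (at t within {0..s})"
    if "0 \<le> t" "t \<le> s" for t
  proof -
    have m: "z + \<xi> *\<^sub>R x + t *\<^sub>R y \<in> W" using sub[of \<xi> t] that xi by auto
    have "((\<lambda>t. ?D (z + \<xi> *\<^sub>R x + t *\<^sub>R y)) has_derivative
        (\<lambda>h. frechet_derivative ?D (at (z + \<xi> *\<^sub>R x + t *\<^sub>R y)) (h *\<^sub>R y))) (at t within {0..s})"
      by (rule has_derivative_compose[where f = "\<lambda>t. z + \<xi> *\<^sub>R x + t *\<^sub>R y", OF _ d2[OF m]]) (auto intro!: derivative_eq_intros)
    then show ?thesis by (simp add: lin2 m)
  qed
  from mvt_very_simple[OF less_imp_le[OF s] this] obtain \<eta> where eta: "\<eta> \<in> {0..s}"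
    and 2: "?D (z + \<xi> *\<^sub>R x + s *\<^sub>R y) - ?D (z + \<xi> *\<^sub>R x)
       = s * frechet_derivative ?D (at (z + \<xi> *\<^sub>R x + \<eta> *\<^sub>R y)) y"
    by auto
  show ?thesis
    using 1 2 xi eta unfolding \<phi>_def by (intro bexI[of _ \<xi>] bexI[of _ \<eta>]) (auto simp: power2_eq_square)
qed

text \<open>The second difference does not change when \<open>x\<close> and \<open>y\<close> are
  swapped, so both mixed derivatives take a common value at points arbitrarily close to
  \<open>z\<close>; continuity then forces them to agree at \<open>z\<close>.\<close>

lemma second_derivative_symmetric_real:
  fixes f :: "'a::real_normed_vector \<Rightarrow> real"
  assumes W: "open W" and f: "Ck_on 2 f W" and z: "z \<in> W"
  shows "frechet_derivative (\<lambda>q. frechet_derivative f (at q) x) (at z) y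
       = frechet_derivative (\<lambda>q. frechet_derivative f (at q) y) (at z) x" (is "?A z = ?B z")
proof (rule ccontr)
  assume "?A z \<noteq> ?B z"
  define e where "e = \<bar>?A z - ?B z\<bar> / 2"
  have e: "0 < e" using \<open>?A z \<noteq> ?B z\<close> by (simp add: e_def)
  have "continuous_on W ?A" "continuous_on W ?B"
    using f by (simp_all add: numeral_2_eq_2)
  then have "isCont ?A z" "isCont ?B z"
    using W z continuous_on_eq_continuous_at by blast+
  then have "(?A \<longlongrightarrow> ?A z) (nhds z)" "(?B \<longlongrightarrow> ?B z) (nhds z)"
    using tendsto_at_iff_tendsto_nhds[of ?A z] tendsto_at_iff_tendsto_nhds[of ?B z] by (simp_all add: isCont_def)
  then have "\<forall>\<^sub>F q in nhds z. dist (?A q) (?A z) < e \<and> dist (?B q) (?B z) < e"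
    using e by (intro eventually_conj tendstoD)
  then have "\<forall>\<^sub>F q in nhds z. q \<in> W \<and> dist (?A q) (?A z) < e \<and> dist (?B q) (?B z) < e"
    using eventually_nhds_in_open[OF W z] by eventually_elim simp
  then obtain r where r: "0 < r" "\<And>q. dist q z < r \<Longrightarrow> q \<in> W \<and> dist (?A q) (?A z) < e \<and> dist (?B q) (?B z) < e"
    unfolding eventually_nhds_metric by blast
  \<comment> \<open>Small enough for the whole parallelogram with sides \<open>s x\<close> and \<open>s y\<close> to lie in the ball of radius \<open>r\<close>.\<close>
  define s where "s = r / (norm x + norm y + 1)"
  have s: "0 < s" using r(1) by (simp add: s_def add_nonneg_pos)
  have small: "dist (z + \<xi> *\<^sub>R x + \<eta> *\<^sub>R y) z < r" if "\<xi> \<in> {0..s}" "\<eta> \<in> {0..s}" for \<xi> \<eta>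
  proof -
    have "dist (z + \<xi> *\<^sub>R x + \<eta> *\<^sub>R y) z \<le> \<xi> * norm x + \<eta> * norm y"
      using norm_triangle_ineq[of "\<xi> *\<^sub>R x" "\<eta> *\<^sub>R y"] that by (simp add: dist_norm algebra_simps)
    also have "\<dots> \<le> s * norm x + s * norm y"
      using that by (intro add_mono mult_right_mono) auto
    also have "\<dots> < s * (norm x + norm y + 1)" using s by (simp add: algebra_simps)
    also have "\<dots> = r" by (simp add: s_def add_nonneg_pos less_imp_neq[symmetric])
    finally show ?thesis .
  qed
  obtain \<xi> \<eta> where 1: "\<xi> \<in> {0..s}" "\<eta> \<in> {0..s}"
    "f (z + s *\<^sub>R x + s *\<^sub>R y) - f (z + s *\<^sub>R x) - f (z + s *\<^sub>R y) + f z = s\<^sup>2 * ?A (z + \<xi> *\<^sub>R x + \<eta> *\<^sub>R y)"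
    using second_difference_mean_value[OF W f s, of z x y] small r(2) by blast
  obtain \<xi>' \<eta>' where 2: "\<xi>' \<in> {0..s}" "\<eta>' \<in> {0..s}"
    "f (z + s *\<^sub>R y + s *\<^sub>R x) - f (z + s *\<^sub>R y) - f (z + s *\<^sub>R x) + f z = s\<^sup>2 * ?B (z + \<xi>' *\<^sub>R y + \<eta>' *\<^sub>R x)"
  proof -
    have "z + \<xi> *\<^sub>R y + \<eta> *\<^sub>R x \<in> W" if "\<xi> \<in> {0..s}" "\<eta> \<in> {0..s}" for \<xi> \<eta>
      using r(2)[OF small[OF that(2,1)]] by (simp add: add_ac)
    then show thesis using second_difference_mean_value[OF W f s, of z y x] that by blast
  qed
  have "f (z + s *\<^sub>R x + s *\<^sub>R y) = f (z + s *\<^sub>R y + s *\<^sub>R x)" by (simp add: add_ac)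
  then have "s\<^sup>2 * ?A (z + \<xi> *\<^sub>R x + \<eta> *\<^sub>R y) = s\<^sup>2 * ?B (z + \<xi>' *\<^sub>R y + \<eta>' *\<^sub>R x)"
    using 1(3) 2(3) by linarith
  then have eq: "?A (z + \<xi> *\<^sub>R x + \<eta> *\<^sub>R y) = ?B (z + \<eta>' *\<^sub>R x + \<xi>' *\<^sub>R y)"
    using s by (simp add: add_ac)
  have a: "dist (?A (z + \<xi> *\<^sub>R x + \<eta> *\<^sub>R y)) (?A z) < e"
    using r(2)[OF small[OF 1(1,2)]] by simp
  have b: "dist (?B (z + \<eta>' *\<^sub>R x + \<xi>' *\<^sub>R y)) (?B z) < e"
    using r(2)[OF small[OF 2(2,1)]] by simp
  have "dist (?A z) (?B z) \<le> dist (?A (z + \<xi> *\<^sub>R x + \<eta> *\<^sub>R y)) (?A z) + dist (?B (z + \<eta>' *\<^sub>R x + \<xi>' *\<^sub>R y)) (?B z)"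
    unfolding eq by (metis dist_commute dist_triangle)
  with a b show False by (simp add: e_def dist_real_def)
qed

lemma second_derivative_symmetric:
  fixes f :: "'a::real_normed_vector \<Rightarrow> 'b::euclidean_space"
  assumes W: "open W" and f: "Ck_on 2 f W" and z: "z \<in> W"
  shows "frechet_derivative (\<lambda>q. frechet_derivative f (at q) x) (at z) y
       = frechet_derivative (\<lambda>q. frechet_derivative f (at q) y) (at z) x"
proof (rule euclidean_eqI)
  fix b :: 'b
  let ?F = "\<lambda>q. f q \<bullet> b"
  have f1: "Ck_on (Suc 1) f W" using f by (simp add: numeral_2_eq_2)
  have F: "Ck_on 2 ?F W"
    by (rule Ck_on_bounded_linear[OF W bounded_linear_inner_left f])
  have dF: "frechet_derivative ?F (at q) v = frechet_derivative f (at q) v \<bullet> b" if "q \<in> W" for q v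
    using frechet_derivative_at[OF bounded_linear.has_derivative[OF bounded_linear_inner_left
      Ck_on_Suc_has_derivative[OF W f1 that], of b]] by metis
  have ddF: "frechet_derivative (\<lambda>q. frechet_derivative ?F (at q) v) (at z) u
      = frechet_derivative (\<lambda>q. frechet_derivative f (at q) v) (at z) u \<bullet> b" for u v
  proof -
    have "Ck_on (Suc 0) (\<lambda>q. frechet_derivative f (at q) v) W" using f1 by simp
    note d = bounded_linear.has_derivative[OF bounded_linear_inner_left
      Ck_on_Suc_has_derivative[OF W this z], of b]
    have "((\<lambda>q. frechet_derivative ?F (at q) v) has_derivative
      (\<lambda>u. frechet_derivative (\<lambda>q. frechet_derivative f (at q) v) (at z) u \<bullet> b)) (at z)"
      by (rule has_derivative_transform_within_open[OF d W z]) (simp add: dF)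
    from frechet_derivative_at[OF this] show ?thesis by metis
  qed
  show "frechet_derivative (\<lambda>q. frechet_derivative f (at q) x) (at z) y \<bullet> b
      = frechet_derivative (\<lambda>q. frechet_derivative f (at q) y) (at z) x \<bullet> b"
    using second_derivative_symmetric_real[OF W F z, of x y] by (simp add: ddF)
qed

lemma Ck_on_sum:
  assumes "open W" "finite I" "\<And>i. i \<in> I \<Longrightarrow> Ck_on k (f i) W"
  shows "Ck_on k (\<lambda>x. \<Sum>i\<in>I. f i x) W"
  using assms(2,3) by (induction I) (auto intro: Ck_on_const Ck_on_add[OF assms(1)])

text \<open>The chain rule evaluates the derivative of \<open>f\<close> in the varying direction
  \<open>Dg(v)\<close>, while \<open>Ck_on\<close> speaks of constant directions only. Expanding
  \<open>Dg(v)\<close> in the basis reduces the former to the latter.\<close>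

lemma Ck_on_compose:
  fixes f :: "'a::euclidean_space \<Rightarrow> 'b::real_normed_vector" and g :: "'c::real_normed_vector \<Rightarrow> 'a"
  assumes "open W" "open V" "Ck_on k g W" "g ` W \<subseteq> V" "Ck_on k f V"
  shows "Ck_on k (\<lambda>x. f (g x)) W"
  using assms(3-5)
proof (induction k arbitrary: f g)
  case 0
  then show ?case by (auto intro: continuous_on_compose2)
next
  case (Suc k)
  have gV: "g x \<in> V" if "x \<in> W" for x using Suc.prems(2) that by auto
  note df = Ck_on_Suc_has_derivative[OF assms(2) Suc.prems(3) gV]
  note dg = Ck_on_Suc_has_derivative[OF assms(1) Suc.prems(1)]
  show ?case
  proof (rule Ck_on_SucI[OF assms(1)])
    show "((\<lambda>x. f (g x)) has_derivative
        (\<lambda>v. \<Sum>b\<in>Basis. (frechet_derivative g (at x) v \<bullet> b) *\<^sub>R frechet_derivative f (at (g x)) b)) (at x)"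
      if "x \<in> W" for x
    proof -
      note lin = has_derivative_linear[OF df[OF that]]
      have "frechet_derivative f (at (g x)) u = (\<Sum>b\<in>Basis. (u \<bullet> b) *\<^sub>R frechet_derivative f (at (g x)) b)" for u
        by (subst (1) euclidean_representation[of u, symmetric])
           (simp only: linear_sum[OF lin] linear_cmul[OF lin])
      then have eq: "(\<lambda>v. frechet_derivative f (at (g x)) (frechet_derivative g (at x) v))
        = (\<lambda>v. \<Sum>b\<in>Basis. (frechet_derivative g (at x) v \<bullet> b) *\<^sub>R frechet_derivative f (at (g x)) b)"
        by (intro ext)
      then show ?thesis
        using has_derivative_compose[OF dg[OF that] df[OF that]] by (simp only: eq)
    qed
    show "Ck_on k (\<lambda>x. \<Sum>b\<in>Basis. (frechet_derivative g (at x) v \<bullet> b) *\<^sub>R frechet_derivative f (at (g x)) b) W" for v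
    proof (rule Ck_on_sum[OF assms(1) finite_Basis], rule Ck_on_bilinear[OF assms(1) bounded_bilinear_scaleR])
      show "Ck_on k (\<lambda>x. frechet_derivative g (at x) v \<bullet> b) W" for b
        using Suc.prems(1) by (intro Ck_on_bounded_linear[OF assms(1) bounded_linear_inner_left]) simp
      show "Ck_on k (\<lambda>x. frechet_derivative f (at (g x)) b) W" for b
        by (rule Suc.IH[OF Ck_on_SucD[OF Suc.prems(1)] Suc.prems(2)]) (use Suc.prems(3) in simp)
    qed
  qed
qed

section \<open>Smooth functions on relatively open subsets of a half-space\<close>

lemma smooth_onE:
  assumes "smooth_on S f" "z \<in> S"
  obtains W F where "open W" "z \<in> W" "\<forall>k. Ck_on k F W" "\<forall>y\<in>S \<inter> W. F y = f y"
proof -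
  from assms obtain W F where "open W" "z \<in> W" "\<forall>k. Ck_on k F W" "\<forall>y\<in>S \<inter> W. F y = f y"
    unfolding smooth_on_def by meson
  then show thesis by (rule that)
qed

lemma smooth_onI:
  assumes "\<And>z. z \<in> S \<Longrightarrow> \<exists>W F. open W \<and> z \<in> W \<and> (\<forall>k. Ck_on k F W) \<and> (\<forall>y\<in>S \<inter> W. F y = f y)"
  shows "smooth_on S f"
  using assms unfolding smooth_on_def by simp

lemma smooth_on_cong: "(\<And>x. x \<in> S \<Longrightarrow> f x = g x) \<Longrightarrow> smooth_on S f \<longleftrightarrow> smooth_on S g"
  unfolding smooth_on_def by auto

lemma smooth_on_subset: "smooth_on S f \<Longrightarrow> T \<subseteq> S \<Longrightarrow> smooth_on T f"
proof (rule smooth_onI)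
  fix z assume "z \<in> T" "smooth_on S f" "T \<subseteq> S"
  then have "z \<in> S" by auto
  obtain W F where
    "open W" "z \<in> W" "\<forall>k. Ck_on k F W" "\<forall>y\<in>S \<inter> W. F y = f y"
    by (rule smooth_onE[OF \<open>smooth_on S f\<close> \<open>z \<in> S\<close>])
  with \<open>T \<subseteq> S\<close> show "\<exists>W F. open W \<and> z \<in> W \<and> (\<forall>k. Ck_on k F W) \<and> (\<forall>y\<in>T \<inter> W. F y = f y)"
    by (intro exI[of _ W] exI[of _ F]) auto
qed

lemma smooth_on_const: "smooth_on S (\<lambda>x. a)"
  by (rule smooth_onI, rule exI[of _ UNIV], rule exI[of _ "\<lambda>x. a"]) (simp add: Ck_on_const)

lemma smooth_on_bounded_linear:
  assumes "bounded_linear L" "smooth_on S f"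
  shows "smooth_on S (\<lambda>x. L (f x))"
proof (rule smooth_onI)
  fix z assume z: "z \<in> S"
  obtain W F where
    "open W" "z \<in> W" "\<forall>k. Ck_on k F W" "\<forall>y\<in>S \<inter> W. F y = f y"
    by (rule smooth_onE[OF assms(2) z])
  then show "\<exists>W F. open W \<and> z \<in> W \<and> (\<forall>k. Ck_on k F W) \<and> (\<forall>y\<in>S \<inter> W. F y = L (f y))"
    by (intro exI[of _ W] exI[of _ "\<lambda>x. L (F x)"]) (auto intro!: Ck_on_bounded_linear[OF _ assms(1)])
qed

lemma smooth_on_bilinear:
  assumes "bounded_bilinear B" "smooth_on S f" "smooth_on S g"
  shows "smooth_on S (\<lambda>x. B (f x) (g x))"
proof (rule smooth_onI)
  fix z assume z: "z \<in> S"
  obtain W F where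
    1: "open W" "z \<in> W" "\<forall>k. Ck_on k F W" "\<forall>y\<in>S \<inter> W. F y = f y"
    by (rule smooth_onE[OF assms(2) z])
  obtain W' F' where
    2: "open W'" "z \<in> W'" "\<forall>k. Ck_on k F' W'" "\<forall>y\<in>S \<inter> W'. F' y = g y"
    by (rule smooth_onE[OF assms(3) z])
  have "Ck_on k (\<lambda>x. B (F x) (F' x)) (W \<inter> W')" for k
    by (rule Ck_on_bilinear[OF _ assms(1)]) (simp_all add: open_Int 1(1) 2(1) Ck_on_subset[OF 1(3)[rule_format]] Ck_on_subset[OF 2(3)[rule_format]])
  then show "\<exists>W F. open W \<and> z \<in> W \<and> (\<forall>k. Ck_on k F W) \<and> (\<forall>y\<in>S \<inter> W. F y = B (f y) (g y))"
    using 1 2 by (intro exI[of _ "W \<inter> W'"] exI[of _ "\<lambda>x. B (F x) (F' x)"]) auto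
qed

lemma smooth_on_add:
  assumes "smooth_on S f" "smooth_on S g"
  shows "smooth_on S (\<lambda>x. f x + g x)"
proof (rule smooth_onI)
  fix z assume z: "z \<in> S"
  obtain W F where
    1: "open W" "z \<in> W" "\<forall>k. Ck_on k F W" "\<forall>y\<in>S \<inter> W. F y = f y"
    by (rule smooth_onE[OF assms(1) z])
  obtain W' F' where
    2: "open W'" "z \<in> W'" "\<forall>k. Ck_on k F' W'" "\<forall>y\<in>S \<inter> W'. F' y = g y"
    by (rule smooth_onE[OF assms(2) z])
  have "Ck_on k (\<lambda>x. F x + F' x) (W \<inter> W')" for k
    by (rule Ck_on_add) (simp_all add: open_Int 1(1) 2(1) Ck_on_subset[OF 1(3)[rule_format]] Ck_on_subset[OF 2(3)[rule_format]])
  then show "\<exists>W F. open W \<and> z \<in> W \<and> (\<forall>k. Ck_on k F W) \<and> (\<forall>y\<in>S \<inter> W. F y = f y + g y)"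
    using 1 2 by (intro exI[of _ "W \<inter> W'"] exI[of _ "\<lambda>x. F x + F' x"]) auto
qed

lemma smooth_on_compose_Ck:
  fixes f :: "'a::real_normed_vector \<Rightarrow> 'b::real_normed_vector"
  fixes g :: "'c::euclidean_space \<Rightarrow> 'a"
  assumes g: "smooth_on S g" and gV: "g ` S \<subseteq> V" and V: "open V"
    and Ck: "\<And>k W (G :: 'c \<Rightarrow> 'a). open W \<Longrightarrow> Ck_on k G W \<Longrightarrow> G ` W \<subseteq> V \<Longrightarrow> Ck_on k (\<lambda>x. f (G x)) W"
  shows "smooth_on S (\<lambda>x. f (g x))"
proof (rule smooth_onI)
  fix z assume z: "z \<in> S"
  obtain W G where
    1: "open W" "z \<in> W" "\<forall>k. Ck_on k G W" "\<forall>y\<in>S \<inter> W. G y = g y"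
    by (rule smooth_onE[OF g z])
  let ?W = "W \<inter> G -` V"
  have op: "open ?W" using continuous_open_preimage[OF _ 1(1) V] 1(3)[rule_format, of 0] by simp
  then have "Ck_on k (\<lambda>x. f (G x)) ?W" for k
    by (intro Ck[OF op] Ck_on_subset[OF 1(3)[rule_format]]) auto
  then show "\<exists>W F. open W \<and> z \<in> W \<and> (\<forall>k. Ck_on k F W) \<and> (\<forall>y\<in>S \<inter> W. F y = f (g y))"
    using op 1 z gV by (intro exI[of _ ?W] exI[of _ "\<lambda>x. f (G x)"]) auto
qed

lemma smooth_on_inverse:
  fixes f :: "'c::euclidean_space \<Rightarrow> real"
  assumes "smooth_on S f" "\<And>x. x \<in> S \<Longrightarrow> f x \<noteq> 0"
  shows "smooth_on S (\<lambda>x. inverse (f x))"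
proof (rule smooth_on_compose_Ck[OF assms(1), where V = "- {0}"])
  show "Ck_on k (\<lambda>x. inverse (G x)) W" if "open W" "Ck_on k G W" "G ` W \<subseteq> - {0}"
    for k W and G :: "'c \<Rightarrow> real"
    by (rule Ck_on_inverse[OF that(1,2)]) (use that(3) in auto)
qed (use assms(2) in auto)

lemma smooth_on_inverse_sqrt:
  fixes f :: "'c::euclidean_space \<Rightarrow> real"
  assumes "smooth_on S f" "\<And>x. x \<in> S \<Longrightarrow> 0 < f x"
  shows "smooth_on S (\<lambda>x. inverse (sqrt (f x)))"
proof (rule smooth_on_compose_Ck[OF assms(1), where V = "{0<..}"])
  show "Ck_on k (\<lambda>x. inverse (sqrt (G x))) W" if "open W" "Ck_on k G W" "G ` W \<subseteq> {0<..}"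
    for k W and G :: "'c \<Rightarrow> real"
    by (rule Ck_on_inverse_sqrt[OF that(1,2)]) (use that(3) in auto)
qed (use assms(2) in auto)

lemma smooth_on_compose:
  fixes f :: "'a::euclidean_space \<Rightarrow> 'b::real_normed_vector" and g :: "'c::euclidean_space \<Rightarrow> 'a"
  assumes g: "smooth_on S g" and gT: "g ` S \<subseteq> T" and f: "smooth_on T f"
  shows "smooth_on S (\<lambda>x. f (g x))"
proof (rule smooth_onI)
  fix z assume z: "z \<in> S"
  obtain W G where
    1: "open W" "z \<in> W" "\<forall>k. Ck_on k G W" "\<forall>y\<in>S \<inter> W. G y = g y"
    by (rule smooth_onE[OF g z])
  from z gT have gz: "g z \<in> T" by auto
  obtain V F where
    2: "open V" "g z \<in> V" "\<forall>k. Ck_on k F V" "\<forall>y\<in>T \<inter> V. F y = f y"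
    by (rule smooth_onE[OF f gz])
  let ?W = "W \<inter> G -` V"
  have op: "open ?W" using continuous_open_preimage[OF _ 1(1) 2(1)] 1(3)[rule_format, of 0] by simp
  have "Ck_on k (\<lambda>x. F (G x)) ?W" for k
    by (rule Ck_on_compose[OF op 2(1) Ck_on_subset[OF 1(3)[rule_format]] _ 2(3)[rule_format]]) auto
  then show "\<exists>W F. open W \<and> z \<in> W \<and> (\<forall>k. Ck_on k F W) \<and> (\<forall>y\<in>S \<inter> W. F y = f (g y))"
    using op 1 2 z gT by (intro exI[of _ ?W] exI[of _ "\<lambda>x. F (G x)"]) auto
qed

lemma smooth_on_continuous_on:
  assumes "smooth_on S f"
  shows "continuous_on S f"
proof -
  have local: "\<exists>W. open W \<and> z \<in> W \<and> continuous_on (S \<inter> W) f" if z: "z \<in> S" for z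
  proof -
    obtain W F where
      1: "open W" "z \<in> W" "\<forall>k. Ck_on k F W" "\<forall>y\<in>S \<inter> W. F y = f y"
    by (rule smooth_onE[OF assms z])
    have "continuous_on (S \<inter> W) F" using 1(3)[rule_format, of 0] by (auto intro: continuous_on_subset)
    then have "continuous_on (S \<inter> W) f" using 1(4) continuous_on_cong[of "S \<inter> W" "S \<inter> W" F f] by simp
    with 1 show ?thesis by blast
  qed
  have "continuous (at z within S) f" if z: "z \<in> S" for z
  proof -
    obtain W where W: "open W" "z \<in> W" "continuous_on (S \<inter> W) f"
      using local[OF z] by auto
    have eq: "at z within S \<inter> W = at z within S"
      using W(1,2) by (intro at_within_nhd[of z W]) auto
    have "continuous (at z within S \<inter> W) f"
      using W z by (auto simp: continuous_on_eq_continuous_within)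
    then show ?thesis by (simp only: eq)
  qed
  then show ?thesis by (simp add: continuous_on_eq_continuous_within)
qed

text \<open>This is the shape of a chart image of a manifold with boundary; \<open>n = 0\<close>
  gives the open sets.\<close>

definition half_space_open :: "'a::euclidean_space set \<Rightarrow> bool" where
  "half_space_open S \<longleftrightarrow> (\<exists>n. openin (top_of_set {x. 0 \<le> x \<bullet> n}) S)"

text \<open>At any point of a half-space each basis direction can be followed for a short while in
  at least one of its two senses, and that determines a derivative.\<close>

lemma has_derivative_unique_half_space_open:
  fixes f :: "'a::euclidean_space \<Rightarrow> 'b::real_normed_vector"
  assumes "half_space_open S" "z \<in> S"
    and "(f has_derivative f') (at z within S)" "(f has_derivative f'') (at z within S)"
  shows "f' = f''"
proof (rule frechet_derivative_unique_within[OF assms(3,4)])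
  fix i :: 'a and e :: real assume i: "i \<in> Basis" and e: "0 < e"
  from assms(1) obtain n W where n: "open W" "S = {x. 0 \<le> x \<bullet> n} \<inter> W"
    unfolding half_space_open_def openin_open by blast
  with assms(2) obtain r where r: "0 < r" "ball z r \<subseteq> W" by (meson IntD2 openE)
  \<comment> \<open>The step is taken towards the side of the half-space to which \<open>i\<close> or \<open>- i\<close> points.\<close>
  define s :: real where "s = min e r / 2"
  define d where "d = (if 0 \<le> i \<bullet> n then s else - s)"
  have s: "0 < s" "s < e" "s < r" using e r by (auto simp: s_def)
  have "z + d *\<^sub>R i \<in> ball z r" using s i by (auto simp: d_def dist_norm)
  moreover have "0 \<le> d * (i \<bullet> n)"
    using s by (auto simp: d_def mult_nonneg_nonneg mult_nonpos_nonpos intro: mult_nonneg_nonpos)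
  ultimately have "z + d *\<^sub>R i \<in> S"
    using assms(2) r(2) n(2) by (auto simp: inner_add_left)
  then show "\<exists>d. 0 < \<bar>d\<bar> \<and> \<bar>d\<bar> < e \<and> z + d *\<^sub>R i \<in> S"
    using s by (intro exI[of _ d]) (auto simp: d_def)
qed

lemma frechet_derivative_half_space_open:
  fixes f :: "'a::euclidean_space \<Rightarrow> 'b::real_normed_vector"
  assumes "half_space_open S" "z \<in> S" "(f has_derivative f') (at z within S)"
  shows "frechet_derivative f (at z within S) = f'"
  by (rule has_derivative_unique_half_space_open[OF assms(1,2) _ assms(3)])
     (use assms(3) frechet_derivative_works differentiable_def in blast)

text \<open>By uniqueness, derivatives within the set are computed by any local extension. This
  transports the calculus on open sets to boundary points.\<close>

lemma smooth_on_derivativeE: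
  fixes f :: "'a::euclidean_space \<Rightarrow> 'b::real_normed_vector"
  assumes S: "half_space_open S" and f: "smooth_on S f" and z: "z \<in> S"
  obtains W F where "open W" "z \<in> W" "\<forall>k. Ck_on k F W" "\<forall>y\<in>S \<inter> W. F y = f y"
    "\<forall>y\<in>S \<inter> W. (f has_derivative frechet_derivative F (at y)) (at y within S)"
    "\<forall>y\<in>S \<inter> W. frechet_derivative f (at y within S) = frechet_derivative F (at y)"
proof -
  obtain W F where
    1: "open W" "z \<in> W" "\<forall>k. Ck_on k F W" "\<forall>y\<in>S \<inter> W. F y = f y"
    by (rule smooth_onE[OF f z])
  have d: "(f has_derivative frechet_derivative F (at y)) (at y within S)" if y: "y \<in> S" "y \<in> W" for y
  proof (rule has_derivative_transform_eventually)
    show "(F has_derivative frechet_derivative F (at y)) (at y within S)"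
      using has_derivative_at_withinI[OF Ck_on_Suc_has_derivative[OF 1(1) 1(3)[rule_format] y(2)]] by blast
    show "\<forall>\<^sub>F x' in at y within S. F x' = f x'"
      unfolding eventually_at_topological using 1 y by blast
  qed (use 1 y in auto)
  show thesis
    using that[OF 1] d frechet_derivative_half_space_open[OF S _ d] by blast
qed

lemma smooth_on_has_derivative:
  fixes f :: "'a::euclidean_space \<Rightarrow> 'b::real_normed_vector"
  assumes "half_space_open S" "smooth_on S f" "z \<in> S"
  shows "(f has_derivative frechet_derivative f (at z within S)) (at z within S)"
  by (rule smooth_on_derivativeE[OF assms]) (simp add: assms(3))

lemma smooth_on_frechet_derivative:
  fixes f :: "'a::euclidean_space \<Rightarrow> 'b::real_normed_vector"
  assumes "half_space_open S" "smooth_on S f"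
  shows "smooth_on S (\<lambda>z. frechet_derivative f (at z within S) v)"
proof (rule smooth_onI)
  fix z assume "z \<in> S"
  from smooth_on_derivativeE[OF assms this] obtain W F where
    1: "open W" "z \<in> W" "\<forall>k. Ck_on k F W"
    "\<forall>y\<in>S \<inter> W. frechet_derivative f (at y within S) = frechet_derivative F (at y)" by metis
  have "Ck_on k (\<lambda>x. frechet_derivative F (at x) v) W" for k using 1(3)[rule_format, of "Suc k"] by simp
  with 1 show "\<exists>W D. open W \<and> z \<in> W \<and> (\<forall>k. Ck_on k D W) \<and>
      (\<forall>y\<in>S \<inter> W. D y = frechet_derivative f (at y within S) v)"
    by (intro exI[of _ W] exI[of _ "\<lambda>x. frechet_derivative F (at x) v"]) auto
qed

lemma smooth_on_second_derivative_symmetric: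
  fixes f :: "'a::euclidean_space \<Rightarrow> 'b::euclidean_space"
  assumes S: "half_space_open S" and f: "smooth_on S f" and z: "z \<in> S"
  shows "frechet_derivative (\<lambda>q. frechet_derivative f (at q within S) x) (at z within S) y
       = frechet_derivative (\<lambda>q. frechet_derivative f (at q within S) y) (at z within S) x"
proof -
  from smooth_on_derivativeE[OF S f z] obtain W F where
    1: "open W" "z \<in> W" "\<forall>k. Ck_on k F W"
    "\<forall>y\<in>S \<inter> W. frechet_derivative f (at y within S) = frechet_derivative F (at y)" by metis
  have "frechet_derivative (\<lambda>q. frechet_derivative f (at q within S) u) (at z within S)
      = frechet_derivative (\<lambda>q. frechet_derivative F (at q) u) (at z)" for u
  proof (rule frechet_derivative_half_space_open[OF S z], rule has_derivative_transform_eventually)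
    have "Ck_on (Suc 0) (\<lambda>q. frechet_derivative F (at q) u) W" using 1(3)[rule_format, of "Suc (Suc 0)"] by simp
    from has_derivative_at_withinI[OF Ck_on_Suc_has_derivative[OF 1(1) this 1(2)]]
    show "((\<lambda>q. frechet_derivative F (at q) u) has_derivative
        frechet_derivative (\<lambda>q. frechet_derivative F (at q) u) (at z)) (at z within S)" .
    show "\<forall>\<^sub>F q in at z within S. frechet_derivative F (at q) u = frechet_derivative f (at q within S) u"
      unfolding eventually_at_topological using 1 by auto
  qed (use 1 z in auto)
  then show ?thesis
    using second_derivative_symmetric[OF 1(1) 1(3)[rule_format, of 2] 1(2), of x y] by simp
qed

section \<open>Calculus in a chart\<close>

text \<open>A set \<open>U\<close> of points over which the chart \<open>c\<close> is used. Fields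
  are only controlled on \<open>U\<close>, whereas \<open>dd\<close> differentiates within the
  whole chart image; as \<open>U\<close> has a relatively open image, the two agree.\<close>

locale chart_domain =
  fixes c :: "('m, 'e::euclidean_space) chart" and U :: "'m set"
  assumes inj: "inj_on (cmap c) (cdom c)" and sub: "U \<subseteq> cdom c"
    and half: "half_space_open (cimg c)"
    and open_img: "openin (top_of_set (cimg c)) (cmap c ` U)"
begin

text \<open>Smoothness, up to the boundary, of a coordinate expression over
  \<open>U\<close>.\<close>

definition chart_smooth :: "('m \<Rightarrow> 'b::real_normed_vector) \<Rightarrow> bool" where
  "chart_smooth f \<longleftrightarrow> smooth_on (cmap c ` U) (\<lambda>z. f (cinv c z))"

lemma cinv_cmap: "p \<in> U \<Longrightarrow> cinv c (cmap c p) = p"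
  using inj sub by (auto intro: inv_into_f_f)

lemma half_img: "half_space_open (cmap c ` U)"
  using half open_img openin_trans unfolding half_space_open_def by blast

lemma at_img: "p \<in> U \<Longrightarrow> at (cmap c p) within cimg c = at (cmap c p) within cmap c ` U"
proof -
  assume p: "p \<in> U"
  obtain W where "open W" "cmap c ` U = cimg c \<inter> W" using open_img unfolding openin_open by blast
  then show ?thesis using p by (intro at_within_nhd[of _ W]) auto
qed

lemma dd_eq: "p \<in> U \<Longrightarrow> dd c f p = frechet_derivative (\<lambda>z. f (cinv c z)) (at (cmap c p) within cmap c ` U)"
  by (rule ext) (simp add: dd_def at_img o_def)

lemma ddI:
  assumes "p \<in> U" "((\<lambda>z. f (cinv c z)) has_derivative f') (at (cmap c p) within cmap c ` U)"
  shows "dd c f p = f'"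
  using frechet_derivative_half_space_open[OF half_img _ assms(2)] assms(1) by (simp add: dd_eq)

lemma chart_smooth_has_derivative:
  assumes "chart_smooth f" "p \<in> U"
  shows "((\<lambda>z. f (cinv c z)) has_derivative dd c f p) (at (cmap c p) within cmap c ` U)"
  using smooth_on_has_derivative[OF half_img, of "\<lambda>z. f (cinv c z)" "cmap c p"] assms by (simp add: chart_smooth_def dd_eq)

lemma dd_linear: "chart_smooth f \<Longrightarrow> p \<in> U \<Longrightarrow> linear (dd c f p)"
  using chart_smooth_has_derivative has_derivative_linear by blast

lemma chart_smooth_cong: "(\<And>q. q \<in> U \<Longrightarrow> f q = g q) \<Longrightarrow> chart_smooth f \<longleftrightarrow> chart_smooth g"
  unfolding chart_smooth_def by (rule smooth_on_cong) (auto simp: cinv_cmap)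

lemma dd_cong:
  assumes "\<And>q. q \<in> U \<Longrightarrow> f q = g q" "p \<in> U"
  shows "dd c f p x = dd c g p x"
proof -
  have "((\<lambda>z. f (cinv c z)) has_derivative D) (at (cmap c p) within cmap c ` U) \<longleftrightarrow>
      ((\<lambda>z. g (cinv c z)) has_derivative D) (at (cmap c p) within cmap c ` U)" for D
    by (rule iffI; rule has_derivative_transform[rotated 2], assumption) (auto simp: assms cinv_cmap)
  then show ?thesis using assms(2) by (simp add: dd_eq frechet_derivative_def)
qed

lemma chart_smooth_const: "chart_smooth (\<lambda>q. a)"
  by (simp add: chart_smooth_def smooth_on_const)

lemma dd_const: "p \<in> U \<Longrightarrow> dd c (\<lambda>q. a) p x = 0"
  by (subst ddI[where f' = "\<lambda>x. 0"]) auto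

lemma chart_smooth_bounded_linear: "bounded_linear L \<Longrightarrow> chart_smooth f \<Longrightarrow> chart_smooth (\<lambda>q. L (f q))"
  unfolding chart_smooth_def by (rule smooth_on_bounded_linear)

lemma dd_bounded_linear:
  "bounded_linear L \<Longrightarrow> chart_smooth f \<Longrightarrow> p \<in> U \<Longrightarrow> dd c (\<lambda>q. L (f q)) p x = L (dd c f p x)"
  by (subst ddI[where f' = "\<lambda>x. L (dd c f p x)"])
     (auto intro: bounded_linear.has_derivative chart_smooth_has_derivative)

lemma chart_smooth_add: "chart_smooth f \<Longrightarrow> chart_smooth g \<Longrightarrow> chart_smooth (\<lambda>q. f q + g q)"
  unfolding chart_smooth_def by (rule smooth_on_add)

lemma dd_add: "chart_smooth f \<Longrightarrow> chart_smooth g \<Longrightarrow> p \<in> U \<Longrightarrow> dd c (\<lambda>q. f q + g q) p x = dd c f p x + dd c g p x"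
  by (subst ddI[where f' = "\<lambda>x. dd c f p x + dd c g p x"])
     (auto intro: has_derivative_add chart_smooth_has_derivative)

lemma chart_smooth_minus: "chart_smooth f \<Longrightarrow> chart_smooth (\<lambda>q. - f q)"
  by (rule chart_smooth_bounded_linear[OF bounded_linear_minus[OF bounded_linear_ident]])

lemma dd_minus: "chart_smooth f \<Longrightarrow> p \<in> U \<Longrightarrow> dd c (\<lambda>q. - f q) p x = - dd c f p x"
  by (rule dd_bounded_linear[OF bounded_linear_minus[OF bounded_linear_ident]])

lemma chart_smooth_diff: "chart_smooth f \<Longrightarrow> chart_smooth g \<Longrightarrow> chart_smooth (\<lambda>q. f q - g q)"
  using chart_smooth_add[of f "\<lambda>q. - g q"] chart_smooth_minus[of g] by simp

lemma dd_diff: "chart_smooth f \<Longrightarrow> chart_smooth g \<Longrightarrow> p \<in> U \<Longrightarrow> dd c (\<lambda>q. f q - g q) p x = dd c f p x - dd c g p x"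
  using dd_add[of f "\<lambda>q. - g q"] chart_smooth_minus[of g] dd_minus[of g] by simp

lemma chart_smooth_sum: "finite I \<Longrightarrow> (\<And>i. i \<in> I \<Longrightarrow> chart_smooth (f i)) \<Longrightarrow> chart_smooth (\<lambda>q. \<Sum>i\<in>I. f i q)"
  by (induction I rule: finite_induct) (auto intro: chart_smooth_const chart_smooth_add)

lemma dd_sum: "finite I \<Longrightarrow> (\<And>i. i \<in> I \<Longrightarrow> chart_smooth (f i)) \<Longrightarrow> p \<in> U \<Longrightarrow>
   dd c (\<lambda>q. \<Sum>i\<in>I. f i q) p x = (\<Sum>i\<in>I. dd c (f i) p x)"
  by (induction I rule: finite_induct) (auto simp: dd_const dd_add chart_smooth_sum)

lemma chart_smooth_bilinear: "bounded_bilinear B \<Longrightarrow> chart_smooth f \<Longrightarrow> chart_smooth g \<Longrightarrow> chart_smooth (\<lambda>q. B (f q) (g q))"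
  unfolding chart_smooth_def by (rule smooth_on_bilinear)

lemma dd_bilinear:
  assumes "bounded_bilinear B" "chart_smooth f" "chart_smooth g" "p \<in> U"
  shows "dd c (\<lambda>q. B (f q) (g q)) p x = B (f p) (dd c g p x) + B (dd c f p x) (g p)"
proof -
  from bounded_bilinear.FDERIV[OF assms(1) chart_smooth_has_derivative[OF assms(2,4)] chart_smooth_has_derivative[OF assms(3,4)]]
  have "dd c (\<lambda>q. B (f q) (g q)) p = (\<lambda>x. B (f p) (dd c g p x) + B (dd c f p x) (g p))"
    by (intro ddI) (simp_all add: assms(4) cinv_cmap)
  then show ?thesis by simp
qed

lemmas chart_smooth_mult = chart_smooth_bilinear[OF bounded_bilinear_mult]
  and chart_smooth_scaleR = chart_smooth_bilinear[OF bounded_bilinear_scaleR]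
  and dd_mult = dd_bilinear[OF bounded_bilinear_mult]
  and dd_scaleR = dd_bilinear[OF bounded_bilinear_scaleR]

lemma chart_smooth_prod:
  fixes f :: "'i \<Rightarrow> 'm \<Rightarrow> real"
  shows "finite I \<Longrightarrow> (\<And>i. i \<in> I \<Longrightarrow> chart_smooth (f i)) \<Longrightarrow> chart_smooth (\<lambda>q. \<Prod>i\<in>I. f i q)"
  by (induction I rule: finite_induct) (auto intro: chart_smooth_const chart_smooth_mult)

lemma chart_smooth_inverse:
  fixes f :: "'m \<Rightarrow> real"
  shows "chart_smooth f \<Longrightarrow> (\<And>q. q \<in> U \<Longrightarrow> f q \<noteq> 0) \<Longrightarrow> chart_smooth (\<lambda>q. inverse (f q))"
  unfolding chart_smooth_def by (rule smooth_on_inverse) (auto simp: cinv_cmap)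

lemma chart_smooth_inverse_sqrt:
  fixes f :: "'m \<Rightarrow> real"
  shows "chart_smooth f \<Longrightarrow> (\<And>q. q \<in> U \<Longrightarrow> 0 < f q) \<Longrightarrow> chart_smooth (\<lambda>q. inverse (sqrt (f q)))"
  unfolding chart_smooth_def by (rule smooth_on_inverse_sqrt) (auto simp: cinv_cmap)

lemma chart_smooth_dd:
  assumes "chart_smooth f" shows "chart_smooth (\<lambda>q. dd c f q x)"
proof -
  have "smooth_on (cmap c ` U) (\<lambda>z. frechet_derivative (\<lambda>z. f (cinv c z)) (at z within cmap c ` U) x)"
    using smooth_on_frechet_derivative[OF half_img] assms by (simp add: chart_smooth_def)
  then show ?thesis
    unfolding chart_smooth_def by (rule iffD1[OF smooth_on_cong, rotated]) (auto simp: cinv_cmap dd_eq)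
qed

lemma dd_commute:
  fixes f :: "'m \<Rightarrow> 'b::euclidean_space"
  assumes "chart_smooth f" "p \<in> U"
  shows "dd c (\<lambda>q. dd c f q x) p y = dd c (\<lambda>q. dd c f q y) p x"
proof -
  let ?S = "cmap c ` U" and ?f = "\<lambda>z. f (cinv c z)"
  have "dd c (\<lambda>q. dd c f q u) p = frechet_derivative (\<lambda>z. frechet_derivative ?f (at z within ?S) u) (at (cmap c p) within ?S)" for u
  proof (rule ddI[OF assms(2)], rule has_derivative_transform)
    show "((\<lambda>z. frechet_derivative ?f (at z within ?S) u) has_derivative
       frechet_derivative (\<lambda>z. frechet_derivative ?f (at z within ?S) u) (at (cmap c p) within ?S)) (at (cmap c p) within ?S)"
      using assms by (intro smooth_on_has_derivative[OF half_img smooth_on_frechet_derivative[OF half_img]])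
        (simp_all add: chart_smooth_def)
  qed (use assms(2) in \<open>auto simp: cinv_cmap dd_eq\<close>)
  then show ?thesis
    using smooth_on_second_derivative_symmetric[OF half_img, of ?f "cmap c p"] assms by (simp add: chart_smooth_def)
qed

text \<open>Points of the half-space boundary are limits of interior points, approached along the
  inner normal \<open>n\<close>.\<close>

lemma chart_smooth_vanishes_on_closure:
  fixes f :: "'m \<Rightarrow> real"
  assumes "chart_smooth f" "\<And>q. q \<in> U \<Longrightarrow> cmap c q \<in> interior (cimg c) \<Longrightarrow> f q = 0" "p \<in> U"
  shows "f p = 0"
proof -
  let ?S = "cmap c ` U" and ?f = "\<lambda>z. f (cinv c z)" and ?z = "cmap c p"
  have cont: "continuous_on ?S ?f" using smooth_on_continuous_on assms(1) by (simp add: chart_smooth_def)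
  have z: "?z \<in> ?S" using assms(3) by auto
  obtain n W where n: "open W" "?S = {x. 0 \<le> x \<bullet> n} \<inter> W"
    using half_img unfolding half_space_open_def openin_open by blast
  show ?thesis
  proof (cases "n = 0")
    case True
    then have "open ?S" using n by simp
    moreover have "?S \<subseteq> cimg c" using sub by auto
    ultimately have "?z \<in> interior (cimg c)" using z interiorI by blast
    then show ?thesis using assms by blast
  next
    case False
    have lim: "(\<lambda>k. ?z + (1 / real (Suc k)) *\<^sub>R n) \<longlonglongrightarrow> ?z + 0 *\<^sub>R n"
      by (intro tendsto_intros LIMSEQ_inverse_real_of_nat[unfolded inverse_eq_divide])
    then have "\<forall>\<^sub>F k in sequentially. ?z + (1 / real (Suc k)) *\<^sub>R n \<in> W"
      using topological_tendstoD[OF lim n(1)] n(2) z by auto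
    then have ev: "\<forall>\<^sub>F k in sequentially. ?z + (1 / real (Suc k)) *\<^sub>R n \<in> {x. 0 < x \<bullet> n} \<inter> W"
    proof eventually_elim
      case (elim k)
      have "0 \<le> ?z \<bullet> n" "0 < n \<bullet> n" using n(2) z False by auto
      then have "0 < ?z \<bullet> n + (1 / real (Suc k)) * (n \<bullet> n)" by (intro add_nonneg_pos) auto
      then show ?case using elim by (simp add: inner_add_left)
    qed
    have "open ({x. 0 < x \<bullet> n} \<inter> W)"
      using n(1) open_halfspace_gt[of 0 n] by (auto simp: inner_commute)
    moreover have "{x. 0 < x \<bullet> n} \<inter> W \<subseteq> ?S" using n(2) by auto
    moreover have "?S \<subseteq> cimg c" using sub by auto
    ultimately have int: "x \<in> interior (cimg c)" if "x \<in> {x. 0 < x \<bullet> n} \<inter> W" for x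
      using that interiorI by blast
    have zero: "\<forall>\<^sub>F k in sequentially. ?f (?z + (1 / real (Suc k)) *\<^sub>R n) = 0"
      using ev
    proof eventually_elim
      case (elim k)
      then have "?z + (1 / real (Suc k)) *\<^sub>R n \<in> ?S" using n(2) by auto
      then obtain q where q: "q \<in> U" "?z + (1 / real (Suc k)) *\<^sub>R n = cmap c q" by auto
      then show ?case using assms(2)[OF q(1)] int[OF elim] by (simp add: cinv_cmap)
    qed
    have "\<forall>\<^sub>F k in sequentially. ?z + (1 / real (Suc k)) *\<^sub>R n \<in> ?S"
      using ev by eventually_elim (use n(2) in auto)
    from continuous_on_tendsto_compose[OF cont _ z this, of ] lim
    have "(\<lambda>k. ?f (?z + (1 / real (Suc k)) *\<^sub>R n)) \<longlonglongrightarrow> ?f ?z" by simp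
    then have "?f ?z = 0"
      using tendsto_cong[OF zero] LIMSEQ_unique tendsto_const by blast
    then show ?thesis using assms(3) by (simp add: cinv_cmap)
  qed
qed

lemma expand_linear_field:
  assumes "linear L"
  shows "L v = (\<Sum>b\<in>Basis. (v \<bullet> b) *\<^sub>R L b)"
  by (subst (1) euclidean_representation[of v, symmetric]) (simp only: linear_sum[OF assms] linear_cmul[OF assms])

text \<open>Tensor fields have smooth values on constant vectors; expanding a vector field in the
  constant basis gives smoothness of its image, and likewise the product rules below.\<close>

lemma chart_smooth_linear_apply:
  fixes L :: "'m \<Rightarrow> 'a::euclidean_space \<Rightarrow> 'b::real_normed_vector"
  assumes lin: "\<And>q. q \<in> U \<Longrightarrow> linear (L q)" and L: "\<And>a. chart_smooth (\<lambda>q. L q a)" and X: "chart_smooth X"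
  shows "chart_smooth (\<lambda>q. L q (X q))"
proof -
  have "chart_smooth (\<lambda>q. \<Sum>b\<in>Basis. (X q \<bullet> b) *\<^sub>R L q b)"
    by (intro chart_smooth_sum chart_smooth_scaleR L chart_smooth_bounded_linear[OF bounded_linear_inner_left X]) simp
  then show ?thesis
    by (rule iffD2[OF chart_smooth_cong, rotated]) (rule expand_linear_field[OF lin])
qed

lemma dd_linear_apply:
  fixes L :: "'m \<Rightarrow> 'a::euclidean_space \<Rightarrow> 'b::real_normed_vector"
  assumes lin: "\<And>q. q \<in> U \<Longrightarrow> linear (L q)" and L: "\<And>a. chart_smooth (\<lambda>q. L q a)" and X: "chart_smooth X" and p: "p \<in> U"
  shows "dd c (\<lambda>q. L q (X q)) p y = dd c (\<lambda>q. L q (X p)) p y + L p (dd c X p y)"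
proof -
  have Xb: "chart_smooth (\<lambda>q. X q \<bullet> b)" for b using chart_smooth_bounded_linear[OF bounded_linear_inner_left X] .
  have "dd c (\<lambda>q. L q (Y q)) p y = (\<Sum>b\<in>Basis. (Y p \<bullet> b) *\<^sub>R dd c (\<lambda>q. L q b) p y) + L p (dd c Y p y)"
    if Y: "chart_smooth Y" for Y
  proof -
    have Yb: "chart_smooth (\<lambda>q. Y q \<bullet> b)" for b using chart_smooth_bounded_linear[OF bounded_linear_inner_left Y] .
    have "dd c (\<lambda>q. L q (Y q)) p y = dd c (\<lambda>q. \<Sum>b\<in>Basis. (Y q \<bullet> b) *\<^sub>R L q b) p y"
      by (rule dd_cong[OF expand_linear_field[OF lin] p])
    also have "\<dots> = (\<Sum>b\<in>Basis. (Y p \<bullet> b) *\<^sub>R dd c (\<lambda>q. L q b) p y + (dd c Y p y \<bullet> b) *\<^sub>R L p b)"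
      using p by (subst dd_sum)
        (auto intro!: chart_smooth_scaleR Yb L sum.cong simp: dd_scaleR[OF Yb L] dd_bounded_linear[OF bounded_linear_inner_left Y])
    also have "\<dots> = (\<Sum>b\<in>Basis. (Y p \<bullet> b) *\<^sub>R dd c (\<lambda>q. L q b) p y) + L p (dd c Y p y)"
      by (simp add: sum.distrib expand_linear_field[OF lin[OF p], of "dd c Y p y", symmetric])
    finally show ?thesis .
  qed
  from this[OF X] this[OF chart_smooth_const[of "X p"]] show ?thesis
    using p by (simp add: dd_const linear_0[OF lin])
qed

lemma chart_smooth_bilinear_apply:
  fixes L :: "'m \<Rightarrow> 'a::euclidean_space \<Rightarrow> 'd::euclidean_space \<Rightarrow> 'b::real_normed_vector"
  assumes lin: "\<And>q. q \<in> U \<Longrightarrow> bilinear (L q)" and L: "\<And>a b. chart_smooth (\<lambda>q. L q a b)" and X: "chart_smooth X" and Y: "chart_smooth Y"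
  shows "chart_smooth (\<lambda>q. L q (X q) (Y q))"
proof (rule chart_smooth_linear_apply[where L = "\<lambda>q a. L q a (Y q)", OF _ _ X])
  show "chart_smooth (\<lambda>q. L q a (Y q))" for a
    by (rule chart_smooth_linear_apply[OF _ L Y]) (use lin bilinear_def in blast)
  show "linear (\<lambda>a. L q a (Y q))" if "q \<in> U" for q using lin[OF that] bilinear_def by blast
qed

lemma dd_bilinear_apply:
  fixes L :: "'m \<Rightarrow> 'a::euclidean_space \<Rightarrow> 'd::euclidean_space \<Rightarrow> 'b::real_normed_vector"
  assumes lin: "\<And>q. q \<in> U \<Longrightarrow> bilinear (L q)" and L: "\<And>a b. chart_smooth (\<lambda>q. L q a b)" and X: "chart_smooth X" and Y: "chart_smooth Y"
    and p: "p \<in> U"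
  shows "dd c (\<lambda>q. L q (X q) (Y q)) p y
    = dd c (\<lambda>q. L q (X p) (Y p)) p y + L p (dd c X p y) (Y p) + L p (X p) (dd c Y p y)"
proof -
  have l1: "linear (\<lambda>a. L q a b)" and l2: "linear (L q a)" if "q \<in> U" for q a b
    using lin[OF that] bilinear_def by blast+
  have Ls: "chart_smooth (\<lambda>q. L q a (Y q))" for a
    by (rule chart_smooth_linear_apply[OF _ L Y]) (rule l2)
  show ?thesis
    using dd_linear_apply[where L = "\<lambda>q a. L q a (Y q)", OF l1 Ls X p, of y]
      dd_linear_apply[where L = "\<lambda>q. L q (X p)", OF l2 L Y p, of y] by simp
qed

end

section \<open>The Levi-Civita connection and its curvature in a chart\<close>

locale metric_chart = chart_domain c U
  for c :: "('m, real^'n) chart" and U +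
  fixes g :: "('m, real^'n) bilfield"
  assumes g_bilinear: "p \<in> U \<Longrightarrow> bilinear (g c p)"
    and g_sym: "p \<in> U \<Longrightarrow> g c p x y = g c p y x"
    and g_pos: "p \<in> U \<Longrightarrow> x \<noteq> 0 \<Longrightarrow> 0 < g c p x x"
    and chart_smooth_g: "chart_smooth (\<lambda>q. g c q x y)"
begin

lemma g_linear: "p \<in> U \<Longrightarrow> linear (g c p x)"
  using g_bilinear[of p] by (auto simp: bilinear_def)

lemma g_linear_left: "p \<in> U \<Longrightarrow> linear (\<lambda>x. g c p x y)"
  using g_bilinear[of p] by (auto simp: bilinear_def)

lemma g_simps:
  assumes "p \<in> U"
  shows "g c p (x + x') y = g c p x y + g c p x' y" "g c p x (y + y') = g c p x y + g c p x y'"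
    "g c p (x - x') y = g c p x y - g c p x' y" "g c p x (y - y') = g c p x y - g c p x y'"
    "g c p (- x) y = - g c p x y" "g c p x (- y) = - g c p x y"
    "g c p (t *\<^sub>R x) y = t * g c p x y" "g c p x (t *\<^sub>R y) = t * g c p x y"
    "g c p 0 y = 0" "g c p x 0 = 0"
  using linear_add[OF g_linear[OF assms]] linear_add[OF g_linear_left[OF assms]]
    linear_diff[OF g_linear[OF assms]] linear_diff[OF g_linear_left[OF assms]]
    linear_neg[OF g_linear[OF assms]] linear_neg[OF g_linear_left[OF assms]]
    linear_cmul[OF g_linear[OF assms]] linear_cmul[OF g_linear_left[OF assms]]
    linear_0[OF g_linear[OF assms]] linear_0[OF g_linear_left[OF assms]]
  by simp_all

lemma g_ext:
  assumes "p \<in> U" "\<And>y. g c p a y = g c p b y"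
  shows "a = b"
proof (rule ccontr)
  assume "a \<noteq> b"
  then have "0 < g c p (a - b) (a - b)" using g_pos[OF assms(1)] by simp
  then show False using assms by (simp add: g_simps)
qed

definition gram :: "'m \<Rightarrow> real^'n^'n" where
  "gram q = (\<chi> i j. g c q (axis i 1) (axis j 1))"

lemma gram_mult: "p \<in> U \<Longrightarrow> (gram p *v x) $ i = g c p (axis i 1) x"
proof -
  assume p: "p \<in> U"
  have "g c p (axis i 1) x = g c p (axis i 1) (\<Sum>j\<in>UNIV. x $ j *\<^sub>R axis j 1)"
    by (simp add: basis_expansion flip: scalar_mult_eq_scaleR)
  also have "\<dots> = (gram p *v x) $ i"
    by (simp add: linear_sum[OF g_linear[OF p]] g_simps[OF p] gram_def matrix_vector_mult_def mult.commute)
  finally show ?thesis by simp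
qed

lemma det_gram: "p \<in> U \<Longrightarrow> det (gram p) \<noteq> 0"
proof -
  assume p: "p \<in> U"
  have "x = 0" if "gram p *v x = 0" for x
  proof (rule g_ext[OF p])
    fix y
    have "g c p y x = g c p (\<Sum>j\<in>UNIV. y $ j *\<^sub>R axis j 1) x"
      by (simp add: basis_expansion flip: scalar_mult_eq_scaleR)
    also have "\<dots> = 0"
      using that gram_mult[OF p, of x] by (simp add: linear_sum[OF g_linear_left[OF p]] g_simps[OF p])
    finally show "g c p x y = g c p 0 y" by (simp add: g_sym[OF p] g_simps[OF p])
  qed
  then have "invertible (gram p)"
    using matrix_left_invertible_ker[of "gram p"] invertible_left_inverse by blast
  then show ?thesis by (simp add: invertible_det_nz)
qed

text \<open>Cramer's rule solves the defining equations of \<open>sharp\<close> and at the same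
  time exhibits the solution as a rational expression in the metric coefficients, whence
  \<open>chart_smooth_sharp\<close>.\<close>

lemma sharp_cramer:
  assumes "p \<in> U" "linear \<alpha>"
  shows "sharp g c p \<alpha> = (\<chi> k. det (\<chi> i j. if j = k then \<alpha> (axis i 1) else gram p $ i $ j) / det (gram p))"
      (is "_ = ?x")
    and "g c p (sharp g c p \<alpha>) y = \<alpha> y"
proof -
  have "gram p *v ?x = (\<chi> i. \<alpha> (axis i 1))"
    unfolding cramer[OF det_gram[OF assms(1)]] by (simp cong: if_cong)
  then have ax: "g c p (axis i 1) ?x = \<alpha> (axis i 1)" for i
    using gram_mult[OF assms(1), of ?x i] by simp
  have *: "g c p ?x y = \<alpha> y" for y
  proof -
    have "g c p y ?x = g c p (\<Sum>j\<in>UNIV. y $ j *\<^sub>R axis j 1) ?x"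
      by (simp add: basis_expansion flip: scalar_mult_eq_scaleR)
    also have "\<dots> = \<alpha> (\<Sum>j\<in>UNIV. y $ j *\<^sub>R axis j 1)"
      by (simp only: linear_sum[OF g_linear_left[OF assms(1)]] linear_sum[OF assms(2)]
          linear_cmul[OF assms(2)] g_simps[OF assms(1)] ax real_scaleR_def)
    also have "\<dots> = \<alpha> y" by (simp add: basis_expansion flip: scalar_mult_eq_scaleR)
    finally show ?thesis by (simp add: g_sym[OF assms(1)])
  qed
  show eq: "sharp g c p \<alpha> = ?x"
    unfolding sharp_def by (rule the_equality) (use * g_ext[OF assms(1)] in auto)
  show "g c p (sharp g c p \<alpha>) y = \<alpha> y" unfolding eq by (rule *)
qed

lemma chart_smooth_vec: "(\<And>k. chart_smooth (\<lambda>q. f q $ k)) \<Longrightarrow> chart_smooth f" for f :: "'m \<Rightarrow> real^'k"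
proof -
  assume f: "\<And>k. chart_smooth (\<lambda>q. f q $ k)"
  have "chart_smooth (\<lambda>q. \<Sum>k\<in>UNIV. f q $ k *\<^sub>R axis k (1::real))"
    by (intro chart_smooth_sum chart_smooth_scaleR f chart_smooth_const) simp
  then show ?thesis by (simp add: basis_expansion flip: scalar_mult_eq_scaleR)
qed

lemma chart_smooth_det:
  fixes M :: "'m \<Rightarrow> real^'k^'k"
  assumes "\<And>i j. chart_smooth (\<lambda>q. M q $ i $ j)"
  shows "chart_smooth (\<lambda>q. det (M q))"
  unfolding det_def by (intro chart_smooth_sum chart_smooth_mult chart_smooth_const chart_smooth_prod assms finite_permutations) simp_all

lemma chart_smooth_sharp:
  assumes lin: "\<And>q. q \<in> U \<Longrightarrow> linear (\<alpha> q)" and sm: "\<And>y. chart_smooth (\<lambda>q. \<alpha> q y)"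
  shows "chart_smooth (\<lambda>q. sharp g c q (\<alpha> q))"
proof -
  have gr: "chart_smooth (\<lambda>q. gram q $ i $ j)" for i j by (simp add: gram_def chart_smooth_g)
  have "chart_smooth (\<lambda>q. \<chi> k. det (\<chi> i j. if j = k then \<alpha> q (axis i 1) else gram q $ i $ j) * inverse (det (gram q)))"
  proof (rule chart_smooth_vec, simp only: vec_lambda_beta, intro chart_smooth_mult chart_smooth_inverse chart_smooth_det gr det_gram)
    show "chart_smooth (\<lambda>q. (\<chi> i j. if j = k then \<alpha> q (axis i 1) else gram q $ i $ j) $ i $ j)" for i j k
      using sm gr by (cases "j = k") simp_all
  qed
  then show ?thesis
    by (rule iffD2[OF chart_smooth_cong, rotated]) (simp add: sharp_cramer(1)[OF _ lin] divide_inverse)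
qed

abbreviation \<Gamma> where "\<Gamma> \<equiv> christoffel g c"

lemma linear_dd_metric: "p \<in> U \<Longrightarrow> linear (\<lambda>z. dd c (\<lambda>q. g c q y z) p x)"
proof
  assume p: "p \<in> U"
  show "dd c (\<lambda>q. g c q y (z + z')) p x = dd c (\<lambda>q. g c q y z) p x + dd c (\<lambda>q. g c q y z') p x" for z z'
    by (subst dd_add[OF chart_smooth_g chart_smooth_g p, symmetric]) (auto intro!: dd_cong p simp: g_simps)
  show "dd c (\<lambda>q. g c q y (t *\<^sub>R z)) p x = t *\<^sub>R dd c (\<lambda>q. g c q y z) p x" for t z
    by (subst dd_bounded_linear[OF bounded_linear_scaleR_right chart_smooth_g p, symmetric])
       (auto intro!: dd_cong p simp: g_simps)
qed

lemma dd_metric_sym: "p \<in> U \<Longrightarrow> dd c (\<lambda>q. g c q y z) p x = dd c (\<lambda>q. g c q z y) p x"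
  by (rule dd_cong) (simp_all add: g_sym)

lemma christoffel_form_linear:
  "p \<in> U \<Longrightarrow> linear (\<lambda>z. (dd c (\<lambda>q. g c q y z) p x + dd c (\<lambda>q. g c q x z) p y - dd c (\<lambda>q. g c q x y) p z) / 2)"
  using linear_compose_scale_right[OF linear_compose_sub[OF linear_compose_add[OF
        linear_dd_metric[of p y x] linear_dd_metric[of p x y]] dd_linear[OF chart_smooth_g, of p x y]], of "1/2"]
  by simp

lemma koszul:
  "p \<in> U \<Longrightarrow> g c p (\<Gamma> p x y) z
    = (dd c (\<lambda>q. g c q y z) p x + dd c (\<lambda>q. g c q x z) p y - dd c (\<lambda>q. g c q x y) p z) / 2"
  unfolding christoffel_def by (rule sharp_cramer(2)) (auto intro: christoffel_form_linear)

lemma christoffel_sym: "p \<in> U \<Longrightarrow> \<Gamma> p x y = \<Gamma> p y x"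
proof (rule g_ext)
  fix z assume p: "p \<in> U"
  show "g c p (\<Gamma> p x y) z = g c p (\<Gamma> p y x) z"
    using koszul[OF p, of x y z] koszul[OF p, of y x z] dd_metric_sym[OF p, of x y z] by simp
qed

lemma christoffel_metric: "p \<in> U \<Longrightarrow> dd c (\<lambda>q. g c q y z) p x = g c p (\<Gamma> p x y) z + g c p y (\<Gamma> p x z)"
  by (simp add: koszul g_sym[of p y] dd_metric_sym[of p z y] dd_metric_sym[of p x y] dd_metric_sym[of p x z] field_simps)

lemma christoffel_linear: "p \<in> U \<Longrightarrow> linear (\<Gamma> p x)"
proof
  assume p: "p \<in> U"
  note lin = linear_dd_metric[OF p]
  have l2: "linear (\<lambda>y. dd c (\<lambda>q. g c q y z) p x)" for z x
    using lin[of z x] dd_metric_sym[OF p, of z _ x] by simp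
  note l3 = dd_linear[OF chart_smooth_g p]
  show "\<Gamma> p x (y + y') = \<Gamma> p x y + \<Gamma> p x y'" for y y'
    by (rule g_ext[OF p])
      (simp add: koszul p g_simps linear_add[OF l2] linear_add[OF l3] linear_add[OF lin] field_simps)
  show "\<Gamma> p x (t *\<^sub>R y) = t *\<^sub>R \<Gamma> p x y" for t y
    by (rule g_ext[OF p])
      (simp add: koszul p g_simps linear_cmul[OF l2] linear_cmul[OF l3] linear_cmul[OF lin] field_simps)
qed

lemma christoffel_bilinear: "p \<in> U \<Longrightarrow> bilinear (\<Gamma> p)"
proof -
  assume p: "p \<in> U"
  have l: "linear (\<lambda>x. \<Gamma> p x y)" for y
    by (rule subst[of "\<Gamma> p y" "\<lambda>x. \<Gamma> p x y" linear, OF ext christoffel_linear[OF p]]) (rule christoffel_sym[OF p])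
  show ?thesis unfolding bilinear_def by (intro conjI allI l christoffel_linear[OF p])
qed

lemma chart_smooth_christoffel: "chart_smooth (\<lambda>q. \<Gamma> q x y)"
  unfolding christoffel_def
  by (rule chart_smooth_sharp[OF christoffel_form_linear], assumption,
      rule chart_smooth_bounded_linear[OF bounded_linear_divide], intro chart_smooth_diff chart_smooth_add chart_smooth_dd chart_smooth_g)

text \<open>Covariant derivative of the field \<open>Y\<close> in the direction of a single
  coordinate vector \<open>x\<close> at \<open>p\<close>.\<close>

definition nab :: "('m \<Rightarrow> real^'n) \<Rightarrow> 'm \<Rightarrow> real^'n \<Rightarrow> real^'n" where
  "nab Y p x = dd c Y p x + \<Gamma> p x (Y p)"

lemma nabla_eq_nab: "nabla g X Y c p = nab (Y c) p (X c p)"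
  by (simp add: nabla_def nab_def)

lemma nab_linear: "chart_smooth Y \<Longrightarrow> p \<in> U \<Longrightarrow> linear (nab Y p)"
  unfolding nab_def
  by (rule linear_compose_add[OF dd_linear]) (auto dest: christoffel_bilinear simp: bilinear_def)

lemma nab_cong: "(\<And>q. q \<in> U \<Longrightarrow> Y q = Z q) \<Longrightarrow> p \<in> U \<Longrightarrow> nab Y p x = nab Z p x"
  using dd_cong[of Y Z p x] by (simp add: nab_def)

lemma chart_smooth_nab: "chart_smooth X \<Longrightarrow> chart_smooth Y \<Longrightarrow> chart_smooth (\<lambda>q. nab Y q (X q))"
proof (rule chart_smooth_linear_apply[where L = "nab Y"])
  assume Y: "chart_smooth Y"
  show "linear (nab Y q)" if "q \<in> U" for q using nab_linear[OF Y that] .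
  show "chart_smooth (\<lambda>q. nab Y q a)" for a
    unfolding nab_def by (rule chart_smooth_add[OF chart_smooth_dd[OF Y] chart_smooth_linear_apply[OF christoffel_linear chart_smooth_christoffel Y]])
qed

lemma nab_add: "chart_smooth Y \<Longrightarrow> chart_smooth Z \<Longrightarrow> p \<in> U \<Longrightarrow> nab (\<lambda>q. Y q + Z q) p x = nab Y p x + nab Z p x"
  by (simp add: nab_def dd_add linear_add[OF christoffel_linear])

lemma nab_scaleR: "chart_smooth f \<Longrightarrow> chart_smooth Y \<Longrightarrow> p \<in> U \<Longrightarrow>
    nab (\<lambda>q. f q *\<^sub>R Y q) p x = dd c f p x *\<^sub>R Y p + f p *\<^sub>R nab Y p x"
  by (simp add: nab_def dd_scaleR linear_cmul[OF christoffel_linear] algebra_simps)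

lemma nab_minus: "chart_smooth Y \<Longrightarrow> p \<in> U \<Longrightarrow> nab (\<lambda>q. - Y q) p x = - nab Y p x"
  by (simp add: nab_def dd_minus linear_neg[OF christoffel_linear])

lemma nab_const: "p \<in> U \<Longrightarrow> nab (\<lambda>q. z) p x = \<Gamma> p x z"
  by (simp add: nab_def dd_const)

lemma dd_metric: "chart_smooth Y \<Longrightarrow> chart_smooth Z \<Longrightarrow> p \<in> U \<Longrightarrow>
    dd c (\<lambda>q. g c q (Y q) (Z q)) p x = g c p (nab Y p x) (Z p) + g c p (Y p) (nab Z p x)"
  by (simp add: dd_bilinear_apply[OF g_bilinear chart_smooth_g] christoffel_metric nab_def g_simps)

lemma chart_smooth_metric: "chart_smooth Y \<Longrightarrow> chart_smooth Z \<Longrightarrow> chart_smooth (\<lambda>q. g c q (Y q) (Z q))"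
  by (rule chart_smooth_bilinear_apply[OF g_bilinear chart_smooth_g])

text \<open>The commutator of second covariant derivatives of \<open>Z\<close> along the constant
  coordinate fields \<open>x\<close> and \<open>y\<close>, whose Lie bracket is zero.\<close>

definition curv2 :: "('m \<Rightarrow> real^'n) \<Rightarrow> 'm \<Rightarrow> real^'n \<Rightarrow> real^'n \<Rightarrow> real^'n" where
  "curv2 Z p x y = nab (\<lambda>q. nab Z q x) p y - nab (\<lambda>q. nab Z q y) p x"

lemma chart_smooth_nab_const: "chart_smooth Z \<Longrightarrow> chart_smooth (\<lambda>q. nab Z q x)"
  by (rule chart_smooth_nab[OF chart_smooth_const])

text \<open>Differentiating \<open>\<nabla>\<^sub>X Z\<close> along \<open>y\<close>: the
  variation of \<open>X\<close> contributes the derivative of \<open>Z\<close> along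
  \<open>\<partial>\<^sub>y X\<close>. In the curvature these terms are cancelled by the Lie
  bracket.\<close>

lemma nab_apply:
  assumes "chart_smooth X" "chart_smooth Z" "p \<in> U"
  shows "nab (\<lambda>q. nab Z q (X q)) p y = nab (\<lambda>q. nab Z q (X p)) p y + nab Z p (dd c X p y)"
  using dd_linear_apply[OF nab_linear[OF assms(2)] chart_smooth_nab_const[OF assms(2)] assms(1,3), of y]
  by (simp add: nab_def)

lemma curv_eq_curv2:
  assumes "chart_smooth (X c)" "chart_smooth (Y c)" "chart_smooth (Z c)" "p \<in> U"
  shows "curv g X Y Z c p = curv2 (Z c) p (X c p) (Y c p)"
proof -
  have "curv g X Y Z c p = nab (\<lambda>q. nab (Z c) q (X c q)) p (Y c p) - nab (\<lambda>q. nab (Z c) q (Y c q)) p (X c p)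
      + nab (Z c) p (dd c (Y c) p (X c p) - dd c (X c) p (Y c p))"
    by (simp add: curv_def nabla_eq_nab lie_bracket_def) (simp add: nabla_eq_nab[abs_def])
  also have "\<dots> = curv2 (Z c) p (X c p) (Y c p)"
    by (simp add: nab_apply[OF assms(1,3,4)] nab_apply[OF assms(2,3,4)] curv2_def linear_diff[OF nab_linear[OF assms(3,4)]])
  finally show ?thesis .
qed

lemma chart_smooth_lie_bracket: "chart_smooth (X c) \<Longrightarrow> chart_smooth (Y c) \<Longrightarrow> chart_smooth (lie_bracket X Y c)"
  unfolding lie_bracket_def[abs_def]
  by (intro chart_smooth_diff chart_smooth_linear_apply[OF dd_linear chart_smooth_dd])

lemma chart_smooth_nabla: "chart_smooth (X c) \<Longrightarrow> chart_smooth (Y c) \<Longrightarrow> chart_smooth (nabla g X Y c)"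
  unfolding nabla_eq_nab[abs_def] by (rule chart_smooth_nab)

lemma chart_smooth_curv: "chart_smooth (X c) \<Longrightarrow> chart_smooth (Y c) \<Longrightarrow> chart_smooth (Z c) \<Longrightarrow> chart_smooth (curv g X Y Z c)"
  unfolding curv_def[abs_def] by (intro chart_smooth_add chart_smooth_diff chart_smooth_nabla chart_smooth_lie_bracket)

lemma curv2_add:
  assumes "chart_smooth Y" "chart_smooth Z" "p \<in> U"
  shows "curv2 (\<lambda>q. Y q + Z q) p x y = curv2 Y p x y + curv2 Z p x y"
proof -
  have "nab (\<lambda>q. nab (\<lambda>q. Y q + Z q) q u) p v = nab (\<lambda>q. nab Y q u) p v + nab (\<lambda>q. nab Z q u) p v" for u v
    using assms by (subst nab_add[symmetric]) (auto intro!: chart_smooth_nab_const nab_cong simp: nab_add)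
  then show ?thesis by (simp add: curv2_def)
qed

text \<open>The first derivatives of \<open>f\<close> enter symmetrically in \<open>x\<close> and
  \<open>y\<close>, and so do its second derivatives; both drop out of the commutator.\<close>

lemma curv2_scaleR:
  assumes f: "chart_smooth f" and Z: "chart_smooth Z" and p: "p \<in> U"
  shows "curv2 (\<lambda>q. f q *\<^sub>R Z q) p x y = f p *\<^sub>R curv2 Z p x y"
proof -
  have "nab (\<lambda>q. nab (\<lambda>q. f q *\<^sub>R Z q) q u) p v
      = dd c (\<lambda>q. dd c f q u) p v *\<^sub>R Z p + dd c f p u *\<^sub>R nab Z p v + dd c f p v *\<^sub>R nab Z p u
        + f p *\<^sub>R nab (\<lambda>q. nab Z q u) p v" for u v
  proof -
    have "nab (\<lambda>q. nab (\<lambda>q. f q *\<^sub>R Z q) q u) p v = nab (\<lambda>q. dd c f q u *\<^sub>R Z q + f q *\<^sub>R nab Z q u) p v"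
      by (rule nab_cong) (auto simp: nab_scaleR f Z p)
    then show ?thesis
      by (simp add: nab_add nab_scaleR chart_smooth_scaleR chart_smooth_dd chart_smooth_nab_const f Z p)
  qed
  then show ?thesis
    using dd_commute[OF f p, of x y] by (simp add: curv2_def algebra_simps)
qed

lemma curv2_expand:
  assumes Z: "chart_smooth Z" and p: "p \<in> U"
  shows "curv2 Z p x y = (\<Sum>b\<in>Basis. (Z p \<bullet> b) *\<^sub>R curv2 (\<lambda>q. b) p x y)"
proof -
  have sm: "chart_smooth (\<lambda>q. (Z q \<bullet> b) *\<^sub>R b)" for b :: "real^'n"
    by (intro chart_smooth_scaleR chart_smooth_const chart_smooth_bounded_linear[OF bounded_linear_inner_left Z])
  have sum: "finite I \<Longrightarrow> curv2 (\<lambda>q. \<Sum>b\<in>I. (Z q \<bullet> b) *\<^sub>R b) p x y = (\<Sum>b\<in>I. (Z p \<bullet> b) *\<^sub>R curv2 (\<lambda>q. b) p x y)"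
    for I :: "(real^'n) set"
  proof (induction I rule: finite_induct)
    case empty
    show ?case by (simp add: curv2_scaleR[OF chart_smooth_const[of 0] chart_smooth_const[of 0] p, simplified])
  next
    case (insert b I)
    then show ?case
      by (simp add: curv2_add[OF sm chart_smooth_sum[OF _ sm] p] curv2_scaleR[OF chart_smooth_bounded_linear[OF bounded_linear_inner_left Z] chart_smooth_const p])
  qed
  from sum[OF finite_Basis] show ?thesis by (simp add: euclidean_representation)
qed

lemma curv2_tensorial:
  assumes "chart_smooth Z" "p \<in> U"
  shows "curv2 Z p x y = curv2 (\<lambda>q. Z p) p x y"
  by (subst (1 2) curv2_expand) (use assms chart_smooth_const in auto)

definition Rm :: "'m \<Rightarrow> real^'n \<Rightarrow> real^'n \<Rightarrow> real^'n \<Rightarrow> real^'n" where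
  "Rm p x y z = curv2 (\<lambda>q. z) p x y"

lemma curv2_eq_Rm: "chart_smooth Z \<Longrightarrow> p \<in> U \<Longrightarrow> curv2 Z p x y = Rm p x y (Z p)"
  unfolding Rm_def by (rule curv2_tensorial)

lemma Rm_linear: "p \<in> U \<Longrightarrow> linear (Rm p x y)"
  unfolding Rm_def
  by (rule linearI) (use curv2_add[OF chart_smooth_const chart_smooth_const] curv2_scaleR[OF chart_smooth_const chart_smooth_const] in simp_all)

lemma Rm_antisym_left: "Rm p x y z = - Rm p y x z"
  by (simp add: Rm_def curv2_def)

text \<open>The commutator of second derivatives of the function \<open>g(z,z)\<close> is zero,
  and by metric compatibility it equals \<open>2 g(R(x,y)z, z)\<close>.\<close>

lemma Rm_skew_diag: "p \<in> U \<Longrightarrow> g c p (Rm p x y z) z = 0"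
proof -
  assume p: "p \<in> U"
  let ?z = "\<lambda>q::'m. z"
  have N: "chart_smooth (\<lambda>q. nab ?z q u)" for u by (rule chart_smooth_nab_const[OF chart_smooth_const])
  have "dd c (\<lambda>q. dd c (\<lambda>q. g c q z z) q u) p v
      = 2 * g c p (nab (\<lambda>q. nab ?z q u) p v) z + 2 * g c p (nab ?z p u) (nab ?z p v)" for u v
  proof -
    have "dd c (\<lambda>q. dd c (\<lambda>q. g c q z z) q u) p v = dd c (\<lambda>q. 2 * g c q (nab ?z q u) z) p v"
      by (rule dd_cong[OF _ p]) (simp add: dd_metric[OF chart_smooth_const chart_smooth_const] g_sym)
    also have "\<dots> = 2 * dd c (\<lambda>q. g c q (nab ?z q u) z) p v"
      by (rule dd_bounded_linear[OF bounded_linear_mult_right chart_smooth_metric[OF N chart_smooth_const] p])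
    also have "\<dots> = 2 * g c p (nab (\<lambda>q. nab ?z q u) p v) z + 2 * g c p (nab ?z p u) (nab ?z p v)"
      by (simp add: dd_metric[OF N chart_smooth_const p])
    finally show ?thesis .
  qed
  from this[of x y] this[of y x] dd_commute[OF chart_smooth_g p, of z z x y] show ?thesis
    using g_sym[OF p, of "nab ?z p x" "nab ?z p y"] by (simp add: Rm_def curv2_def g_simps[OF p])
qed

lemma Rm_skew: "p \<in> U \<Longrightarrow> g c p (Rm p x y z) w = - g c p (Rm p x y w) z"
  using Rm_skew_diag[of p x y z] Rm_skew_diag[of p x y w] Rm_skew_diag[of p x y "z + w"]
  by (simp add: linear_add[OF Rm_linear] g_simps)

text \<open>For constant fields \<open>\<nabla>\<^sub>a b = \<nabla>\<^sub>b a\<close>, so the six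
  second derivatives in the cyclic sum cancel in pairs.\<close>

lemma Rm_bianchi: "p \<in> U \<Longrightarrow> Rm p x y z + Rm p y z x + Rm p z x y = 0"
proof -
  assume p: "p \<in> U"
  have N: "nab (\<lambda>q. nab (\<lambda>q. a) q b) p u = nab (\<lambda>q. nab (\<lambda>q. b) q a) p u" for a b u
    by (rule nab_cong[OF _ p]) (simp add: nab_const christoffel_sym)
  show ?thesis
    unfolding Rm_def curv2_def using N[of z x y] N[of z y x] N[of x y z] by simp
qed

text \<open>The usual consequence of the skew symmetries and of the Bianchi identity for the four
  triples among \<open>x, y, z, w\<close>.\<close>

lemma Rm_pair: "p \<in> U \<Longrightarrow> g c p (Rm p x y z) w = g c p (Rm p z w x) y"
proof -
  assume p: "p \<in> U"
  have B: "g c p (Rm p a b d) e + g c p (Rm p b d a) e + g c p (Rm p d a b) e = 0" for a b d e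
    using Rm_bianchi[OF p, of a b d] g_simps(1,9)[OF p] by metis
  have A: "g c p (Rm p a b d) e = - g c p (Rm p b a d) e" for a b d e
    using Rm_antisym_left[of p a b d] g_simps(5)[OF p] by metis
  note S = Rm_skew[OF p]
  show ?thesis
    using B[of x y z w] B[of y z w x] B[of z w x y] B[of w x y z]
      S[of x y z w] S[of y z x w] S[of z x y w] S[of y z w x] S[of z w y x] S[of w y z x]
      S[of z w x y] S[of w x z y] S[of x z w y] S[of w x y z] S[of x y w z] S[of y w x z]
      A[of x z y w] A[of z x y w] A[of y w x z] A[of w y x z] A[of x z w y] A[of w y z x]
    by linarith
qed

end

section \<open>Kaehler symmetries of the curvature\<close>

locale endo_chart = metric_chart c U g for c :: "('m, real^'n) chart" and U g +
  fixes J :: "('m, real^'n) endofield"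
  assumes J_linear: "p \<in> U \<Longrightarrow> linear (J c p)"
    and chart_smooth_J: "chart_smooth (\<lambda>q. J c q x)"
begin

lemma chart_smooth_J_apply: "chart_smooth Y \<Longrightarrow> chart_smooth (\<lambda>q. J c q (Y q))"
  by (rule chart_smooth_linear_apply[OF J_linear chart_smooth_J])

end

locale kaehler_chart = endo_chart +
  assumes J_square: "p \<in> U \<Longrightarrow> J c p (J c p x) = - x"
    and J_isometry: "p \<in> U \<Longrightarrow> g c p (J c p x) (J c p y) = g c p x y"
    and J_parallel: "p \<in> U \<Longrightarrow> nab (\<lambda>q. J c q y) p x = J c p (nab (\<lambda>q. y) p x)"
begin

text \<open>Parallelism of \<open>J\<close>, given for constant fields, extends to all fields by
  the product rule.\<close>

lemma nab_J: "chart_smooth Y \<Longrightarrow> p \<in> U \<Longrightarrow> nab (\<lambda>q. J c q (Y q)) p x = J c p (nab Y p x)"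
  using J_parallel[of p "Y p" x]
  by (simp add: nab_def dd_linear_apply[OF J_linear chart_smooth_J] dd_const linear_add[OF J_linear])

lemma Rm_J: "p \<in> U \<Longrightarrow> Rm p x y (J c p z) = J c p (Rm p x y z)"
proof -
  assume p: "p \<in> U"
  have "nab (\<lambda>q. nab (\<lambda>q. J c q z) q u) p v = J c p (nab (\<lambda>q. nab (\<lambda>q. z) q u) p v)" for u v
  proof -
    have "nab (\<lambda>q. nab (\<lambda>q. J c q z) q u) p v = nab (\<lambda>q. J c q (nab (\<lambda>q. z) q u)) p v"
      by (rule nab_cong[OF _ p]) (rule J_parallel)
    then show ?thesis by (simp add: nab_J[OF chart_smooth_nab_const[OF chart_smooth_const] p])
  qed
  then have "curv2 (\<lambda>q. J c q z) p x y = J c p (Rm p x y z)"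
    by (simp add: Rm_def curv2_def linear_diff[OF J_linear[OF p]])
  then show ?thesis using curv2_eq_Rm[OF chart_smooth_J p] by simp
qed

lemma Rm_JJ: "p \<in> U \<Longrightarrow> g c p (Rm p x y (J c p z)) (J c p w) = g c p (Rm p x y z) w"
  by (simp add: Rm_J J_isometry)

end

section \<open>Curvature of an SKR structure in the adapted frame\<close>

text \<open>Frame indices are numerals; rewriting the index 1 to \<open>Suc 0\<close> would keep
  the rules about \<open>e\<^sub>1\<close> from applying.\<close>

declare One_nat_def [simp del]

text \<open>These equations between curvature components amount to the asserted matrix form;
  \<open>b\<close>, \<open>c\<close>, \<open>d\<close>, \<open>r\<close> are the components 1212,
  1234, 3434 and 1313. They are written with right-hand side zero so that each can be extended to
  the boundary as the vanishing of a smooth function.\<close>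

definition skr_curvature_pattern :: "(nat \<Rightarrow> nat \<Rightarrow> nat \<Rightarrow> nat \<Rightarrow> real) \<Rightarrow> bool" where
  "skr_curvature_pattern T \<longleftrightarrow>
     (\<forall>i j k l. T j i k l + T i j k l = 0) \<and>
     (\<forall>k l. T 2 3 k l + T 1 4 k l = 0) \<and> (\<forall>k l. T 2 4 k l - T 1 3 k l = 0) \<and>
     T 1 2 1 3 = 0 \<and> T 1 2 1 4 = 0 \<and> T 1 2 2 3 = 0 \<and> T 1 2 2 4 = 0 \<and>
     T 3 4 1 3 = 0 \<and> T 3 4 1 4 = 0 \<and> T 3 4 2 3 = 0 \<and> T 3 4 2 4 = 0 \<and>
     T 1 3 1 2 = 0 \<and> T 1 3 3 4 = 0 \<and> T 1 3 1 4 = 0 \<and> T 1 3 2 3 = 0 \<and>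
     T 1 4 1 2 = 0 \<and> T 1 4 3 4 = 0 \<and> T 1 4 1 3 = 0 \<and> T 1 4 2 4 = 0 \<and>
     T 3 4 1 2 - T 1 2 3 4 = 0 \<and> T 1 3 2 4 - T 1 3 1 3 = 0 \<and>
     T 1 4 1 4 - T 1 3 1 3 = 0 \<and> T 1 4 2 3 + T 1 3 1 3 = 0"

text \<open>Linear algebra of Kaehler curvature tensors for \<open>Je\<^sub>1 = e\<^sub>2\<close>,
  \<open>Je\<^sub>3 = e\<^sub>4\<close>: the hypotheses \<open>J\<close> are invariance under
  \<open>J\<close> in the last two slots, and together with pair symmetry they reduce every
  component to one of those named in \<open>0\<close> and \<open>r\<close> or to 1212, 1234,
  3434.\<close>

lemma skr_curvature_patternI:
  assumes A: "\<And>i j k l. T j i k l = - T i j k l" and S: "\<And>i j k l. T i j l k = - T i j k l"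
    and P: "\<And>i j k l. T i j k l = T k l i j"
    and J: "\<And>i j. T i j 2 4 = T i j 1 3" "\<And>i j. T i j 2 3 = - T i j 1 4"
    and 0: "T 1 2 4 1 = 0" "T 1 2 4 2 = 0" "T 3 4 4 1 = 0" "T 3 4 4 2 = 0" "T 1 4 4 2 = 0"
    and r: "T 1 4 4 1 = T 2 4 4 2"
  shows "skr_curvature_pattern T"
proof -
  have Jl: "T 2 4 k l = T 1 3 k l" "T 2 3 k l = - T 1 4 k l" for k l
    using J[of k l] P[of 2 4 k l] P[of 1 3 k l] P[of 2 3 k l] P[of 1 4 k l] by linarith+
  have z: "T 1 2 1 4 = 0" "T 1 2 2 4 = 0" "T 3 4 1 4 = 0" "T 3 4 2 4 = 0" "T 1 4 2 4 = 0"
    using 0 S[of 1 2 4 1] S[of 1 2 4 2] S[of 3 4 4 1] S[of 3 4 4 2] S[of 1 4 4 2] by linarith+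
  have r': "T 1 4 1 4 = T 2 4 2 4" using r S[of 1 4 4 1] S[of 2 4 4 2] by linarith
  have z': "T 1 2 1 3 = 0" "T 1 2 2 3 = 0" "T 3 4 1 3 = 0" "T 3 4 2 3 = 0" "T 1 4 1 3 = 0"
    using z J[of 1 2] J[of 3 4] J[of 1 4] by linarith+
  have p: "T 1 3 1 2 = 0" "T 1 3 3 4 = 0" "T 1 3 1 4 = 0" "T 1 4 1 2 = 0" "T 1 4 3 4 = 0"
    using z z' P[of 1 3 1 2] P[of 1 3 3 4] P[of 1 3 1 4] P[of 1 4 1 2] P[of 1 4 3 4] by linarith+
  have q: "T 1 3 2 3 = 0" "T 1 3 2 4 = T 1 3 1 3" "T 1 4 2 3 = - T 1 4 1 4" "T 1 4 1 4 = T 1 3 1 3"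
    using p J[of 1 3] J[of 1 4] r' Jl[of 2 4] by linarith+
  have A': "T j i k l + T i j k l = 0" for i j k l using A[of j i k l] by linarith
  have Jl': "T 2 4 k l - T 1 3 k l = 0" "T 2 3 k l + T 1 4 k l = 0" for k l using Jl[of k l] by linarith+
  show ?thesis
    unfolding skr_curvature_pattern_def
    by (intro conjI allI; (rule A' Jl' | use z z' p q P[of 3 4 1 2] in linarith))
qed

text \<open>The data that the frame and its curvature components depend on, with what makes them
  smooth; this is available up to the boundary.\<close>

locale skr_frame_chart = endo_chart c U g J for c :: "('m, real^4) chart" and U g J +
  fixes \<tau> :: "'m \<Rightarrow> real" and w :: "('m, real^4) vfield"
  assumes chart_smooth_\<tau>: "chart_smooth \<tau>"
    and regular: "p \<in> U \<Longrightarrow> \<exists>x. dd c \<tau> p x \<noteq> 0"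
    and chart_smooth_w: "chart_smooth (w c)"
    and w_nonzero: "p \<in> U \<Longrightarrow> w c p \<noteq> 0"
begin

abbreviation "v \<equiv> grad g \<tau> c"
abbreviation "u \<equiv> Jgrad g J \<tau> c"
abbreviation "Q \<equiv> Qfun g \<tau> c"
abbreviation "e \<equiv> skr_frame g J \<tau> w"

lemma grad_dual: "p \<in> U \<Longrightarrow> g c p (v p) x = dd c \<tau> p x"
  unfolding grad_def by (rule sharp_cramer(2)[OF _ dd_linear[OF chart_smooth_\<tau>]])

lemma chart_smooth_grad: "chart_smooth v"
  unfolding grad_def by (rule chart_smooth_sharp[OF dd_linear[OF chart_smooth_\<tau>] chart_smooth_dd[OF chart_smooth_\<tau>]])

lemma chart_smooth_Jgrad: "chart_smooth u"
  unfolding Jgrad_def by (rule chart_smooth_J_apply[OF chart_smooth_grad])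

lemma chart_smooth_Q: "chart_smooth Q"
  unfolding Qfun_def by (rule chart_smooth_metric[OF chart_smooth_grad chart_smooth_grad])

lemma Q_pos: "p \<in> U \<Longrightarrow> 0 < Q p"
  using regular[of p] g_pos[of p "v p"] grad_dual[of p] g_simps(9)[of p] unfolding Qfun_def by fastforce

lemma chart_smooth_skr_frame: "chart_smooth (e i c)"
proof -
  have w1: "chart_smooth (\<lambda>q. (1 / sqrt (g c q (w c q) (w c q))) *\<^sub>R w c q)"
    unfolding inverse_eq_divide[symmetric]
    by (intro chart_smooth_scaleR chart_smooth_inverse_sqrt chart_smooth_metric chart_smooth_w g_pos w_nonzero)
  have s: "chart_smooth (\<lambda>q. 1 / sqrt (Q q))"
    unfolding inverse_eq_divide[symmetric] by (intro chart_smooth_inverse_sqrt chart_smooth_Q Q_pos)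
  have 3: "chart_smooth (\<lambda>q. (1 / sqrt (Q q)) *\<^sub>R u q)" and 4: "chart_smooth (\<lambda>q. - ((1 / sqrt (Q q)) *\<^sub>R v q))"
    by (intro chart_smooth_minus chart_smooth_scaleR s chart_smooth_Jgrad chart_smooth_grad)+
  consider "i = 1" | "i = 2" | "i = 3" | "i \<notin> {1,2,3}" by auto
  then show ?thesis
    using w1 chart_smooth_J_apply[OF w1] 3 4 by cases (simp_all add: skr_frame_def[abs_def])
qed

lemma chart_smooth_curv_comp: "chart_smooth (curv_comp g e i j k l c)"
proof -
  note sm = chart_smooth_skr_frame
  show ?thesis unfolding curv_comp_def by (intro chart_smooth_metric chart_smooth_curv sm)
qed

text \<open>Each equation of the pattern is the vanishing of a function that is smooth up to the
  boundary.\<close>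

lemma curvature_pattern_closed:
  assumes int: "\<And>q. q \<in> U \<Longrightarrow> cmap c q \<in> interior (cimg c) \<Longrightarrow>
      skr_curvature_pattern (\<lambda>i j k l. curv_comp g e i j k l c q)"
    and p: "p \<in> U"
  shows "skr_curvature_pattern (\<lambda>i j k l. curv_comp g e i j k l c p)"
proof -
  let ?P = "\<lambda>q. skr_curvature_pattern (\<lambda>i j k l. curv_comp g e i j k l c q)"
  note cl = chart_smooth_vanishes_on_closure[OF _ _ p]
  have 0: "curv_comp g e i j k l c p = 0" if "\<And>q. ?P q \<Longrightarrow> curv_comp g e i j k l c q = 0" for i j k l
    using that int by (intro cl[OF chart_smooth_curv_comp]) blast
  have add: "curv_comp g e i j k l c p + curv_comp g e i' j' k' l' c p = 0"
    if "\<And>q. ?P q \<Longrightarrow> curv_comp g e i j k l c q + curv_comp g e i' j' k' l' c q = 0" for i j k l i' j' k' l'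
    using that int by (intro cl[OF chart_smooth_add[OF chart_smooth_curv_comp chart_smooth_curv_comp]]) blast
  have diff: "curv_comp g e i j k l c p - curv_comp g e i' j' k' l' c p = 0"
    if "\<And>q. ?P q \<Longrightarrow> curv_comp g e i j k l c q - curv_comp g e i' j' k' l' c q = 0" for i j k l i' j' k' l'
    using that int by (intro cl[OF chart_smooth_diff[OF chart_smooth_curv_comp chart_smooth_curv_comp]]) blast
  show ?thesis
    unfolding skr_curvature_pattern_def
    by (intro conjI allI; (rule add | rule diff | rule 0); unfold skr_curvature_pattern_def; elim conjE; (assumption | erule allE)+)
qed

end

text \<open>The equations for the Hessian of \<open>\<tau>\<close> on horizontal vectors, together
  with the Kaehler and Killing equations, as they hold over interior points. In
  \<open>Q_relation\<close> the two alternatives are the irreducible and the reducible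
  case.\<close>

locale kaehler_skr_chart = skr_frame_chart c U g J \<tau> w + kaehler_chart c U g J
  for c :: "('m, real^4) chart" and U g J \<tau> w +
  fixes \<phi> :: "'m \<Rightarrow> real"
  assumes killing: "p \<in> U \<Longrightarrow> lie_metric g (Jgrad g J \<tau>) c p x y = 0"
    and w_horizontal: "p \<in> U \<Longrightarrow> w c p \<in> horiz g J \<tau> c p"
    and hess_eigen: "p \<in> U \<Longrightarrow> x \<in> horiz g J \<tau> c p \<Longrightarrow> x \<noteq> 0 \<Longrightarrow> \<exists>\<mu>. hess_endo g \<tau> c p x = \<mu> *\<^sub>R x"
    and hess_horizontal: "p \<in> U \<Longrightarrow> x \<in> horiz g J \<tau> c p \<Longrightarrow> y \<in> horiz g J \<tau> c p \<Longrightarrow>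
      hess g \<tau> c p x y = \<phi> p * g c p x y"
    and Q_relation: "(\<exists>\<kappa>. \<forall>p\<in>U. Q p = 2 * (\<tau> p - \<kappa>) * \<phi> p) \<or> (\<forall>p\<in>U. \<phi> p = 0)"
begin

abbreviation "H \<equiv> nab v"

lemma hess_endo_eq: "hess_endo g \<tau> c p x = H p x"
  by (simp add: hess_endo_def nabla_eq_nab cfield_def)

lemma J_skew: "p \<in> U \<Longrightarrow> g c p (J c p x) y = - g c p x (J c p y)"
  using J_isometry[of p x "J c p y"] by (simp add: J_square g_simps)

lemma J_diag: "p \<in> U \<Longrightarrow> g c p x (J c p x) = 0" "p \<in> U \<Longrightarrow> g c p (J c p x) x = 0"
  using J_skew[of p x x] g_sym[of p x "J c p x"] by simp_all

text \<open>\<open>g(Hx,y)\<close> and the second derivative of \<open>\<tau>\<close> differ by a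
  Christoffel term, and both the latter are symmetric.\<close>

lemma H_sym: "p \<in> U \<Longrightarrow> g c p (H p x) y = g c p (H p y) x"
proof -
  assume p: "p \<in> U"
  have "dd c (\<lambda>q. dd c \<tau> q b) p a = g c p (H p a) b + g c p (v p) (\<Gamma> p a b)" for a b
  proof -
    have "dd c (\<lambda>q. dd c \<tau> q b) p a = dd c (\<lambda>q. g c q (v q) b) p a"
      by (rule dd_cong[OF _ p]) (simp add: grad_dual)
    then show ?thesis by (simp add: dd_metric[OF chart_smooth_grad chart_smooth_const p] nab_const p)
  qed
  then show ?thesis
    using dd_commute[OF chart_smooth_\<tau> p, of x y] christoffel_sym[OF p, of x y] by simp
qed

lemma nab_u: "p \<in> U \<Longrightarrow> nab u p x = J c p (H p x)"
  unfolding Jgrad_def by (rule nab_J[OF chart_smooth_grad])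

text \<open>The Killing equation says that \<open>\<nabla>u = JH\<close> is skew; since
  \<open>H\<close> is symmetric and \<open>J\<close> is skew, this means \<open>JH =
  HJ\<close>.\<close>

lemma H_J: "p \<in> U \<Longrightarrow> H p (J c p x) = J c p (H p x)"
proof -
  assume p: "p \<in> U"
  have K: "g c p (J c p (H p a)) b + g c p a (J c p (H p b)) = 0" for a b
  proof -
    have "0 = dd c (\<lambda>q. g c q a b) p (u p) + g c p (dd c u p a) b + g c p a (dd c u p b)"
      using killing[OF p, of a b] p
      by (simp add: lie_metric_def lie_bracket_def cfield_def dd_const g_simps)
    also have "\<dots> = g c p (nab u p a) b + g c p a (nab u p b)"
      by (simp add: christoffel_metric[OF p] nab_def g_simps[OF p] christoffel_sym[OF p, of "u p"])
    finally show ?thesis by (simp add: nab_u p)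
  qed
  show ?thesis
  proof (rule g_ext[OF p])
    fix y
    have "g c p (H p (J c p x)) y = g c p (J c p x) (H p y)"
      using H_sym[OF p, of "J c p x" y] g_sym[OF p] by simp
    also have "\<dots> = - g c p x (J c p (H p y))" by (rule J_skew[OF p])
    also have "\<dots> = g c p (J c p (H p x)) y" using K[of x y] by simp
    finally show "g c p (H p (J c p x)) y = g c p (J c p (H p x)) y" .
  qed
qed

lemma horiz_iff: "p \<in> U \<Longrightarrow> x \<in> horiz g J \<tau> c p \<longleftrightarrow> g c p x (v p) = 0 \<and> g c p x (u p) = 0"
proof -
  assume p: "p \<in> U"
  show ?thesis
  proof
    assume "x \<in> horiz g J \<tau> c p"
    then show "g c p x (v p) = 0 \<and> g c p x (u p) = 0"
      by (auto simp: horiz_def vert_def span_base)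
  next
    assume a: "g c p x (v p) = 0 \<and> g c p x (u p) = 0"
    have "g c p x y = 0" if "y \<in> span {v p, u p}" for y
      using that a by (induction rule: span_induct_alt) (auto simp: g_simps p)
    then show "x \<in> horiz g J \<tau> c p" by (simp add: horiz_def vert_def)
  qed
qed

lemma horiz_J: "p \<in> U \<Longrightarrow> x \<in> horiz g J \<tau> c p \<Longrightarrow> J c p x \<in> horiz g J \<tau> c p"
  by (simp add: horiz_iff J_skew Jgrad_def J_square g_simps)

lemma H_horizontal: "p \<in> U \<Longrightarrow> x \<in> horiz g J \<tau> c p \<Longrightarrow> H p x = \<phi> p *\<^sub>R x"
proof (cases "x = 0")
  case False
  assume a: "p \<in> U" "x \<in> horiz g J \<tau> c p"
  from hess_eigen[OF a False] obtain \<mu> where mu: "H p x = \<mu> *\<^sub>R x" by (auto simp: hess_endo_eq)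
  have "\<mu> * g c p x x = \<phi> p * g c p x x"
    using hess_horizontal[OF a a(2)] mu by (simp add: hess_def hess_endo_eq g_simps a)
  then show ?thesis using g_pos[OF a(1) False] mu by simp
qed (simp add: linear_0[OF nab_linear[OF chart_smooth_grad]])

lemma e_simps:
  shows "e 1 c p = (1 / sqrt (g c p (w c p) (w c p))) *\<^sub>R w c p"
    and "e 2 c p = J c p (e 1 c p)"
    and "e 3 c p = (1 / sqrt (Q p)) *\<^sub>R u p"
    and "e 4 c p = - ((1 / sqrt (Q p)) *\<^sub>R v p)"
  by (simp_all add: skr_frame_def)

lemma J_e:
  assumes "p \<in> U"
  shows "J c p (e 1 c p) = e 2 c p" "J c p (e 2 c p) = - e 1 c p"
    "J c p (e 3 c p) = e 4 c p" "J c p (e 4 c p) = - e 3 c p"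
  using assms by (simp_all add: e_simps J_square linear_cmul[OF J_linear] linear_neg[OF J_linear] Jgrad_def )

lemma e_horizontal: "p \<in> U \<Longrightarrow> e 1 c p \<in> horiz g J \<tau> c p" "p \<in> U \<Longrightarrow> e 2 c p \<in> horiz g J \<tau> c p"
proof -
  assume p: "p \<in> U"
  show 1: "e 1 c p \<in> horiz g J \<tau> c p"
    using w_horizontal[OF p] by (simp add: horiz_iff e_simps g_simps p)
  show "e 2 c p \<in> horiz g J \<tau> c p" using horiz_J[OF p 1] by (simp add: J_e p)
qed

lemma e_orthonormal:
  assumes p: "p \<in> U" and ij: "i \<in> {1..4}" "j \<in> {1..4}"
  shows "g c p (e i c p) (e j c p) = (if i = j then 1 else 0)"
proof -
  have ww: "0 < g c p (w c p) (w c p)" using g_pos[OF p w_nonzero[OF p]] .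
  have vv: "g c p (v p) (v p) = Q p" by (simp add: Qfun_def)
  have 11: "g c p (e 1 c p) (e 1 c p) = 1"
    using ww by (simp add: e_simps g_simps p)
  have 44: "g c p (e 4 c p) (e 4 c p) = 1"
    using Q_pos[OF p] by (simp add: e_simps g_simps p vv)
  have h: "g c p (e i c p) (e 3 c p) = 0" "g c p (e i c p) (e 4 c p) = 0"
    if "i = 1 \<or> i = 2" for i
  proof -
    have "e i c p \<in> horiz g J \<tau> c p" using that e_horizontal[OF p] by auto
    then show "g c p (e i c p) (e 3 c p) = 0" "g c p (e i c p) (e 4 c p) = 0"
      by (simp_all add: horiz_iff e_simps g_simps p)
  qed
  have 22: "g c p (e 2 c p) (e 2 c p) = 1" using J_isometry[OF p, of "e 1 c p" "e 1 c p"] 11 by (simp add: J_e p)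
  have 33: "g c p (e 3 c p) (e 3 c p) = 1" using J_isometry[OF p, of "e 3 c p" "e 3 c p"] 44 by (simp add: J_e p)
  have 12: "g c p (e 1 c p) (e 2 c p) = 0" "g c p (e 3 c p) (e 4 c p) = 0"
    using J_diag(1)[OF p, of "e 1 c p"] J_diag(1)[OF p, of "e 3 c p"] by (simp_all add: J_e p)
  have "i \<in> {1,2,3,4}" "j \<in> {1,2,3,4}" using ij by auto
  then show ?thesis
    using 11 22 33 44 12 h[of 1] h[of 2] g_sym[OF p, of "e 2 c p" "e 1 c p"] g_sym[OF p, of "e 4 c p" "e 3 c p"]
      g_sym[OF p, of "e 3 c p" "e 1 c p"] g_sym[OF p, of "e 3 c p" "e 2 c p"]
      g_sym[OF p, of "e 4 c p" "e 1 c p"] g_sym[OF p, of "e 4 c p" "e 2 c p"]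
    by auto
qed

text \<open>Four orthonormal vectors span, so the frame detects equality of vectors.\<close>

lemma e_ext:
  assumes p: "p \<in> U" and eq: "\<And>i. i \<in> {1..4} \<Longrightarrow> g c p a (e i c p) = g c p b (e i c p)"
  shows "a = b"
proof -
  \<comment> \<open>The map \<open>f\<close> sends the standard basis to the frame; it is injective by orthonormality, hence surjective.\<close>
  define E :: "4 \<Rightarrow> real^4" where
    "E k = (if k = 1 then e 1 c p else if k = 2 then e 2 c p else if k = 3 then e 3 c p else e 4 c p)" for k
  have EE: "g c p (E k) (E l) = (if k = l then 1 else 0)" for k l
    using exhaust_4[of k] exhaust_4[of l] by (auto simp: E_def e_orthonormal[OF p])
  define f :: "real^4 \<Rightarrow> real^4" where "f x = (\<Sum>k\<in>UNIV. x $ k *\<^sub>R E k)" for x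
  have fE: "g c p (f x) (E l) = x $ l" for x l
  proof -
    have "g c p (f x) (E l) = (\<Sum>k\<in>UNIV. x $ k * (if k = l then 1 else 0))"
      by (simp add: f_def linear_sum[OF g_linear_left[OF p]] g_simps[OF p] EE)
    then show ?thesis by (simp add: if_distrib cong: if_cong)
  qed
  have "linear f"
    by (rule linearI) (simp_all add: f_def scaleR_add_left sum.distrib scaleR_sum_right)
  moreover have "inj f"
    by (rule injI) (metis fE vec_eq_iff)
  ultimately have "surj f" by (rule linear_injective_imp_surjective[OF _ _ refl])
  then obtain x where x: "a - b = f x" by (metis surjD)
  have "g c p (a - b) (E l) = 0" for l
    using exhaust_4[of l] eq by (auto simp: E_def g_simps p)
  then have "x = 0" using fE[of x] x by (simp add: vec_eq_iff)
  then show "a = b" using x by (simp add: f_def)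
qed

text \<open>The vertical eigenvalue of the Hessian.\<close>

definition \<psi> :: "'m \<Rightarrow> real" where "\<psi> q = g c q (H q (e 3 c q)) (e 3 c q)"

definition eig :: "nat \<Rightarrow> 'm \<Rightarrow> real" where "eig i = (if i \<in> {1,2} then \<phi> else \<psi>)"

text \<open>On horizontal vectors this is the SKR condition. The image of \<open>e\<^sub>3\<close>
  has no horizontal component by symmetry of \<open>H\<close>, and none along \<open>e\<^sub>4 =
  Je\<^sub>3\<close> because \<open>JH\<close> is skew; \<open>e\<^sub>4\<close> follows by
  \<open>HJ = JH\<close>.\<close>

lemma H_e: 
  assumes p: "p \<in> U" and i: "i \<in> {1..4}"
  shows "H p (e i c p) = eig i p *\<^sub>R e i c p"
proof -
  have h: "H p (e i c p) = \<phi> p *\<^sub>R e i c p" if "i = 1 \<or> i = 2" for i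
    using that H_horizontal[OF p] e_horizontal[OF p] by auto
  have 3: "H p (e 3 c p) = \<psi> p *\<^sub>R e 3 c p"
  proof (rule e_ext[OF p])
    fix k :: nat assume "k \<in> {1..4}"
    then consider "k = 1 \<or> k = 2" | "k = 3" | "k = 4" by fastforce
    then show "g c p (H p (e 3 c p)) (e k c p) = g c p (\<psi> p *\<^sub>R e 3 c p) (e k c p)"
    proof cases
      case 1
      then show ?thesis
        using H_sym[OF p, of "e 3 c p" "e k c p"] h[of k] by (auto simp: g_simps p e_orthonormal)
    next
      case 2
      then show ?thesis by (simp add: \<psi>_def g_simps p e_orthonormal)
    next
      case 3
      have "g c p (H p (e 3 c p)) (e 4 c p) = - g c p (J c p (H p (e 3 c p))) (e 3 c p)"
        using J_skew[OF p, of "H p (e 3 c p)" "e 3 c p"] by (simp add: J_e p)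
      also have "\<dots> = - g c p (H p (e 4 c p)) (e 3 c p)"
        by (simp add: J_e p flip: H_J)
      also have "\<dots> = - g c p (H p (e 3 c p)) (e 4 c p)" using H_sym[OF p] by simp
      finally show ?thesis using 3 by (simp add: g_simps p e_orthonormal)
    qed
  qed
  have "H p (e 4 c p) = J c p (H p (e 3 c p))" by (simp add: J_e p flip: H_J)
  then have 4: "H p (e 4 c p) = \<psi> p *\<^sub>R e 4 c p"
    using 3 by (simp add: linear_cmul[OF J_linear] J_e p)
  have "i \<in> {1,2,3,4}" using i by auto
  then show ?thesis using h[of 1] h[of 2] 3 4 by (auto simp: eig_def)
qed

lemma chart_smooth_\<phi>: "chart_smooth \<phi>"
proof -
  have "chart_smooth (\<lambda>q. g c q (H q (e 1 c q)) (e 1 c q))"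
    by (intro chart_smooth_metric chart_smooth_nab chart_smooth_skr_frame chart_smooth_grad)
  then show ?thesis
    by (rule iffD1[OF chart_smooth_cong, rotated]) (simp add: H_e eig_def g_simps e_orthonormal)
qed

lemma chart_smooth_eig: "chart_smooth (eig i)"
proof -
  have "chart_smooth \<psi>" unfolding \<psi>_def[abs_def] by (intro chart_smooth_metric chart_smooth_nab chart_smooth_skr_frame chart_smooth_grad)
  then show ?thesis using chart_smooth_\<phi> by (simp add: eig_def)
qed

text \<open>Along a horizontal vector \<open>x\<close> one has \<open>d\<tau>(x) = g(v,x) =
  0\<close> and \<open>dQ(x) = 2g(Hx,v) = 2\<phi> g(x,v) = 0\<close>. Differentiating \<open>Q =
  2(\<tau> - \<kappa>)\<phi>\<close> leaves \<open>(\<tau> - \<kappa>) d\<phi>(x) = 0\<close>, and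
  \<open>\<tau> \<noteq> \<kappa>\<close> since \<open>Q > 0\<close>.\<close>

lemma dd_\<phi>_horizontal:
  assumes p: "p \<in> U" and x: "x \<in> horiz g J \<tau> c p"
  shows "dd c \<phi> p x = 0"
  using Q_relation
proof
  assume "\<exists>\<kappa>. \<forall>p\<in>U. Q p = 2 * (\<tau> p - \<kappa>) * \<phi> p"
  then obtain \<kappa> where \<kappa>: "\<And>q. q \<in> U \<Longrightarrow> Q q = 2 * (\<tau> q - \<kappa>) * \<phi> q" by blast
  have d\<tau>: "dd c \<tau> p x = 0"
    using x p g_sym[OF p, of x "v p"] by (simp add: horiz_iff flip: grad_dual)
  have "dd c Q p x = 2 * g c p (H p x) (v p)"
    unfolding Qfun_def using g_sym[OF p, of "v p" "H p x"] by (simp add: dd_metric chart_smooth_grad p)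
  also have "\<dots> = 0" using x by (simp add: H_horizontal p g_simps horiz_iff)
  finally have "dd c Q p x = 0" .
  moreover have "dd c Q p x = dd c (\<lambda>q. (2 * (\<tau> q - \<kappa>)) * \<phi> q) p x"
    by (rule dd_cong[OF \<kappa> p])
  moreover have "\<dots> = 2 * (\<tau> p - \<kappa>) * dd c \<phi> p x"
    by (simp add: dd_mult chart_smooth_mult chart_smooth_diff chart_smooth_const chart_smooth_\<tau> chart_smooth_\<phi> p dd_diff dd_const d\<tau>)
  ultimately show ?thesis using \<kappa>[OF p] Q_pos[OF p] by auto
next
  assume "\<forall>p\<in>U. \<phi> p = 0"
  then show ?thesis using dd_cong[of \<phi> "\<lambda>q. 0" p x] p by (simp add: dd_const)
qed

text \<open>The connection coefficients of the frame.\<close>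

definition \<omega> :: "'m \<Rightarrow> real^4 \<Rightarrow> nat \<Rightarrow> nat \<Rightarrow> real" where
  "\<omega> p x i k = g c p (nab (e i c) p x) (e k c p)"

text \<open>The Ricci identity for \<open>v\<close> in the frame: differentiate
  \<open>\<nabla>\<^sub>X v = \<lambda>\<^sub>i X\<close> for \<open>X = e\<^sub>i\<close> along
  \<open>e\<^sub>j\<close>, antisymmetrise, and use that the connection is torsion-free to rewrite
  the bracket term, on whose \<open>e\<^sub>k\<close> component \<open>H\<close> acts by
  \<open>\<lambda>\<^sub>k\<close>.\<close>

lemma Rm_grad:
  assumes p: "p \<in> U" and i: "i \<in> {1..4}" and j: "j \<in> {1..4}" and k: "k \<in> {1..4}"
  shows "g c p (Rm p (e i c p) (e j c p) (v p)) (e k c p) =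
    dd c (eig i) p (e j c p) * (if i = k then 1 else 0) - dd c (eig j) p (e i c p) * (if j = k then 1 else 0)
    + (eig i p - eig k p) * \<omega> p (e j c p) i k - (eig j p - eig k p) * \<omega> p (e i c p) j k"
proof -
  note sm = chart_smooth_skr_frame
  have He: "nab (\<lambda>q. H q (e i c p)) p y = nab (\<lambda>q. eig i q *\<^sub>R e i c q) p y - H p (dd c (e i c) p y)"
    if "i \<in> {1..4}" for i y
    using nab_apply[OF sm chart_smooth_grad p, of i y] nab_cong[of "\<lambda>q. H q (e i c q)" "\<lambda>q. eig i q *\<^sub>R e i c q" p y]
      H_e[OF _ that] p by simp
  have tors: "dd c (e i c) p (e j c p) - dd c (e j c) p (e i c p) = nab (e i c) p (e j c p) - nab (e j c) p (e i c p)"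
    using christoffel_sym[OF p] by (simp add: nab_def)
  have HE: "g c p (H p a) (e k c p) = eig k p * g c p a (e k c p)" for a
    using H_sym[OF p, of a "e k c p"] H_e[OF p k] g_sym[OF p] by (simp add: g_simps p)
  have "Rm p (e i c p) (e j c p) (v p) = curv2 v p (e i c p) (e j c p)"
    using curv2_eq_Rm[OF chart_smooth_grad p] by simp
  also have "\<dots> = nab (\<lambda>q. eig i q *\<^sub>R e i c q) p (e j c p) - nab (\<lambda>q. eig j q *\<^sub>R e j c q) p (e i c p)
     - H p (nab (e i c) p (e j c p) - nab (e j c) p (e i c p))"
    unfolding curv2_def He[OF i] He[OF j] tors[symmetric] by (simp add: linear_diff[OF nab_linear[OF chart_smooth_grad p]])
  finally have eq: "Rm p (e i c p) (e j c p) (v p) = nab (\<lambda>q. eig i q *\<^sub>R e i c q) p (e j c p)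
     - nab (\<lambda>q. eig j q *\<^sub>R e j c q) p (e i c p) - H p (nab (e i c) p (e j c p) - nab (e j c) p (e i c p))" .
  show ?thesis
    unfolding eq by (simp add: g_simps[OF p] HE nab_scaleR[OF chart_smooth_eig sm p] \<omega>_def e_orthonormal[OF p i k] e_orthonormal[OF p j k] algebra_simps)
qed

text \<open>As \<open>e\<^sub>4\<close> is a multiple of \<open>v\<close>, its covariant
  derivative is, up to a multiple of \<open>v\<close>, that multiple of \<open>Hx\<close>.\<close>

lemma \<omega>_4:
  assumes p: "p \<in> U" and k: "k \<in> {1..3}"
  shows "\<omega> p x 4 k = - (1 / sqrt (Q p)) * eig k p * g c p x (e k c p)"
proof -
  let ?s = "\<lambda>q. 1 / sqrt (Q q)"
  have s: "chart_smooth ?s"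
    unfolding inverse_eq_divide[symmetric] by (intro chart_smooth_inverse_sqrt chart_smooth_Q Q_pos)
  have e4: "e 4 c = (\<lambda>q. - (?s q *\<^sub>R v q))" by (rule ext) (simp add: e_simps)
  have k4: "k \<in> {1..4}" "k \<noteq> 4" using k by auto
  have "g c p (e 4 c p) (e k c p) = 0" using e_orthonormal[OF p _ k4(1), of 4] k4 by simp
  then have vk: "g c p (v p) (e k c p) = 0" using Q_pos[OF p] by (simp add: e_simps g_simps p)
  have "nab (e 4 c) p x = - (dd c ?s p x *\<^sub>R v p + ?s p *\<^sub>R H p x)"
    unfolding e4 using nab_minus[OF chart_smooth_scaleR[OF s chart_smooth_grad] p] nab_scaleR[OF s chart_smooth_grad p] by simp
  moreover have "g c p (H p x) (e k c p) = eig k p * g c p x (e k c p)"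
    using H_sym[OF p, of x "e k c p"] H_e[OF p k4(1)] g_sym[OF p] by (simp add: g_simps p)
  ultimately show ?thesis by (simp add: \<omega>_def g_simps p vk)
qed

text \<open>\<open>e\<^sub>4 = Je\<^sub>3\<close> and \<open>J\<close> is parallel.\<close>

lemma \<omega>_3:
  assumes p: "p \<in> U"
  shows "\<omega> p x 3 1 = \<omega> p x 4 2" "\<omega> p x 3 2 = - \<omega> p x 4 1"
proof -
  have "nab (e 4 c) p x = J c p (nab (e 3 c) p x)"
    using nab_J[OF chart_smooth_skr_frame p, of 3 x] nab_cong[of "\<lambda>q. J c q (e 3 c q)" "e 4 c" p x] p by (simp add: J_e)
  then show "\<omega> p x 3 1 = \<omega> p x 4 2" "\<omega> p x 3 2 = - \<omega> p x 4 1"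
    using J_skew[OF p, of "nab (e 3 c) p x"] J_isometry[OF p, of "nab (e 3 c) p x" "e 1 c p"]
    by (simp_all add: \<omega>_def J_e p g_simps)
qed

lemma curv_comp_eq: "p \<in> U \<Longrightarrow> curv_comp g e i j k l c p = g c p (Rm p (e i c p) (e j c p) (e k c p)) (e l c p)"
  by (simp add: curv_comp_def curv_eq_curv2 curv2_eq_Rm chart_smooth_skr_frame)

lemma curvature_pattern_interior:
  assumes p: "p \<in> U"
  shows "skr_curvature_pattern (\<lambda>i j k l. curv_comp g e i j k l c p)"
proof -
  define T where "T i j k l = g c p (Rm p (e i c p) (e j c p) (e k c p)) (e l c p)" for i j k l
  have T4: "T i j 4 k = - (1 / sqrt (Q p)) * g c p (Rm p (e i c p) (e j c p) (v p)) (e k c p)" for i j k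
    by (simp add: T_def e_simps(4) linear_cmul[OF Rm_linear] linear_neg[OF Rm_linear] g_simps p)
  have eig: "eig 1 = \<phi>" "eig 2 = \<phi>" "eig 3 = \<psi>" "eig 4 = \<psi>" by (simp_all add: eig_def)
  have d\<phi>: "dd c \<phi> p (e 1 c p) = 0" "dd c \<phi> p (e 2 c p) = 0"
    using dd_\<phi>_horizontal[OF p] e_horizontal[OF p] by auto
  note on = e_orthonormal[OF p]
  have "skr_curvature_pattern T"
  proof (rule skr_curvature_patternI)
    show "T j i k l = - T i j k l" for i j k l
      unfolding T_def by (subst Rm_antisym_left) (simp add: g_simps p)
    show "T i j l k = - T i j k l" for i j k l
      unfolding T_def by (rule Rm_skew[OF p])
    show "T i j k l = T k l i j" for i j k l
      unfolding T_def by (rule Rm_pair[OF p])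
    show "T i j 2 4 = T i j 1 3" for i j
      using Rm_JJ[OF p, of "e i c p" "e j c p" "e 1 c p" "e 3 c p"] by (simp add: T_def J_e p)
    show "T i j 2 3 = - T i j 1 4" for i j
      using Rm_JJ[OF p, of "e i c p" "e j c p" "e 1 c p" "e 4 c p"] by (simp add: T_def J_e p g_simps)
    show "T 1 2 4 1 = 0" "T 1 2 4 2 = 0"
      unfolding T4 by (simp_all add: Rm_grad p eig d\<phi> )
    show "T 3 4 4 1 = 0" "T 3 4 4 2 = 0"
      unfolding T4 by (simp_all add: Rm_grad p eig \<omega>_3 \<omega>_4 on )
    show "T 1 4 4 2 = 0" "T 1 4 4 1 = T 2 4 4 2"
      unfolding T4 by (simp_all add: Rm_grad p eig d\<phi> \<omega>_4 on )
  qed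
  then show ?thesis by (simp add: T_def[abs_def] curv_comp_eq p)
qed

end

section \<open>Change of charts\<close>

text \<open>Two charts used over the same set of points; \<open>t\<close> is the differential of
  the coordinate change from \<open>c\<close> to \<open>d\<close>.\<close>

locale chart_pair = C: chart_domain c U + D: chart_domain d U
  for c :: "('m, 'e::euclidean_space) chart" and d :: "('m, 'e) chart" and U +
  assumes chart_smooth_cd: "C.chart_smooth (cmap d)" and chart_smooth_dc: "D.chart_smooth (cmap c)"
begin

abbreviation "t \<equiv> dd c (cmap d)"

lemma chart_smooth_transfer:
  assumes "D.chart_smooth f" shows "C.chart_smooth f"
proof -
  have "smooth_on (cmap c ` U) (\<lambda>z. f (cinv d (cmap d (cinv c z))))"
    by (rule smooth_on_compose[OF chart_smooth_cd[unfolded C.chart_smooth_def] _ assms[unfolded D.chart_smooth_def]]) (auto simp: C.cinv_cmap)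
  then have "C.chart_smooth (\<lambda>q. f (cinv d (cmap d q)))" by (simp add: C.chart_smooth_def)
  then show ?thesis
    by (rule iffD1[OF C.chart_smooth_cong, rotated]) (simp add: D.cinv_cmap)
qed

lemma chain_rule:
  assumes f: "D.chart_smooth f" and p: "p \<in> U"
  shows "dd d f p (t p x) = dd c f p x"
proof -
  have img: "(\<lambda>z. cmap d (cinv c z)) ` (cmap c ` U) = cmap d ` U"
    by (auto simp: C.cinv_cmap image_iff)
  have "((\<lambda>z. f (cinv d z)) has_derivative dd d f p) (at (cmap d (cinv c (cmap c p))) within (\<lambda>z. cmap d (cinv c z)) ` (cmap c ` U))"
    unfolding img C.cinv_cmap[OF p] by (rule D.chart_smooth_has_derivative[OF f p])
  from has_derivative_in_compose[OF C.chart_smooth_has_derivative[OF chart_smooth_cd p] this]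
  have "((\<lambda>z. f (cinv d (cmap d (cinv c z)))) has_derivative (\<lambda>x. dd d f p (t p x))) (at (cmap c p) within cmap c ` U)" .
  from C.ddI[OF p this] have "dd c (\<lambda>q. f (cinv d (cmap d q))) p x = dd d f p (t p x)" by simp
  moreover have "dd c (\<lambda>q. f (cinv d (cmap d q))) p x = dd c f p x"
    by (rule C.dd_cong[OF _ p]) (simp add: D.cinv_cmap)
  ultimately show ?thesis by simp
qed

lemma dd_cmap_self: "p \<in> U \<Longrightarrow> dd d (cmap d) p y = y"
proof -
  assume p: "p \<in> U"
  have "dd d (cmap d) p = (\<lambda>y. y)"
  proof (rule D.ddI[OF p], rule has_derivative_transform)
    show "((\<lambda>z. z) has_derivative (\<lambda>y. y)) (at (cmap d p) within cmap d ` U)" by (rule has_derivative_ident)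
  qed (use p in \<open>auto simp: D.cinv_cmap\<close>)
  then show ?thesis by simp
qed

lemma t_linear: "p \<in> U \<Longrightarrow> linear (t p)"
  by (rule C.dd_linear[OF chart_smooth_cd])

lemma t_surj:
  assumes "p \<in> U" obtains x where "y = t p x"
proof -
  interpret DC: chart_pair d c U by unfold_locales (rule chart_smooth_dc, rule chart_smooth_cd)
  from DC.chain_rule[OF chart_smooth_cd assms, of y] dd_cmap_self[OF assms, of y]
  show thesis using that by metis
qed

text \<open>The derivative of \<open>t\<close> is the second derivative of the coordinate
  change.\<close>

lemma t_symmetric: "p \<in> U \<Longrightarrow> dd c (\<lambda>q. t q a) p x = dd c (\<lambda>q. t q x) p a"
  by (rule C.dd_commute[OF chart_smooth_cd])

text \<open>The two coordinate expressions represent one smooth vector field over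
  \<open>U\<close>.\<close>

definition natural :: "('m, 'e) vfield \<Rightarrow> bool" where
  "natural X \<longleftrightarrow> C.chart_smooth (X c) \<and> D.chart_smooth (X d) \<and> (\<forall>q\<in>U. X d q = t q (X c q))"

text \<open>Coordinate derivatives of a vector field transform with an additional second-order
  term, symmetric by \<open>t_symmetric\<close>: it drops out of Lie brackets, and in covariant
  derivatives it is compensated by \<open>christoffel_transform\<close>.\<close>

lemma dd_natural:
  assumes X: "natural X" and p: "p \<in> U"
  shows "dd d (X d) p (t p x) = dd c (\<lambda>q. t q (X c p)) p x + t p (dd c (X c) p x)"
proof -
  have "dd d (X d) p (t p x) = dd c (X d) p x"
    using chain_rule[OF _ p, of "X d" x] X by (simp add: natural_def)
  also have "\<dots> = dd c (\<lambda>q. t q (X c q)) p x"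
    by (rule C.dd_cong[OF _ p]) (use X in \<open>simp add: natural_def\<close>)
  also have "\<dots> = dd c (\<lambda>q. t q (X c p)) p x + t p (dd c (X c) p x)"
    by (rule C.dd_linear_apply[OF t_linear C.chart_smooth_dd[OF chart_smooth_cd] _ p]) (use X in \<open>simp_all add: natural_def\<close>)
  finally show ?thesis .
qed

end

locale metric_chart_pair = C: metric_chart c U g + D: metric_chart d U g + chart_pair c d U
  for c d :: "('m, real^'n) chart" and U g +
  assumes isometry: "p \<in> U \<Longrightarrow> g d p (dd c (cmap d) p x) (dd c (cmap d) p y) = g c p x y"
begin

text \<open>Read as a trilinear form \<open>s\<close> on vectors of the chart \<open>c\<close>,
  the right-hand side is symmetric in its first two arguments and compatible with the metric.
  These two properties characterise the Christoffel symbols of \<open>c\<close> by the Koszul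
  formula.\<close>

lemma christoffel_transform:
  assumes p: "p \<in> U"
  shows "t p (C.\<Gamma> p x a) = D.\<Gamma> p (t p x) (t p a) + dd c (\<lambda>q. t q a) p x"
proof -
  define s where "s x a b = g d p (D.\<Gamma> p (t p x) (t p a) + dd c (\<lambda>q. t q a) p x) (t p b)" for x a b
  have ct: "C.chart_smooth (\<lambda>q. t q a)" for a by (rule C.chart_smooth_dd[OF chart_smooth_cd])
  have s_sym: "s x a b = s a x b" for x a b
    using D.christoffel_sym[OF p] t_symmetric[OF p] by (simp add: s_def)
  have s_metric: "dd c (\<lambda>q. g c q a b) p x = s x a b + s x b a" for x a b
  proof -
    have "dd c (\<lambda>q. g c q a b) p x = dd c (\<lambda>q. g d q (t q a) (t q b)) p x"
      by (rule C.dd_cong[OF _ p]) (simp add: isometry)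
    also have "\<dots> = dd c (\<lambda>q. g d q (t p a) (t p b)) p x + g d p (dd c (\<lambda>q. t q a) p x) (t p b)
        + g d p (t p a) (dd c (\<lambda>q. t q b) p x)"
      by (rule C.dd_bilinear_apply[OF D.g_bilinear chart_smooth_transfer[OF D.chart_smooth_g] ct ct p])
    also have "dd c (\<lambda>q. g d q (t p a) (t p b)) p x = dd d (\<lambda>q. g d q (t p a) (t p b)) p (t p x)"
      by (rule chain_rule[OF D.chart_smooth_g p, symmetric])
    finally show ?thesis
      by (simp add: D.christoffel_metric[OF p] s_def D.g_simps[OF p] D.g_sym[OF p, of "t p a"])
  qed
  have "g c p (C.\<Gamma> p x a) b = s x a b" for b
    unfolding C.koszul[OF p] s_metric
    using s_sym[of x a b] s_sym[of x b a] s_sym[of a b x] by simp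
  then have *: "g d p (t p (C.\<Gamma> p x a)) (t p b) = s x a b" for b by (simp add: isometry p)
  show ?thesis
  proof (rule D.g_ext[OF p])
    fix y
    obtain b where "y = t p b" by (rule t_surj[OF p])
    then show "g d p (t p (C.\<Gamma> p x a)) y = g d p (D.\<Gamma> p (t p x) (t p a) + dd c (\<lambda>q. t q a) p x) y"
      using *[of b] by (simp add: s_def)
  qed
qed

lemma natural_nabla:
  assumes X: "natural X" and Y: "natural Y"
  shows "natural (nabla g X Y)"
proof -
  have "nabla g X Y d q = t q (nabla g X Y c q)" if q: "q \<in> U" for q
  proof -
    have "nabla g X Y d q = dd d (Y d) q (t q (X c q)) + D.\<Gamma> q (t q (X c q)) (t q (Y c q))"
      using X Y q by (simp add: nabla_def natural_def)
    also have "\<dots> = t q (nabla g X Y c q)"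
      by (simp add: dd_natural[OF Y q] christoffel_transform[OF q] nabla_def linear_add[OF t_linear[OF q]])
    finally show ?thesis .
  qed
  then show ?thesis using X Y C.chart_smooth_nabla D.chart_smooth_nabla by (simp add: natural_def)
qed

lemma natural_lie_bracket:
  assumes X: "natural X" and Y: "natural Y"
  shows "natural (lie_bracket X Y)"
proof -
  have "lie_bracket X Y d q = t q (lie_bracket X Y c q)" if q: "q \<in> U" for q
  proof -
    have "X d q = t q (X c q)" "Y d q = t q (Y c q)" using X Y q by (auto simp: natural_def)
    then show ?thesis
      using t_symmetric[OF q, of "X c q" "Y c q"]
      by (simp add: lie_bracket_def dd_natural[OF X q] dd_natural[OF Y q] linear_diff[OF t_linear[OF q]])
  qed
  then show ?thesis using X Y C.chart_smooth_lie_bracket D.chart_smooth_lie_bracket by (simp add: natural_def)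
qed

lemma curv_natural:
  assumes "natural X" "natural Y" "natural Z" and p: "p \<in> U"
  shows "curv g X Y Z d p = t p (curv g X Y Z c p)"
  using natural_nabla[OF assms(2) natural_nabla[OF assms(1,3)]] natural_nabla[OF assms(1) natural_nabla[OF assms(2,3)]]
    natural_nabla[OF natural_lie_bracket[OF assms(1,2)] assms(3)] p
  by (simp add: natural_def curv_def linear_add[OF t_linear] linear_diff[OF t_linear])

end

locale skr_frame_chart_pair = metric_chart_pair c d U g + C: skr_frame_chart c U g J \<tau> w + D: skr_frame_chart d U g J \<tau> w
  for c d :: "('m, real^4) chart" and U g J \<tau> w +
  assumes J_natural: "p \<in> U \<Longrightarrow> J d p (dd c (cmap d) p x) = dd c (cmap d) p (J c p x)"
    and w_natural: "p \<in> U \<Longrightarrow> w d p = dd c (cmap d) p (w c p)"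
begin

lemma grad_natural: "p \<in> U \<Longrightarrow> grad g \<tau> d p = t p (grad g \<tau> c p)"
proof (rule D.g_ext)
  fix y assume p: "p \<in> U"
  obtain b where "y = t p b" by (rule t_surj[OF p])
  then show "g d p (grad g \<tau> d p) y = g d p (t p (grad g \<tau> c p)) y"
    by (simp add: D.grad_dual C.grad_dual p isometry chain_rule[OF D.chart_smooth_\<tau>])
qed

lemma skr_frame_natural: "natural (skr_frame g J \<tau> w i)"
  unfolding natural_def
proof (intro conjI ballI)
  fix q assume q: "q \<in> U"
  have "Qfun g \<tau> d q = Qfun g \<tau> c q" "Jgrad g J \<tau> d q = t q (Jgrad g J \<tau> c q)"
    by (simp_all add: Qfun_def Jgrad_def grad_natural isometry J_natural q)
  then show "skr_frame g J \<tau> w i d q = t q (skr_frame g J \<tau> w i c q)"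
    using linear_cmul[OF t_linear[OF q]] linear_neg[OF t_linear[OF q]] J_natural[OF q]
    by (simp add: skr_frame_def grad_natural w_natural isometry q flip: J_natural)
qed (rule C.chart_smooth_skr_frame, rule D.chart_smooth_skr_frame)

lemma curv_comp_natural:
  assumes "p \<in> U"
  shows "curv_comp g (skr_frame g J \<tau> w) i j k l d p = curv_comp g (skr_frame g J \<tau> w) i j k l c p"
proof -
  have "skr_frame g J \<tau> w l d p = t p (skr_frame g J \<tau> w l c p)"
    using skr_frame_natural[of l] assms by (simp add: natural_def)
  then show ?thesis
    using curv_natural[OF skr_frame_natural skr_frame_natural skr_frame_natural assms]
    by (simp add: curv_comp_def isometry assms)
qed

end

section \<open>From charts to the manifold\<close>

lemma chart_domainI:
  assumes A: "smooth_manifold A" and c: "c \<in> A" and U: "U \<subseteq> cdom c"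
    and op: "openin (top_of_set (cimg c)) (cmap c ` U)"
  shows "chart_domain c U"
proof
  have h: "homeomorphism (cdom c) (cimg c) (cmap c) (cinv c)"
    and n: "\<exists>n. openin (top_of_set {x. 0 \<le> x \<bullet> n}) (cimg c)"
    using A c unfolding smooth_manifold_def by auto
  show "inj_on (cmap c) (cdom c)" using h by (metis homeomorphism_def inj_on_inverseI)
  show "half_space_open (cimg c)" using n by (simp add: half_space_open_def)
qed (use U op in auto)

lemma openin_chart_image:
  assumes A: "smooth_manifold A" and c: "c \<in> A" and U: "open_in A U"
  shows "openin (top_of_set (cimg c)) (cmap c ` (cdom c \<inter> U))"
proof -
  have "openin (top_of_set (cdom c)) (cdom c \<inter> U)"
    using U c unfolding open_in_def openin_open pts_def by blast
  moreover have "homeomorphism (cdom c) (cimg c) (cmap c) (cinv c)"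
    using A c unfolding smooth_manifold_def by auto
  ultimately show ?thesis by (rule homeomorphism_imp_open_map[rotated])
qed

lemma open_in_Int_cdom:
  assumes A: "smooth_manifold A" and d: "d \<in> A" and U: "open_in A U"
  shows "open_in A (cdom d \<inter> U)"
  using assms unfolding smooth_manifold_def open_in_def by (blast intro: openin_Int)

lemma chart_pairI:
  assumes A: "smooth_manifold A" and c: "c \<in> A" and d: "d \<in> A" and U: "open_in A U"
  shows "chart_pair c d (cdom c \<inter> cdom d \<inter> U)"
proof -
  let ?V = "cdom c \<inter> cdom d \<inter> U"
  have Vc: "?V = cdom c \<inter> (cdom d \<inter> U)" and Vd: "?V = cdom d \<inter> (cdom c \<inter> U)" by auto
  interpret C: chart_domain c ?V
    by (rule chart_domainI[OF A c]) (auto simp only: Vc intro!: openin_chart_image[OF A c] open_in_Int_cdom[OF A d U])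
  interpret D: chart_domain d ?V
    by (rule chart_domainI[OF A d]) (auto simp only: Vd intro!: openin_chart_image[OF A d] open_in_Int_cdom[OF A c U])
  have "smooth_on (cmap c ` (cdom c \<inter> cdom d)) (cmap d \<circ> cinv c)" "smooth_on (cmap d ` (cdom d \<inter> cdom c)) (cmap c \<circ> cinv d)"
    using A c d unfolding smooth_manifold_def by auto
  then have "C.chart_smooth (cmap d)" "D.chart_smooth (cmap c)"
    unfolding C.chart_smooth_def D.chart_smooth_def o_def by (auto elim!: smooth_on_subset)
  then show ?thesis by unfold_locales
qed

text \<open>Regularity is defined through some chart around the point; by the chain rule any other
  chart detects it too.\<close>

lemma regular_set_iff:
  assumes A: "smooth_manifold A" and \<tau>: "smooth_fun A (pts A) \<tau>" and p: "p \<in> regular_set A \<tau>"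
    and c: "c \<in> A" "p \<in> cdom c"
  shows "\<exists>x. dd c \<tau> p x \<noteq> 0"
proof -
  from p obtain d x where d: "d \<in> A" "p \<in> cdom d" "dd d \<tau> p x \<noteq> 0" unfolding regular_set_def by blast
  have "open_in A (pts A)" by (simp add: open_in_def)
  then interpret chart_pair d c "cdom d \<inter> cdom c \<inter> pts A" by (rule chart_pairI[OF A d(1) c(1)])
  have "smooth_on (cmap c ` (cdom c \<inter> pts A)) (\<tau> \<circ> cinv c)" using \<tau> c unfolding smooth_fun_def by auto
  then have "D.chart_smooth \<tau>" unfolding D.chart_smooth_def o_def by (auto elim!: smooth_on_subset)
  moreover have "p \<in> cdom d \<inter> cdom c \<inter> pts A" using d c by (auto simp: pts_def)
  ultimately have "dd c \<tau> p (dd d (cmap c) p x) = dd d \<tau> p x" by (rule chain_rule)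
  with d(3) show ?thesis by metis
qed

lemma skr_frame_chartI:
  assumes cs: "compact_skr_with_boundary A g J \<tau>" and U: "U \<subseteq> regular_set A \<tau>"
    and w: "vector_field A U w" and w0: "\<forall>p\<in>U. \<forall>ch\<in>A. p \<in> cdom ch \<longrightarrow> w ch p \<noteq> 0"
    and c: "c \<in> A" and V: "V \<subseteq> cdom c \<inter> U" and op: "openin (top_of_set (cimg c)) (cmap c ` V)"
  shows "skr_frame_chart c V g J \<tau> w"
proof -
  have A: "smooth_manifold A" and g: "riemannian_metric A (pts A) g" and J: "endo_field A (pts A) J"
    and \<tau>: "smooth_fun A (pts A) \<tau>"
    using cs unfolding compact_skr_with_boundary_def by auto
  have Vp: "V \<subseteq> cdom c \<inter> pts A" using V c by (auto simp: pts_def)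
  interpret chart_domain c V by (rule chart_domainI[OF A c _ op]) (use V in auto)
  have sm: "chart_smooth f" if "smooth_on (cmap c ` (cdom c \<inter> W)) (\<lambda>z. f (cinv c z))" "V \<subseteq> W" for f :: "'a \<Rightarrow> 'b::real_normed_vector" and W
    using that V unfolding chart_smooth_def by (auto elim!: smooth_on_subset)
  have VA: "V \<subseteq> pts A" using Vp by auto
  have VU: "V \<subseteq> U" using V by auto
  show ?thesis
  proof unfold_locales
    fix p x y assume p: "p \<in> V"
    then have p': "p \<in> cdom c \<inter> pts A" using Vp by auto
    show "bilinear (g c p)" "g c p x y = g c p y x"
      using g c p' unfolding riemannian_metric_def by blast+
    show "0 < g c p x x" if "x \<noteq> 0"
      using g c p' that unfolding riemannian_metric_def by blast
    have "linear (J c p)" using J c p' unfolding endo_field_def by blast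
    then show "J c p (x + y) = J c p x + J c p y" "J c p (k *\<^sub>R x) = k *\<^sub>R J c p x" for k
      by (simp_all add: linear_add linear_cmul)
    show "\<exists>x. dd c \<tau> p x \<noteq> 0"
      using regular_set_iff[OF A \<tau> _ c, of p] U p V by auto
    show "w c p \<noteq> 0" using w0 p V c by auto
  next
    fix x y
    show "chart_smooth (\<lambda>q. g c q x y)"
      by (rule sm[OF _ VA]) (use g c in \<open>simp add: riemannian_metric_def\<close>)
    show "chart_smooth (\<lambda>q. J c q x)"
      by (rule sm[OF _ VA]) (use J c in \<open>simp add: endo_field_def\<close>)
  next
    show "chart_smooth \<tau>" by (rule sm[OF _ VA]) (use \<tau> c in \<open>simp add: smooth_fun_def o_def\<close>)
    show "chart_smooth (w c)" by (rule sm[OF _ VU]) (use w c in \<open>simp add: vector_field_def\<close>)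
  qed
qed

text \<open>The SKR equations hold over the points \<open>?V\<close> of the interior. Since the
  equations to be shown are closed conditions, this is enough.\<close>

lemma curvature_pattern_global:
  assumes F: "fibered_skr_4manifold A g J \<tau> B h J' \<pi>"
    and L: "horizontal_lift A g J \<tau> B \<pi> U V X w"
    and w0: "\<forall>p\<in>U. \<forall>ch\<in>A. p \<in> cdom ch \<longrightarrow> w ch p \<noteq> 0"
    and c: "c \<in> A" and p: "p \<in> cdom c \<inter> U"
  shows "skr_curvature_pattern (\<lambda>i j k l. curv_comp g (skr_frame g J \<tau> w) i j k l c p)"
    and "i \<in> {1..4} \<Longrightarrow> j \<in> {1..4} \<Longrightarrow>
      g c p (skr_frame g J \<tau> w i c p) (skr_frame g J \<tau> w j c p) = (if i = j then 1 else 0)"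
proof -
  have cs: "compact_skr_with_boundary A g J \<tau>" using F by (simp add: fibered_skr_4manifold_def)
  then have A: "smooth_manifold A" and S: "skr_structure A (minterior A) g J \<tau>"
    by (simp_all add: compact_skr_with_boundary_def)
  then have K: "kaehler A (minterior A) g J" and kf: "killing_field A (minterior A) g (Jgrad g J \<tau>)"
    by (simp_all add: skr_structure_def killing_potential_def)
  have opU: "open_in A U" and U: "U \<subseteq> regular_set A \<tau>" and w: "vector_field A U w"
    and hor: "\<And>p. p \<in> cdom c \<inter> U \<Longrightarrow> w c p \<in> horiz g J \<tau> c p"
    using L c unfolding horizontal_lift_def by auto
  let ?U = "cdom c \<inter> U" and ?V = "{q \<in> cdom c \<inter> U. cmap c q \<in> interior (cimg c)}"
  have op: "openin (top_of_set (cimg c)) (cmap c ` ?U)" by (rule openin_chart_image[OF A c opU])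
  interpret W: skr_frame_chart c ?U g J \<tau> w
    by (rule skr_frame_chartI[OF cs U w w0 c _ op]) simp
  have "cmap c ` ?V = cmap c ` ?U \<inter> interior (cimg c)" by auto
  then have opV: "openin (top_of_set (cimg c)) (cmap c ` ?V)"
    using op by (simp add: openin_Int_open)
  interpret I: skr_frame_chart c ?V g J \<tau> w
    by (rule skr_frame_chartI[OF cs U w w0 c _ opV]) auto
  have Vint: "?V \<subseteq> minterior A" using c by (auto simp: minterior_def)
  obtain \<phi> where \<phi>: "\<forall>p\<in>regular_set A \<tau>. \<forall>c\<in>A. p \<in> cdom c \<longrightarrow>
              (\<forall>x\<in>horiz g J \<tau> c p. \<forall>y\<in>horiz g J \<tau> c p. hess g \<tau> c p x y = \<phi> p * g c p x y)"
    and Q: "(\<exists>cbar. \<forall>p\<in>regular_set A \<tau>. \<forall>c\<in>A. p \<in> cdom c \<longrightarrow> Qfun g \<tau> c p = 2 * (\<tau> p - cbar) * \<phi> p) \<or>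
           (\<forall>p\<in>regular_set A \<tau>. \<phi> p = 0)"
    using F unfolding fibered_skr_4manifold_def by blast
  interpret K: kaehler_skr_chart c ?V g J \<tau> w \<phi>
  proof unfold_locales
    fix p x y assume p: "p \<in> ?V"
    then have pi: "p \<in> minterior A" "p \<in> cdom c" "p \<in> U" "p \<in> regular_set A \<tau>" using Vint U by auto
    note Kp = K[unfolded kaehler_def, THEN conjunct2, THEN conjunct2, rule_format, OF pi(1) c pi(2)]
    show "J c p (J c p x) = - x" "g c p (J c p x) (J c p y) = g c p x y" using Kp by blast+
    have "nabla g (cfield x) (\<lambda>c q. J c q y) c p = J c p (nabla g (cfield x) (cfield y) c p)" using Kp by blast
    then show "I.nab (\<lambda>q. J c q y) p x = J c p (I.nab (\<lambda>q. y) p x)"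
      by (simp add: I.nabla_eq_nab cfield_def)
    show "lie_metric g (Jgrad g J \<tau>) c p x y = 0"
      using kf pi c unfolding killing_field_def by blast
    show "w c p \<in> horiz g J \<tau> c p" using hor pi by simp
    show "\<exists>\<mu>. hess_endo g \<tau> c p x = \<mu> *\<^sub>R x" if "x \<in> horiz g J \<tau> c p" "x \<noteq> 0"
      using S c pi that unfolding skr_structure_def by blast
    show "hess g \<tau> c p x y = \<phi> p * g c p x y" if "x \<in> horiz g J \<tau> c p" "y \<in> horiz g J \<tau> c p"
      using \<phi> c pi that by blast
  next
    show "(\<exists>\<kappa>. \<forall>p\<in>?V. Qfun g \<tau> c p = 2 * (\<tau> p - \<kappa>) * \<phi> p) \<or> (\<forall>p\<in>?V. \<phi> p = 0)"
      using Q c U by blast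
  qed
  show "skr_curvature_pattern (\<lambda>i j k l. curv_comp g (skr_frame g J \<tau> w) i j k l c p)"
    by (rule W.curvature_pattern_closed[OF _ p]) (rule K.curvature_pattern_interior, simp)
  show "g c p (skr_frame g J \<tau> w i c p) (skr_frame g J \<tau> w j c p) = (if i = j then 1 else 0)"
    if ij: "i \<in> {1..4}" "j \<in> {1..4}"
  proof -
    let ?f = "\<lambda>q. g c q (skr_frame g J \<tau> w i c q) (skr_frame g J \<tau> w j c q) - (if i = j then 1 else 0)"
    have "?f p = 0"
    proof (rule W.chart_smooth_vanishes_on_closure[OF _ _ p, where f = ?f])
      show "W.chart_smooth ?f" by (intro W.chart_smooth_diff W.chart_smooth_metric W.chart_smooth_skr_frame W.chart_smooth_const)
      show "?f q = 0" if "q \<in> ?U" "cmap c q \<in> interior (cimg c)" for q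
        using K.e_orthonormal[OF _ ij, of q] that by simp
    qed
    then show ?thesis by simp
  qed
qed

text \<open>The frame consists of vector fields, and curvature and metric are compatible with
  coordinate changes.\<close>

lemma curv_comp_chart_independent:
  assumes F: "fibered_skr_4manifold A g J \<tau> B h J' \<pi>"
    and L: "horizontal_lift A g J \<tau> B \<pi> U V X w"
    and w0: "\<forall>p\<in>U. \<forall>ch\<in>A. p \<in> cdom ch \<longrightarrow> w ch p \<noteq> 0"
    and c: "c \<in> A" "p \<in> cdom c" and d: "d \<in> A" "p \<in> cdom d" and p: "p \<in> U"
  shows "curv_comp g (skr_frame g J \<tau> w) i j k l d p = curv_comp g (skr_frame g J \<tau> w) i j k l c p"
proof -
  have cs: "compact_skr_with_boundary A g J \<tau>" using F by (simp add: fibered_skr_4manifold_def)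
  then have A: "smooth_manifold A" and g: "riemannian_metric A (pts A) g" and J: "endo_field A (pts A) J"
    by (simp_all add: compact_skr_with_boundary_def)
  have opU: "open_in A U" and U: "U \<subseteq> regular_set A \<tau>" and w: "vector_field A U w"
    using L unfolding horizontal_lift_def by auto
  let ?V = "cdom c \<inter> cdom d \<inter> U"
  interpret P: chart_pair c d ?V by (rule chart_pairI[OF A c(1) d(1) opU])
  interpret C: skr_frame_chart c ?V g J \<tau> w
    by (rule skr_frame_chartI[OF cs U w w0 c(1) _ P.C.open_img]) auto
  interpret D: skr_frame_chart d ?V g J \<tau> w
    by (rule skr_frame_chartI[OF cs U w w0 d(1) _ P.D.open_img]) auto
  interpret skr_frame_chart_pair c d ?V g J \<tau> w
  proof unfold_locales
    fix q x y assume "q \<in> ?V"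
    then have q: "q \<in> cdom c \<inter> cdom d \<inter> pts A" "q \<in> cdom c \<inter> cdom d \<inter> U" using c by (auto simp: pts_def)
    have t: "trans_d c d q z = dd c (cmap d) q z" for z by (simp add: dmap_def)
    have "\<forall>p\<in>cdom c \<inter> cdom d \<inter> pts A. \<forall>x y. g d p (trans_d c d p x) (trans_d c d p y) = g c p x y"
      using g c(1) d(1) unfolding riemannian_metric_def by blast
    with q(1) have "g d q (trans_d c d q x) (trans_d c d q y) = g c q x y" by blast
    then show "g d q (dd c (cmap d) q x) (dd c (cmap d) q y) = g c q x y" by (simp only: t)
    have "\<forall>p\<in>cdom c \<inter> cdom d \<inter> pts A. \<forall>x. J d p (trans_d c d p x) = trans_d c d p (J c p x)"
      using J c(1) d(1) unfolding endo_field_def by blast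
    with q(1) have "J d q (trans_d c d q x) = trans_d c d q (J c q x)" by blast
    then show "J d q (dd c (cmap d) q x) = dd c (cmap d) q (J c q x)" by (simp only: t)
    have "\<forall>p\<in>cdom c \<inter> cdom d \<inter> U. w d p = trans_d c d p (w c p)"
      using w c(1) d(1) unfolding vector_field_def by blast
    with q(2) have "w d q = trans_d c d q (w c q)" by blast
    then show "w d q = dd c (cmap d) q (w c q)" by (simp only: t)
  qed
  show ?thesis by (rule curv_comp_natural) (use c d p in simp)
qed

lemma curv_form_expand:
  "curv_form g e i j c p x y =
     curv_comp g e i j 1 2 c p * coframe_wedge e 1 2 c p x y + curv_comp g e i j 1 3 c p * coframe_wedge e 1 3 c p x y
   + curv_comp g e i j 1 4 c p * coframe_wedge e 1 4 c p x y + curv_comp g e i j 2 3 c p * coframe_wedge e 2 3 c p x y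
   + curv_comp g e i j 2 4 c p * coframe_wedge e 2 4 c p x y + curv_comp g e i j 3 4 c p * coframe_wedge e 3 4 c p x y"
proof -
  have "{1..4} = {1,2,3,4::nat}" "{1<..4} = {2,3,4::nat}" "{2<..4} = {3,4::nat}" "{3<..4} = {4::nat}"
    by auto
  then show ?thesis by (simp add: curv_form_def)
qed

theorem proposition10p5:
  fixes A :: "('m::{t2_space,second_countable_topology}, real^4) chart set"
    and g :: "('m, real^4) bilfield"
    and J :: "('m, real^4) endofield"
    and \<tau> :: "'m \<Rightarrow> real"
    and B :: "('n::{t2_space,second_countable_topology}, real^2) chart set"
    and h :: "('n, real^2) bilfield"
    and J' :: "('n, real^2) endofield"
    and \<pi> :: "'m \<Rightarrow> 'n"
    and U :: "'m set" and V :: "'n set"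
    and X :: "('n, real^2) vfield" and w :: "('m, real^4) vfield"
    and e :: "nat \<Rightarrow> ('m, real^4) vfield"
  assumes "fibered_skr_4manifold A g J \<tau> B h J' \<pi>"
    and "horizontal_lift A g J \<tau> B \<pi> U V X w"
    and "\<forall>p\<in>U. \<forall>ch\<in>A. p \<in> cdom ch \<longrightarrow> w ch p \<noteq> 0"
    and "e = skr_frame g J \<tau> w"
  shows "(\<forall>p\<in>U. \<forall>ch\<in>A. p \<in> cdom ch \<longrightarrow>
            (\<forall>i\<in>{1..4}. \<forall>j\<in>{1..4}. g ch p (e i ch p) (e j ch p) = (if i = j then 1 else 0))) \<and>
         (\<exists>b c d r :: 'm \<Rightarrow> real. \<forall>p\<in>U. \<forall>ch\<in>A. p \<in> cdom ch \<longrightarrow>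
            (\<forall>x y. let R = (\<lambda>i j. curv_form g e i j ch p x y);
                       E = (\<lambda>k l. coframe_wedge e k l ch p x y);
                       \<beta> = b p * E 1 2 + c p * E 3 4;
                       \<delta> = c p * E 1 2 + d p * E 3 4;
                       \<rho> = r p * (E 1 3 + E 2 4);
                       \<sigma> = r p * (E 1 4 - E 2 3)
                   in [[R 1 1, R 1 2, R 1 3, R 1 4],
                       [R 2 1, R 2 2, R 2 3, R 2 4],
                       [R 3 1, R 3 2, R 3 3, R 3 4],
                       [R 4 1, R 4 2, R 4 3, R 4 4]] =
                      [[0, \<beta>, \<rho>, \<sigma>],
                       [- \<beta>, 0, - \<sigma>, \<rho>],
                       [- \<rho>, \<sigma>, 0, \<delta>],
                       [- \<sigma>, - \<rho>, - \<delta>, 0]]))"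
proof (intro conjI)
  note pattern = curvature_pattern_global[OF assms(1-3), folded assms(4)]
  show "\<forall>p\<in>U. \<forall>ch\<in>A. p \<in> cdom ch \<longrightarrow>
      (\<forall>i\<in>{1..4}. \<forall>j\<in>{1..4}. g ch p (e i ch p) (e j ch p) = (if i = j then 1 else 0))"
    using pattern(2) by blast
  \<comment> \<open>The coefficient functions are read off in an arbitrary chart around each point.\<close>
  define K where "K i j k l p = curv_comp g e i j k l (SOME ch. ch \<in> A \<and> p \<in> cdom ch) p" for i j k l p
  have K: "K i j k l p = curv_comp g e i j k l ch p" if "p \<in> U" "ch \<in> A" "p \<in> cdom ch" for i j k l p ch
  proof -
    have "(SOME ch. ch \<in> A \<and> p \<in> cdom ch) \<in> A \<and> p \<in> cdom (SOME ch. ch \<in> A \<and> p \<in> cdom ch)"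
      using someI[of "\<lambda>ch. ch \<in> A \<and> p \<in> cdom ch" ch] that by blast
    then show ?thesis
      unfolding K_def using curv_comp_chart_independent[OF assms(1-3), folded assms(4)] that by blast
  qed
  show "\<exists>b c d r :: 'm \<Rightarrow> real. \<forall>p\<in>U. \<forall>ch\<in>A. p \<in> cdom ch \<longrightarrow>
            (\<forall>x y. let R = (\<lambda>i j. curv_form g e i j ch p x y);
                       E = (\<lambda>k l. coframe_wedge e k l ch p x y);
                       \<beta> = b p * E 1 2 + c p * E 3 4;
                       \<delta> = c p * E 1 2 + d p * E 3 4;
                       \<rho> = r p * (E 1 3 + E 2 4);
                       \<sigma> = r p * (E 1 4 - E 2 3)
                   in [[R 1 1, R 1 2, R 1 3, R 1 4],
                       [R 2 1, R 2 2, R 2 3, R 2 4],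
                       [R 3 1, R 3 2, R 3 3, R 3 4],
                       [R 4 1, R 4 2, R 4 3, R 4 4]] =
                      [[0, \<beta>, \<rho>, \<sigma>],
                       [- \<beta>, 0, - \<sigma>, \<rho>],
                       [- \<rho>, \<sigma>, 0, \<delta>],
                       [- \<sigma>, - \<rho>, - \<delta>, 0]])"
  proof (intro exI ballI impI allI)
    fix p ch x y assume p: "p \<in> U" "ch \<in> A" "p \<in> cdom ch"
    define E where "E k l = coframe_wedge e k l ch p x y" for k l
    define R where "R i j = curv_form g e i j ch p x y" for i j
    have "p \<in> cdom ch \<inter> U" using p by simp
    from pattern(1)[OF p(2) this] have T: "skr_curvature_pattern (\<lambda>i j k l. K i j k l p)"
      by (simp add: K[OF p])
    have R: "R i j = K i j 1 2 p * E 1 2 + K i j 1 3 p * E 1 3 + K i j 1 4 p * E 1 4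
        + K i j 2 3 p * E 2 3 + K i j 2 4 p * E 2 4 + K i j 3 4 p * E 3 4" for i j
      by (simp add: R_def E_def curv_form_expand K[OF p])
    have skew: "R j i = - R i j" for i j
    proof -
      have "K j i k l p = - K i j k l p" for k l
        using T unfolding skr_curvature_pattern_def by (simp add: eq_neg_iff_add_eq_0)
      then show ?thesis by (simp add: R)
    qed
    have K1423: "K 1 4 2 3 p = - K 1 3 1 3 p"
      using T unfolding skr_curvature_pattern_def by (simp add: eq_neg_iff_add_eq_0)
    have R12: "R 1 2 = K 1 2 1 2 p * E 1 2 + K 1 2 3 4 p * E 3 4"
      and R34: "R 3 4 = K 1 2 3 4 p * E 1 2 + K 3 4 3 4 p * E 3 4"
      and R13: "R 1 3 = K 1 3 1 3 p * (E 1 3 + E 2 4)" and R14: "R 1 4 = K 1 3 1 3 p * (E 1 4 - E 2 3)"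
      using T unfolding skr_curvature_pattern_def R K1423 by (simp_all add: algebra_simps)
    have "R 2 3 = - R 1 4" "R 2 4 = R 1 3"
    proof -
      have "K 2 3 k l p = - K 1 4 k l p" "K 2 4 k l p = K 1 3 k l p" for k l
        using T unfolding skr_curvature_pattern_def by (simp_all add: eq_neg_iff_add_eq_0)
      then show "R 2 3 = - R 1 4" "R 2 4 = R 1 3" by (simp_all add: R)
    qed
    then show "let R = (\<lambda>i j. curv_form g e i j ch p x y);
                       E = (\<lambda>k l. coframe_wedge e k l ch p x y);
                       \<beta> = K 1 2 1 2 p * E 1 2 + K 1 2 3 4 p * E 3 4;
                       \<delta> = K 1 2 3 4 p * E 1 2 + K 3 4 3 4 p * E 3 4;
                       \<rho> = K 1 3 1 3 p * (E 1 3 + E 2 4);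
                       \<sigma> = K 1 3 1 3 p * (E 1 4 - E 2 3)
                   in [[R 1 1, R 1 2, R 1 3, R 1 4],
                       [R 2 1, R 2 2, R 2 3, R 2 4],
                       [R 3 1, R 3 2, R 3 3, R 3 4],
                       [R 4 1, R 4 2, R 4 3, R 4 4]] =
                      [[0, \<beta>, \<rho>, \<sigma>],
                       [- \<beta>, 0, - \<sigma>, \<rho>],
                       [- \<rho>, \<sigma>, 0, \<delta>],
                       [- \<sigma>, - \<rho>, - \<delta>, 0]]"
      unfolding Let_def R_def[symmetric] E_def[symmetric] R12[symmetric] R34[symmetric] R13[symmetric] R14[symmetric]
      using skew[of 1 1] skew[of 2 2] skew[of 3 3] skew[of 4 4]
        skew[of 1 2] skew[of 1 3] skew[of 1 4] skew[of 2 3] skew[of 2 4] skew[of 3 4] by simp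
  qed
qed

end
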